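(* For $-1<\nu<0$ and $0<\beta<\alpha<1$, $$[P_\nu(2\beta-1)]^2\int_0^\beta\frac{[P_\nu(1-2t)]^2dt}{t-\alpha}-P_\nu(1-2\beta)P_\nu(2\beta-1)\int_0^\beta\frac{P_\nu(1-2t)P_\nu(2t-1)dt}{t-\alpha}$$ $$=\frac{\pi[P_\nu(2\alpha-1)]^2P_\nu(1-2\beta)P_\nu(2\beta-1)}{2\sin(\nu\pi)}-\frac{\sin^2(\nu\pi)}{2\pi^2}P_\nu(2\beta-1)\int_0^1\left\{\int_0^U\left[\int_W^1\frac{dV}{\mathbb Y_{\nu,\alpha}(V)}\right]\frac{dW}{\mathbb Y_{-\nu-1,\alpha}(W)}\right\}\frac{dU}{\mathbb Y_{\nu,\beta}(U)}$$ $$-\frac{\sin^2(\nu\pi)}{2\pi^2}P_\nu(2\beta-1)\int_0^1\left\{\int_0^U\left[\int_W^1\frac{dV}{\mathbb Y_{-\nu-1,\alpha}(V)}\right]\frac{dW}{\mathbb Y_{\nu,\alpha}(W)}\right\}\frac{dU}{\mathbb Y_{-\nu-1,\beta}(U)}$$ $$-\frac{\sin(\nu\pi)P_\nu(1-2\alpha)P_\nu(2\beta-1)}{2\pi}\int_0^{1/\alpha}\left[\frac{1}{\mathscr U^{\nu+1}(1-\alpha\mathscr U)^{\nu+1}}\int_{\mathscr U}^1\frac{u^\nu}{(1-\beta u)^{-\nu}}\left(\frac{1-\mathscr U}{1-u}\right)^\nu\frac{du}{1-u}\right]d\mathscr U$$ $$-\frac{\sin(\nu\pi)P_\nu(1-2\alpha)P_\nu(2\beta-1)}{2\pi}\int_0^{1/\alpha}\left[\frac{1}{\mathscr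 U^{-\nu}(1-\alpha\mathscr U)^{-\nu}}\int_{\mathscr U}^1\frac{u^{-\nu-1}}{(1-\beta u)^{\nu+1}}\left(\frac{1-\mathscr U}{1-u}\right)^{-\nu-1}\frac{du}{1-u}\right]d\mathscr U,$$ where all integration paths are straight-line segments joining the endpoints.
   Context: For $-1<\nu<0$ and $t\in\mathbb C\setminus[1,+\infty)$, $P_\nu(1-2t):={}_2F_1(-\nu,\nu+1;1;t)=-\frac{\sin(\nu\pi)}{\pi}\int_0^1\left[\frac{u(1-tu)}{1-u}\right]^\nu\frac{du}{1-u}$ (Legendre function of the first kind; $P_\nu=P_{-\nu-1}$); thus $P_\nu(2t-1)={}_2F_1(-\nu,\nu+1;1;1-t)$. $\mathbb Y_{\nu,\alpha}(u):=\frac{(1-u)^{\nu+1}}{u^\nu(1-\alpha u)^\nu}$ (and $\mathbb Y_{-\nu-1,\alpha}$ is the same expression with $\nu$ replaced by $-\nu-1$). Fractional powers and logarithms use the principal branch ($\arg\in(-\pi,\pi]$, $\xi^\beta=e^{\beta\log\xi}$). *)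

theory Defs
  imports "HOL-Complex_Analysis.Complex_Analysis"
begin

(* Gauss's function on the plane cut along [1, infinity): the hypergeometric series inside the
   unit disc and its (unique) holomorphic continuation elsewhere. Values on the cut itself are
   unspecified. *)
definition hyp2F1 :: "complex \<Rightarrow> complex \<Rightarrow> complex \<Rightarrow> complex \<Rightarrow> complex" where
  "hyp2F1 a b c z =
     (if norm z < 1 then eval_fps (fps_hypergeo [a, b] [c] 1) z
      else (SOME f. f holomorphic_on - (of_real ` {1::real..}) \<and>
              (\<forall>w\<in>ball 0 1. f w = eval_fps (fps_hypergeo [a, b] [c] 1) w)) z)"

(* The argument is x = 1 - 2t, so that P_nu(1 - 2t) = 2F1(-nu, nu + 1; 1; t). *)
definition legendre_P :: "complex \<Rightarrow> complex \<Rightarrow> complex" where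
  "legendre_P \<nu> x = hyp2F1 (- \<nu>) (\<nu> + 1) 1 ((1 - x) / 2)"

definition YY :: "complex \<Rightarrow> complex \<Rightarrow> complex \<Rightarrow> complex" where
  "YY \<nu> \<alpha> u = (1 - u) powr (\<nu> + 1) / (u powr \<nu> * (1 - \<alpha> * u) powr \<nu>)"

abbreviation seg_integral :: "complex \<Rightarrow> complex \<Rightarrow> (complex \<Rightarrow> complex) \<Rightarrow> complex" where
  "seg_integral a b f \<equiv> contour_integral (linepath a b) f"

end

theory Submission
  imports Defs
begin

text \<open>
  Write \<open>F(t) = P\<^sub>\<nu>(1 - 2t)\<close>, \<open>Q(t) = F(1 - t)\<close>, \<open>s = sin(\<nu>\<pi>)\<close> and, for \<open>r \<in> {\<nu>, -\<nu> - 1}\<close>, let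
  \<open>f\<^sub>r(V) = 1 / Y\<^sub>r\<^sub>,\<^sub>\<alpha>(V)\<close> with \<open>1 - V\<close> replaced by its absolute value. Since \<open>\<integral>\<^sub>0\<^sup>1 f\<^sub>r\<close> is a multiple of \<open>F(\<alpha>)\<close>,
  Tonelli's theorem combines the second and fourth (third and fifth) terms on the right into one absolutely convergent triple
  integral \<open>S\<^sub>r(\<beta>)\<close> of \<open>f\<^sub>r(V) f\<^sub>-\<^sub>1\<^sub>-\<^sub>r(W) U\<^sup>r |1 - U|\<^sup>-\<^sup>1\<^sup>-\<^sup>r (1 - \<beta>U)\<^sup>r\<close> over \<open>0 < V < 1\<close>,
  \<open>V < W < 1/\<alpha>\<close> and \<open>U\<close> between \<open>W\<close> and \<open>1\<close>. Two facts determine the right-hand side as a function of \<open>\<beta>\<close>.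

  First, the Legendre operator in \<open>\<beta>\<close> turns the \<open>U\<close>-integrand into an exact derivative; the boundary term, multiplied by
  \<open>f\<^sub>-\<^sub>1\<^sub>-\<^sub>r(W)\<close>, is again exact, so \<open>S\<^sub>r\<close> solves a Legendre equation with right-hand side proportional to
  \<open>F(\<beta>) / (\<alpha> - \<beta>)\<close>. Second, at \<open>\<beta> = 0\<close> three Moebius substitutions reduce \<open>S\<^sub>r(0)\<close> to a double integral over a
  triangle, and the two triangles for \<open>r = \<nu>\<close> and \<open>r = -\<nu> - 1\<close> add up to a square, giving
  \<open>S\<^sub>\<nu>(0) + S\<^sub>-\<^sub>\<nu>\<^sub>-\<^sub>1(0) = (-\<pi>/s)\<^sup>3 Q(\<alpha>)\<^sup>2\<close>. Hence the right-hand side divided by \<open>Q(\<beta>)\<close> solves the inhomogeneous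
  equation and vanishes at \<open>0\<close>; variation of parameters with the Wronskian of \<open>F\<close> and \<open>Q\<close> yields the left-hand side.
\<close>

subsection \<open>Change of variables for nonnegative integrals\<close>

text \<open>Two obstacles shape the development: the integrands are singular, and \<open>W\<close>
  runs past 1, where the segment from \<open>W\<close> to 1 reverses while
  \<open>1 / (1 - u)\<close> changes sign. These two signs cancel, so with absolute values every
  integrand is nonnegative. Exchanges of order and substitutions then take place in extended
  nonnegative integrals, and finiteness comes afterwards from comparison with a product of two Euler
  integrals. The factor -pi/s is \<open>Beta (r + 1) (- r)\<close>, the value at 0 of the Euler
  integral; it is invariant under r -> -1-r. The Moebius maps succeed because the Jacobi weight has
  total exponent -1: the Jacobian leaves one linear denominator, and a weight with such a
  denominator has total exponent -2, at which every power of a new denominator cancels. Vanishing at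
  beta = 0 suffices as initial condition for an equation of order two because 0 is a singular point:
  Q is logarithmic there and t Q'(t) tends to a nonzero constant, so the boundary terms of the two
  Wronskians involve the value of the solution at 0 but not its derivative.\<close>

lemma absolutely_integrable_on_iff_nn_integral:
  fixes f :: "real \<Rightarrow> real"
  assumes [measurable]: "f \<in> borel_measurable borel" "S \<in> sets borel" and nn: "\<And>x. x \<in> S \<Longrightarrow> 0 \<le> f x"
  shows "f absolutely_integrable_on S \<longleftrightarrow> (\<integral>\<^sup>+x\<in>S. ennreal (f x) \<partial>lborel) < \<infinity>"
proof -
  have "f absolutely_integrable_on S \<longleftrightarrow> integrable lborel (\<lambda>x. indicator S x *\<^sub>R f x)"
    unfolding set_integrable_def by (rule integrable_completion) measurable
  also have "\<dots> \<longleftrightarrow> (\<integral>\<^sup>+x. ennreal (norm (indicator S x *\<^sub>R f x)) \<partial>lborel) < \<infinity>"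
    by (subst integrable_iff_bounded) auto
  also have "(\<integral>\<^sup>+x. ennreal (norm (indicator S x *\<^sub>R f x)) \<partial>lborel) = (\<integral>\<^sup>+x\<in>S. ennreal (f x) \<partial>lborel)"
    using nn by (intro nn_integral_cong) (auto split: split_indicator)
  finally show ?thesis .
qed

lemma set_nn_integral_eq_integral:
  fixes f :: "real \<Rightarrow> real"
  assumes "f \<in> borel_measurable borel" "S \<in> sets borel" and nn: "\<And>x. x \<in> S \<Longrightarrow> 0 \<le> f x"
    and "f absolutely_integrable_on S"
  shows "(\<integral>\<^sup>+x\<in>S. ennreal (f x) \<partial>lborel) = ennreal (integral S f)"
  by (rule nn_integral_has_integral_lebesgue'[OF nn integrable_integral[OF
        set_lebesgue_integral_eq_integral(1)[OF assms(4)]]])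

text \<open>Both sides may be infinite, so a substitution can be made before anything is known about
  convergence: absolute integrability transfers in both directions, and where it fails both
  integrals are infinite. The separate function \<open>h\<close> allows the new integrand to be
  given in simplified form, valid on \<open>S\<close> alone.\<close>

lemma nn_integral_change_of_variables:
  fixes f h g g' k :: "real \<Rightarrow> real"
  assumes [measurable]: "f \<in> borel_measurable borel" "h \<in> borel_measurable borel"
      "S \<in> sets borel" "T \<in> sets borel"
    and der: "\<And>x. x \<in> S \<Longrightarrow> (g has_real_derivative g' x) (at x)"
    and S: "\<And>x. x \<in> S \<Longrightarrow> g x \<in> T" "\<And>x. x \<in> S \<Longrightarrow> k (g x) = x"
    and T: "\<And>y. y \<in> T \<Longrightarrow> k y \<in> S" "\<And>y. y \<in> T \<Longrightarrow> g (k y) = y"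
    and nn: "\<And>y. y \<in> T \<Longrightarrow> 0 \<le> f y"
    and h: "\<And>x. x \<in> S \<Longrightarrow> h x = \<bar>g' x\<bar> * f (g x)"
  shows "(\<integral>\<^sup>+y\<in>T. ennreal (f y) \<partial>lborel) = (\<integral>\<^sup>+x\<in>S. ennreal (h x) \<partial>lborel)"
proof -
  have im: "g ` S = T" using S(1) image_eqI[where f = g, OF T(2)[symmetric] T(1)] by blast
  have inj: "inj_on g S" using S(2) by (rule inj_on_inverseI)
  have nnh: "0 \<le> h x" if "x \<in> S" for x using h[OF that] nn[OF S(1)[OF that]] by simp
  have "(\<lambda>x. \<bar>g' x\<bar> * f (g x)) absolutely_integrable_on S \<and> integral S (\<lambda>x. \<bar>g' x\<bar> * f (g x)) = b
      \<longleftrightarrow> f absolutely_integrable_on T \<and> integral T f = b" for b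
    unfolding im[symmetric]
    by (rule has_absolute_integral_change_of_variables_1'[OF _ has_field_derivative_at_within[OF der] inj])
       auto
  moreover have "(\<lambda>x. \<bar>g' x\<bar> * f (g x)) absolutely_integrable_on S \<longleftrightarrow> h absolutely_integrable_on S"
    by (rule set_integrable_cong[OF refl refl h[symmetric]])
  moreover have "integral S (\<lambda>x. \<bar>g' x\<bar> * f (g x)) = integral S h"
    by (rule integral_cong[OF h[symmetric]])
  ultimately have *: "h absolutely_integrable_on S \<and> integral S h = b
      \<longleftrightarrow> f absolutely_integrable_on T \<and> integral T f = b" for b
    by (simp only:)
  show ?thesis
  proof (cases "f absolutely_integrable_on T")
    case True
    then have "h absolutely_integrable_on S" "integral S h = integral T f"
      using *[of "integral T f"] by blast+
    with True show ?thesis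
      using set_nn_integral_eq_integral[OF assms(1,4) nn] set_nn_integral_eq_integral[OF assms(2,3) nnh]
      by simp
  next
    case False
    then have "\<not> h absolutely_integrable_on S" using * by blast
    with False have "(\<integral>\<^sup>+y\<in>T. ennreal (f y) \<partial>lborel) = \<infinity>" "(\<integral>\<^sup>+x\<in>S. ennreal (h x) \<partial>lborel) = \<infinity>"
      using absolutely_integrable_on_iff_nn_integral[OF assms(1,4) nn]
        absolutely_integrable_on_iff_nn_integral[OF assms(2,3) nnh]
      by (auto simp: less_top[symmetric])
    then show ?thesis by simp
  qed
qed

section \<open>Jacobi weights, Euler kernels and the Beta integral\<close>

lemma nn_integral_Beta:
  fixes a b :: real
  assumes "a > 0" "b > 0"
  shows "(\<integral>\<^sup>+t\<in>{0<..<1}. ennreal (t powr (a - 1) * (1 - t) powr (b - 1)) \<partial>lborel) = ennreal (Beta a b)"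
  using has_integral_Beta_real[OF assms]
  by (intro nn_integral_has_integral_lebesgue') (auto simp: has_integral_Icc_iff_Ioo)

text \<open>Logarithms turn an identity between products of real powers into a linear one, which
  \<open>algebra_simps\<close> settles. The exponent bookkeeping after the substitutions is done
  this way.\<close>

lemma ln_eqI:
  fixes x y :: real
  assumes "ln x = ln y" "0 < x" "0 < y"
  shows "x = y"
  using assms by simp

text \<open>The absolute value lets one weight serve on both sides of the singularity at 1, as is
  needed for variables that run up to \<open>1 / a\<close>.\<close>

definition jacobi_weight :: "real \<Rightarrow> real \<Rightarrow> real" where
  "jacobi_weight r u = u powr r * \<bar>1 - u\<bar> powr (- 1 - r)"

text \<open>For \<open>0 < u < 1\<close> this is 1/Y with parameters \<open>r\<close> and
  \<open>a\<close>, that is, the integrand of Euler's integral for 2F1(-r, r+1; 1; a).\<close>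

definition euler_kernel :: "real \<Rightarrow> real \<Rightarrow> real \<Rightarrow> real" where
  "euler_kernel r a u = jacobi_weight r u * (1 - a * u) powr r"

lemma jacobi_weight_measurable [measurable]: "jacobi_weight r \<in> borel_measurable borel"
  unfolding jacobi_weight_def by measurable

lemma euler_kernel_measurable [measurable]: "euler_kernel r a \<in> borel_measurable borel"
  unfolding euler_kernel_def by measurable

lemma jacobi_weight_nonneg [simp]: "0 \<le> jacobi_weight r u"
  by (simp add: jacobi_weight_def)

lemma euler_kernel_nonneg [simp]: "0 \<le> euler_kernel r a u"
  by (simp add: euler_kernel_def)

lemma nn_integral_jacobi_weight:
  assumes "-1 < r" "r < 0"
  shows "(\<integral>\<^sup>+u\<in>{0<..<1}. ennreal (jacobi_weight r u) \<partial>lborel) = ennreal (Beta (r + 1) (- r))"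
proof -
  have "(\<integral>\<^sup>+u\<in>{0<..<1}. ennreal (jacobi_weight r u) \<partial>lborel)
      = (\<integral>\<^sup>+u\<in>{0<..<1}. ennreal (u powr (r + 1 - 1) * (1 - u) powr (- r - 1)) \<partial>lborel)"
    by (intro nn_integral_cong) (auto simp: jacobi_weight_def minus_diff_commute split: split_indicator)
  then show ?thesis
    using assms by (subst (asm) nn_integral_Beta) auto
qed

lemma moebius_jacobi_weight_identity:
  fixes A C x y D r :: real
  assumes "0 < A" "0 < C" "0 < x" "0 < y" "0 < D"
  shows "A powr r * C powr (- 1 - r) * (x powr r * y powr (- 1 - r))
    = A * C / D\<^sup>2 * ((A * x / D) powr r * (C * y / D) powr (- 1 - r) / (A * C / D))"
  by (rule ln_eqI) (use assms in \<open>simp_all add: ln_mult ln_div ln_powr ln_realpow algebra_simps\<close>)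

text \<open>The Moebius map \<open>A * x / (A + B - B * x)\<close> fixes 0 and 1. The exponents of
  \<open>u\<close>, \<open>1 - u\<close> and \<open>A + B * u\<close> sum to -2, which matches the
  square in the Jacobian, so the new denominator disappears and the plain Beta integral
  remains.\<close>

lemma nn_integral_jacobi_weight_over_linear:
  assumes r: "-1 < r" "r < 0" and A: "0 < A" "0 < A + B"
  shows "(\<integral>\<^sup>+u\<in>{0<..<1}. ennreal (jacobi_weight r u / (A + B * u)) \<partial>lborel)
       = ennreal (Beta (r + 1) (- r) * (A powr r * (A + B) powr (- 1 - r)))"
proof -
  \<comment> \<open>Both linear factors are convex combinations of \<open>A\<close> and
    \<open>A + B\<close>, hence positive for either sign of \<open>B\<close>.\<close>
  have pos: "0 < A + B - B * x" if "0 < x" "x < 1" for x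
  proof -
    have "0 < A * x + (A + B) * (1 - x)" using that A by (simp add: add_pos_pos)
    then show ?thesis by (simp add: algebra_simps)
  qed
  have pos': "0 < A + B * x" if "0 < x" "x < 1" for x
  proof -
    have "0 < (A + B) * x + A * (1 - x)" using that A by (simp add: add_pos_pos)
    then show ?thesis by (simp add: algebra_simps)
  qed
  have eq: "1 - A * x / (A + B - B * x) = (A + B) * (1 - x) / (A + B - B * x)"
    "A + B * (A * x / (A + B - B * x)) = A * (A + B) / (A + B - B * x)" if "0 < x" "x < 1" for x
    using pos[OF that] by (simp_all add: field_simps)
  have "(\<integral>\<^sup>+u\<in>{0<..<1}. ennreal (jacobi_weight r u / (A + B * u)) \<partial>lborel)
      = (\<integral>\<^sup>+x\<in>{0<..<1}. ennreal (A powr r * (A + B) powr (- 1 - r) * jacobi_weight r x) \<partial>lborel)"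
  proof (rule nn_integral_change_of_variables[where g = "\<lambda>x. A * x / (A + B - B * x)"
          and k = "\<lambda>u. (A + B) * u / (A + B * u)" and g' = "\<lambda>x. A * (A + B) / (A + B - B * x)\<^sup>2"])
    fix x :: real assume x: "x \<in> {0<..<1}"
    then have p: "0 < A + B - B * x" using pos by auto
    show "((\<lambda>x. A * x / (A + B - B * x)) has_real_derivative A * (A + B) / (A + B - B * x)\<^sup>2) (at x)"
      using p by (auto intro!: derivative_eq_intros simp: field_simps power2_eq_square)
    have e: "1 - A * x / (A + B - B * x) = (A + B) * (1 - x) / (A + B - B * x)"
      "A + B * (A * x / (A + B - B * x)) = A * (A + B) / (A + B - B * x)"
      using eq x by auto
    have "0 < (A + B) * (1 - x) / (A + B - B * x)" using x A p by simp
    then have lt: "A * x / (A + B - B * x) < 1" using e(1) by linarith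
    then show "A * x / (A + B - B * x) \<in> {0<..<1}" using x A p by simp
    show "(A + B) * (A * x / (A + B - B * x)) / (A + B * (A * x / (A + B - B * x))) = x"
      unfolding e using p A by simp
    define D where "D = A + B - B * x"
    have D: "D > 0" using p by (simp add: D_def)
    show "A powr r * (A + B) powr (- 1 - r) * jacobi_weight r x
       = \<bar>A * (A + B) / (A + B - B * x)\<^sup>2\<bar> * (jacobi_weight r (A * x / (A + B - B * x)) / (A + B * (A * x / (A + B - B * x))))"
      unfolding jacobi_weight_def e unfolding D_def[symmetric]
      using moebius_jacobi_weight_identity[OF A, of x "1 - x" D r] x A D by (simp add: abs_of_pos)
  next
    fix y :: real assume y: "y \<in> {0<..<1}"
    then have p: "0 < A + B * y" using pos' by auto
    have e: "A + B - B * ((A + B) * y / (A + B * y)) = A * (A + B) / (A + B * y)"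
       "1 - (A + B) * y / (A + B * y) = A * (1 - y) / (A + B * y)"
      using p by (simp_all add: field_simps)
    have "0 < A * (1 - y) / (A + B * y)" using y A p by simp
    then have lt: "(A + B) * y / (A + B * y) < 1" using e by linarith
    then show "(A + B) * y / (A + B * y) \<in> {0<..<1}" using y A p by simp
    show "A * ((A + B) * y / (A + B * y)) / (A + B - B * ((A + B) * y / (A + B * y))) = y"
      unfolding e using p A by simp
    show "0 \<le> jacobi_weight r y / (A + B * y)" using p by simp
  qed measurable
  also have "\<dots> = (\<integral>\<^sup>+x. ennreal (A powr r * (A + B) powr (- 1 - r)) * (ennreal (jacobi_weight r x) * indicator {0<..<1} x) \<partial>lborel)"
    by (intro nn_integral_cong) (auto simp: ennreal_mult split: split_indicator)
  also have "\<dots> = ennreal (Beta (r + 1) (- r) * (A powr r * (A + B) powr (- 1 - r)))"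
    by (subst nn_integral_cmult)
      (simp_all add: nn_integral_jacobi_weight[OF r] mult.commute[of "ennreal (A powr _ * _)"] flip: ennreal_mult'')
  finally show ?thesis .
qed

subsection \<open>The triple integral at the base point\<close>

lemma set_nn_integral_swap:
  fixes f :: "real \<Rightarrow> real \<Rightarrow> ennreal"
  assumes [measurable]: "case_prod f \<in> borel_measurable (borel \<Otimes>\<^sub>M borel)" "A \<in> sets borel" "B \<in> sets borel"
  shows "(\<integral>\<^sup>+x\<in>A. (\<integral>\<^sup>+y\<in>B. f x y \<partial>lborel) \<partial>lborel) = (\<integral>\<^sup>+y\<in>B. (\<integral>\<^sup>+x\<in>A. f x y \<partial>lborel) \<partial>lborel)"
proof -
  have "(\<integral>\<^sup>+x\<in>A. (\<integral>\<^sup>+y\<in>B. f x y \<partial>lborel) \<partial>lborel)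
      = (\<integral>\<^sup>+x. (\<integral>\<^sup>+y. f x y * indicator B y * indicator A x \<partial>lborel) \<partial>lborel)"
    by (simp add: nn_integral_multc)
  also have "\<dots> = (\<integral>\<^sup>+y. (\<integral>\<^sup>+x. f x y * indicator B y * indicator A x \<partial>lborel) \<partial>lborel)"
    by (rule lborel_pair.Fubini'[symmetric]) measurable
  also have "\<dots> = (\<integral>\<^sup>+y. (\<integral>\<^sup>+x. f x y * indicator A x * indicator B y \<partial>lborel) \<partial>lborel)"
    by (simp add: mult_ac)
  also have "\<dots> = (\<integral>\<^sup>+y\<in>B. (\<integral>\<^sup>+x\<in>A. f x y \<partial>lborel) \<partial>lborel)"
    by (simp add: nn_integral_multc)
  finally show ?thesis .
qed

lemma set_nn_integral_cong_except:
  fixes f g :: "real \<Rightarrow> ennreal"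
  assumes "\<And>x. x \<in> A \<Longrightarrow> x \<noteq> c \<Longrightarrow> f x = g x"
  shows "(\<integral>\<^sup>+x\<in>A. f x \<partial>lborel) = (\<integral>\<^sup>+x\<in>A. g x \<partial>lborel)"
proof (rule nn_integral_cong_AE)
  show "AE x in lborel. f x * indicator A x = g x * indicator A x"
    using AE_lborel_singleton[of c] by eventually_elim (use assms in \<open>auto split: split_indicator\<close>)
qed

lemma set_nn_integral_cong_on:
  fixes f g :: "real \<Rightarrow> ennreal"
  assumes "\<And>x. x \<in> A \<Longrightarrow> f x = g x"
  shows "(\<integral>\<^sup>+x\<in>A. f x \<partial>lborel) = (\<integral>\<^sup>+x\<in>A. g x \<partial>lborel)"
  by (intro nn_integral_cong) (use assms in \<open>auto split: split_indicator\<close>)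

lemma set_nn_integral_cmult:
  fixes f :: "real \<Rightarrow> ennreal"
  assumes [measurable]: "f \<in> borel_measurable borel" "A \<in> sets borel"
  shows "(\<integral>\<^sup>+x\<in>A. c * f x \<partial>lborel) = c * (\<integral>\<^sup>+x\<in>A. f x \<partial>lborel)"
  by (subst nn_integral_cmult[symmetric]) (auto simp: mult.assoc)

lemma set_nn_integral_cmult_real:
  fixes f :: "real \<Rightarrow> real"
  assumes [measurable]: "f \<in> borel_measurable borel" "A \<in> sets borel" and c: "0 \<le> c"
  shows "(\<integral>\<^sup>+x\<in>A. ennreal (c * f x) \<partial>lborel) = ennreal c * (\<integral>\<^sup>+x\<in>A. ennreal (f x) \<partial>lborel)"
  using c by (subst set_nn_integral_cmult[symmetric]) (auto simp: ennreal_mult')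

text \<open>Power bookkeeping for the next substitution: \<open>D\<close>, \<open>E\<close>,
  \<open>P\<close>, \<open>B\<close>, \<open>Q\<close> stand for |1-W|, 1-aW, 1-(1-a)b, 1-b and
  1-(1-aW)b.\<close>

lemma moebius_kernel_identity:
  fixes W D E P B Q a r :: real
  assumes "0 < W" "0 < D" "0 < E" "0 < P" "0 < B" "0 < Q" "0 < a"
  shows "E powr (-1-r) * P powr r * B powr (-1-r) * a / Q
    = W * a * D / Q\<^sup>2 * (W powr (-1-r) * D powr r * E powr (-1-r) *
       ((W * P / Q) powr r * (D * B / Q) powr (-1-r)))"
  by (rule ln_eqI) (use assms in \<open>simp_all add: ln_mult ln_div ln_powr ln_realpow algebra_simps\<close>)

lemma powr_scale_cancel:
  fixes z d r :: real
  assumes "0 < z" "0 < d"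
  shows "(z * d) powr (-1-r) * d powr r * d = z powr (-1-r)"
  by (rule ln_eqI) (use assms in \<open>simp_all add: ln_mult ln_powr algebra_simps\<close>)

lemma quotient_in_unit_interval:
  fixes x y :: real
  assumes "(0 < x \<and> 0 < y \<and> x < y) \<or> (0 > x \<and> 0 > y \<and> x > y)"
  shows "y \<noteq> 0" "0 < x / y" "x / y < 1"
  using assms by (auto simp: divide_neg_neg)

text \<open>The Moebius map used here sends 0, 1 and 1/(1-a) to W, 1 and 0, so it treats W < 1 and W
  > 1 alike. The powers of |1-W| from the Jacobian, the weight and the kernel are 1, -1-r and r and
  cancel; the powers of W cancel in the same way. Hence the new integrand is regular across W = 1,
  and W enters it only through 1-aW.\<close>

lemma nn_integral_jacobi_weight_between:
  assumes r: "-1 < r" "r < 0" and a: "0 < a" "a < 1" and W: "0 < W" "W < 1 / a" "W \<noteq> 1"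
  shows "(\<integral>\<^sup>+u\<in>{min W 1<..<max W 1}. ennreal (euler_kernel (-1-r) a W * jacobi_weight r u) \<partial>lborel)
    = (\<integral>\<^sup>+b\<in>{0<..<1}. ennreal ((1 - a * W) powr (-1-r) * (1 - (1-a) * b) powr r * (1 - b) powr (-1-r)
          * a / (1 - (1 - a * W) * b)) \<partial>lborel)"
proof -
  define e where "e = 1 - a * W"
  have e: "0 < e" "e < 1" using W a by (auto simp: e_def field_simps)
  have Q: "0 < 1 - e * b" if "0 < b" "b < 1" for b
    using mult_strict_mono[of e 1 b 1] that e by simp
  have P: "0 < 1 - (1-a) * b" if "0 < b" "b < 1" for b
    using mult_strict_mono[of "1-a" 1 b 1] that a by simp
  have ec: "e - (1 - a) = a * (1 - W)" by (simp add: e_def algebra_simps)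
  have UW: "W * (1 - (1-a) * b) / (1 - e * b) - W = W * a * (1 - W) * b / (1 - e * b)"
    and U1: "1 - W * (1 - (1-a) * b) / (1 - e * b) = (1 - W) * (1 - b) / (1 - e * b)"
    if "0 < b" "b < 1" for b
    using Q[OF that] by (simp_all add: field_simps) (simp_all add: e_def algebra_simps)
  have den: "e * u - (1-a) * W \<noteq> 0" "0 < (u - W) / (e * u - (1-a) * W)" "(u - W) / (e * u - (1-a) * W) < 1"
    if u: "u \<in> {min W 1<..<max W 1}" for u
  proof -
    have 1: "e * u - (1-a) * W = (u - W) * e + a * (1 - W) * W"
      by (simp add: e_def algebra_simps)
    \<comment> \<open>As \<open>u\<close> lies between \<open>W\<close> and 1, \<open>1 - u\<close>
      has the same sign as \<open>u - W\<close>. So denominator and numerator of the inverse map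
      have equal signs and the denominator is larger in absolute value.\<close>
    have 2: "e * u - (1-a) * W - (u - W) = a * W * (1 - u)"
      by (simp add: e_def algebra_simps)
    show "e * u - (1-a) * W \<noteq> 0" "0 < (u - W) / (e * u - (1-a) * W)" "(u - W) / (e * u - (1-a) * W) < 1"
    proof -
      consider "W < 1" | "W > 1" using W by linarith
      then have "(0 < u - W \<and> 0 < e * u - (1-a) * W \<and> u - W < e * u - (1-a) * W) \<or>
         (0 > u - W \<and> 0 > e * u - (1-a) * W \<and> u - W > e * u - (1-a) * W)"
      proof cases
        case 1
        then have *: "0 < u - W" "u < 1" using u by auto
        then have "0 < a * W * (1 - u)" using W a by simp
        with * show ?thesis using 2 by linarith
      next
        case 2
        then have *: "0 < W - u" "1 < u" using u by auto
        then have "0 < a * W * (u - 1)" using W a by simp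
        moreover have "a * W * (u - 1) = - (a * W * (1 - u))" by (simp add: algebra_simps)
        ultimately show ?thesis using * \<open>e * u - (1-a) * W - (u - W) = a * W * (1 - u)\<close> by linarith
      qed
      then show "e * u - (1-a) * W \<noteq> 0" "0 < (u - W) / (e * u - (1-a) * W)" "(u - W) / (e * u - (1-a) * W) < 1"
        using quotient_in_unit_interval by blast+
    qed
  qed
  show ?thesis
    unfolding e_def[symmetric]
  proof (rule nn_integral_change_of_variables[where g = "\<lambda>b. W * (1 - (1-a) * b) / (1 - e * b)"
       and g' = "\<lambda>b. W * a * (1 - W) / (1 - e * b)\<^sup>2"
       and k = "\<lambda>u. (u - W) / (e * u - (1-a) * W)"])
    fix b :: real assume "b \<in> {0<..<1}"
    then have b: "0 < b" "b < 1" by auto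
    note Qb = Q[OF b] and Pb = P[OF b] and U1b = U1[OF b] and UWb = UW[OF b]
    have "((\<lambda>b. W * (1 - (1-a) * b) / (1 - e * b)) has_real_derivative W * (e - (1 - a)) / (1 - e * b)\<^sup>2) (at b)"
      using Qb by (auto intro!: derivative_eq_intros simp: field_simps power2_eq_square)
    then show "((\<lambda>b. W * (1 - (1-a) * b) / (1 - e * b)) has_real_derivative W * a * (1 - W) / (1 - e * b)\<^sup>2) (at b)"
      unfolding ec by (simp add: mult.assoc)
    show "W * (1 - (1-a) * b) / (1 - e * b) \<in> {min W 1<..<max W 1}"
    proof (cases "W < 1")
      case True
      have "0 < W * a * (1 - W) * b / (1 - e * b)" "0 < (1 - W) * (1 - b) / (1 - e * b)"
        using True W a b Qb by simp_all
      then show ?thesis using UWb U1b True by auto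
    next
      case False
      have "0 < W * a * (W - 1) * b / (1 - e * b)" "0 < (W - 1) * (1 - b) / (1 - e * b)"
        using False W a b Qb by simp_all
      moreover have "W * a * (W - 1) * b / (1 - e * b) = - (W * a * (1 - W) * b / (1 - e * b))"
        "(W - 1) * (1 - b) / (1 - e * b) = - ((1 - W) * (1 - b) / (1 - e * b))"
        unfolding minus_divide_left by (simp_all add: algebra_simps)
      ultimately show ?thesis using UWb U1b False by auto
    qed
    have "e * (W * (1 - (1-a) * b) / (1 - e * b)) - (1-a) * W = W * a * (1 - W) / (1 - e * b)"
      using Qb by (simp add: field_simps) (simp add: e_def algebra_simps)
    then show "(W * (1 - (1-a) * b) / (1 - e * b) - W) / (e * (W * (1 - (1-a) * b) / (1 - e * b)) - (1-a) * W) = b"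
      unfolding UWb using W a Qb by simp
    have abs1: "\<bar>1 - W * (1 - (1-a) * b) / (1 - e * b)\<bar> = \<bar>1 - W\<bar> * (1 - b) / (1 - e * b)"
      unfolding U1b using b Qb by (simp add: abs_mult)
    have abs2: "\<bar>W * a * (1 - W) / (1 - e * b)\<^sup>2\<bar> = W * a * \<bar>1 - W\<bar> / (1 - e * b)\<^sup>2"
      using W a by (simp add: abs_mult)
    show "e powr (-1-r) * (1 - (1-a) * b) powr r * (1 - b) powr (-1-r) * a / (1 - e * b)
       = \<bar>W * a * (1 - W) / (1 - e * b)\<^sup>2\<bar> * (euler_kernel (-1-r) a W * jacobi_weight r (W * (1 - (1-a) * b) / (1 - e * b)))"
      unfolding euler_kernel_def jacobi_weight_def abs1 abs2 
      using moebius_kernel_identity[of W "\<bar>1 - W\<bar>" e "1 - (1-a) * b" "1 - b" "1 - e * b" a r] W e Pb Qb a b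
      by (simp add: e_def[symmetric])
  next
    fix u :: real assume u: "u \<in> {min W 1<..<max W 1}"
    note d = den[OF u]
    show "(u - W) / (e * u - (1-a) * W) \<in> {0<..<1}" using d by auto
    define N where "N = e * u - (1-a) * W"
    have N: "N \<noteq> 0" using d by (simp add: N_def)
    have "1 - e * ((u - W) / N) = (N - e * (u - W)) / N" using N by (simp add: field_simps)
    also have "N - e * (u - W) = W * a * (1 - W)" by (simp add: N_def e_def algebra_simps)
    finally have 1: "1 - e * ((u - W) / N) = W * a * (1 - W) / N" .
    have "1 - (1-a) * ((u - W) / N) = (N - (1-a) * (u - W)) / N" using N by (simp add: field_simps)
    also have "N - (1-a) * (u - W) = a * (1 - W) * u" by (simp add: N_def e_def algebra_simps)
    finally have 2: "1 - (1-a) * ((u - W) / N) = a * (1 - W) * u / N" .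
    show "W * (1 - (1-a) * ((u - W) / (e * u - (1-a) * W))) / (1 - e * ((u - W) / (e * u - (1-a) * W))) = u"
      unfolding N_def[symmetric] 1 2 using N W a by simp
    show "0 \<le> euler_kernel (-1-r) a W * jacobi_weight r u" by simp
  next
    show "(\<lambda>u. euler_kernel (-1-r) a W * jacobi_weight r u) \<in> borel_measurable borel" by measurable
    show "(\<lambda>b. e powr (-1-r) * (1 - (1-a) * b) powr r * (1 - b) powr (-1-r) * a / (1 - e * b)) \<in> borel_measurable borel"
      by measurable
  qed simp_all
qed

text \<open>After \<open>U \<mapsto> b\<close> of the previous lemma and \<open>1 - aW = z (1 - aV)\<close> the \<open>V\<close>-integral is elementary, and \<open>z = v/b\<close>
  produces the triangle.\<close>

lemma nn_integral_triple_kernel: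
  assumes r: "-1 < r" "r < 0" and a: "0 < a" "a < 1"
  shows "(\<integral>\<^sup>+V\<in>{0<..<1}. (\<integral>\<^sup>+W\<in>{V<..<1/a}. (\<integral>\<^sup>+U\<in>{min W 1<..<max W 1}.
            ennreal (euler_kernel r a V * (euler_kernel (-1-r) a W * jacobi_weight r U)) \<partial>lborel) \<partial>lborel) \<partial>lborel)
    = ennreal (Beta (r + 1) (- r)) * (\<integral>\<^sup>+b\<in>{0<..<1}. (\<integral>\<^sup>+v\<in>{0<..<b}.
            ennreal (euler_kernel r (1-a) b * euler_kernel (-1-r) (1-a) v) \<partial>lborel) \<partial>lborel)"
    (is "?L = ?R")
proof -
  have Beta_nonneg: "0 \<le> Beta (r + 1) (- r)"
    using r by (simp add: Beta_def Gamma_real_nonneg)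
  define c where "c = 1 - a"
  have c: "0 < c" "c < 1" using a by (auto simp: c_def)
  let ?e1 = "\<lambda>V W b. ennreal (euler_kernel r a V * ((1 - a * W) powr (-1-r) * (1 - c * b) powr r * (1 - b) powr (-1-r)
          * a / (1 - (1 - a * W) * b)))"
  let ?e2 = "\<lambda>V b z. ennreal (jacobi_weight r V / ((1 - z * b) + (a * z * b) * V) *
          (z powr (-1-r) * (1 - c * b) powr r * (1 - b) powr (-1-r)))"
  let ?I = "{0<..<1::real}"
  have "?L = (\<integral>\<^sup>+V\<in>?I. (\<integral>\<^sup>+W\<in>{V<..<1/a}. (\<integral>\<^sup>+b\<in>?I. ?e1 V W b \<partial>lborel) \<partial>lborel) \<partial>lborel)"
  \<comment> \<open>The \<open>U\<close>-substitution degenerates at \<open>W = 1\<close>, a single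
    point and therefore negligible.\<close>
  proof (rule set_nn_integral_cong_on, rule set_nn_integral_cong_except[where c = 1])
    fix V W :: real assume V: "V \<in> ?I" and W: "W \<in> {V<..<1/a}" "W \<noteq> 1"
    have "(\<integral>\<^sup>+U\<in>{min W 1<..<max W 1}. ennreal (euler_kernel r a V * (euler_kernel (-1-r) a W * jacobi_weight r U)) \<partial>lborel)
      = ennreal (euler_kernel r a V) * (\<integral>\<^sup>+U\<in>{min W 1<..<max W 1}. ennreal (euler_kernel (-1-r) a W * jacobi_weight r U) \<partial>lborel)"
      by (subst set_nn_integral_cmult_real[symmetric]) auto
    also have "\<dots> = ennreal (euler_kernel r a V) * (\<integral>\<^sup>+b\<in>?I. ennreal ((1 - a * W) powr (-1-r) * (1 - c * b) powr r * (1 - b) powr (-1-r)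
          * a / (1 - (1 - a * W) * b)) \<partial>lborel)"
      unfolding c_def using V W by (subst nn_integral_jacobi_weight_between[OF r a]) auto
    also have "\<dots> = (\<integral>\<^sup>+b\<in>?I. ?e1 V W b \<partial>lborel)"
      by (subst set_nn_integral_cmult_real[symmetric]) auto
    finally show "(\<integral>\<^sup>+U\<in>{min W 1<..<max W 1}. ennreal (euler_kernel r a V * (euler_kernel (-1-r) a W * jacobi_weight r U)) \<partial>lborel)
      = (\<integral>\<^sup>+b\<in>?I. ?e1 V W b \<partial>lborel)" .
  qed
  also have "\<dots> = (\<integral>\<^sup>+V\<in>?I. (\<integral>\<^sup>+b\<in>?I. (\<integral>\<^sup>+W\<in>{V<..<1/a}. ?e1 V W b \<partial>lborel) \<partial>lborel) \<partial>lborel)"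
    by (rule set_nn_integral_cong_on, rule set_nn_integral_swap) measurable
  also have "\<dots> = (\<integral>\<^sup>+V\<in>?I. (\<integral>\<^sup>+b\<in>?I. (\<integral>\<^sup>+z\<in>?I. ?e2 V b z \<partial>lborel) \<partial>lborel) \<partial>lborel)"
  proof (intro set_nn_integral_cong_on)
    fix V b :: real assume V: "V \<in> ?I" and b: "b \<in> ?I"
    have d: "0 < 1 - a * V" using mult_strict_mono[of a 1 V 1] V a by simp
    show "(\<integral>\<^sup>+W\<in>{V<..<1/a}. ?e1 V W b \<partial>lborel) = (\<integral>\<^sup>+z\<in>?I. ?e2 V b z \<partial>lborel)"
    proof (rule nn_integral_change_of_variables[where g = "\<lambda>z. (1 - z * (1 - a * V)) / a"
        and g' = "\<lambda>z. - (1 - a * V) / a" and k = "\<lambda>W. (1 - a * W) / (1 - a * V)"])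
      fix z assume z: "z \<in> ?I"
      show "((\<lambda>z. (1 - z * (1 - a * V)) / a) has_real_derivative - (1 - a * V) / a) (at z)"
        using a by (auto intro!: derivative_eq_intros)
      have "z * (1 - a * V) < 1 * (1 - a * V)" "0 < z * (1 - a * V)" using z d by auto
      then show "(1 - z * (1 - a * V)) / a \<in> {V<..<1/a}" using a by (auto simp: field_simps)
      have aW: "1 - a * ((1 - z * (1 - a * V)) / a) = z * (1 - a * V)" using a by simp
      show "(1 - a * ((1 - z * (1 - a * V)) / a)) / (1 - a * V) = z" unfolding aW using d by simp
      \<comment> \<open>The powers of \<open>1 - a * V\<close> cancel under this substitution, and
        the denominator becomes affine in \<open>V\<close>: exactly the shape of
        \<open>nn_integral_jacobi_weight_over_linear\<close>.\<close>
      have den: "1 - z * (1 - a * V) * b = (1 - z * b) + (a * z * b) * V" by (simp add: algebra_simps)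
      have p: "(z * (1 - a * V)) powr (-1-r) * (1 - a * V) powr r * (1 - a * V) = z powr (-1-r)"
        using z d by (intro powr_scale_cancel) auto
      show "jacobi_weight r V / ((1 - z * b) + (a * z * b) * V) * (z powr (-1-r) * (1 - c * b) powr r * (1 - b) powr (-1-r))
        = \<bar>- (1 - a * V) / a\<bar> * (euler_kernel r a V * ((1 - a * ((1 - z * (1 - a * V)) / a)) powr (-1-r) * (1 - c * b) powr r * (1 - b) powr (-1-r)
          * a / (1 - (1 - a * ((1 - z * (1 - a * V)) / a)) * b)))"
        unfolding aW den euler_kernel_def p[symmetric] using d a by (simp add: abs_of_pos)
    next
      fix W assume W: "W \<in> {V<..<1/a}"
      then have "0 < 1 - a * W" "1 - a * W < 1 - a * V" using a by (auto simp: field_simps)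
      then show "(1 - a * W) / (1 - a * V) \<in> ?I" using d by auto
      show "(1 - (1 - a * W) / (1 - a * V) * (1 - a * V)) / a = W" using d a by simp
      have "(1 - a * W) * b < 1 * 1"
        using \<open>0 < 1 - a * W\<close> \<open>1 - a * W < 1 - a * V\<close> b V a by (intro mult_strict_mono) (auto intro: less_trans)
      then show "0 \<le> euler_kernel r a V * ((1 - a * W) powr (-1-r) * (1 - c * b) powr r * (1 - b) powr (-1-r)
          * a / (1 - (1 - a * W) * b))"
        using a by simp
    next
      show "(\<lambda>W. euler_kernel r a V * ((1 - a * W) powr (-1-r) * (1 - c * b) powr r * (1 - b) powr (-1-r)
          * a / (1 - (1 - a * W) * b))) \<in> borel_measurable borel" by measurable
      show "(\<lambda>z. jacobi_weight r V / ((1 - z * b) + (a * z * b) * V) * (z powr (-1-r) * (1 - c * b) powr r * (1 - b) powr (-1-r)))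
         \<in> borel_measurable borel" by measurable
    qed simp_all
  qed
  also have "\<dots> = (\<integral>\<^sup>+b\<in>?I. (\<integral>\<^sup>+V\<in>?I. (\<integral>\<^sup>+z\<in>?I. ?e2 V b z \<partial>lborel) \<partial>lborel) \<partial>lborel)"
    by (rule set_nn_integral_swap) measurable
  also have "\<dots> = (\<integral>\<^sup>+b\<in>?I. (\<integral>\<^sup>+z\<in>?I. (\<integral>\<^sup>+V\<in>?I. ?e2 V b z \<partial>lborel) \<partial>lborel) \<partial>lborel)"
    by (rule set_nn_integral_cong_on, rule set_nn_integral_swap) measurable
  also have "\<dots> = (\<integral>\<^sup>+b\<in>?I. ennreal (Beta (r + 1) (- r)) * (\<integral>\<^sup>+v\<in>{0<..<b}.
            ennreal (euler_kernel r c b * euler_kernel (-1-r) c v) \<partial>lborel) \<partial>lborel)"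
  proof (intro set_nn_integral_cong_on)
    fix b assume b: "b \<in> ?I"
    have cb: "0 < 1 - c * b" using mult_strict_mono[of c 1 b 1] b c by simp
    have "(\<integral>\<^sup>+z\<in>?I. (\<integral>\<^sup>+V\<in>?I. ?e2 V b z \<partial>lborel) \<partial>lborel)
       = (\<integral>\<^sup>+z\<in>?I. ennreal (Beta (r + 1) (- r) * ((1 - z * b) powr r * (1 - c * (z * b)) powr (-1-r))
           * (z powr (-1-r) * (1 - c * b) powr r * (1 - b) powr (-1-r))) \<partial>lborel)"
    proof (intro set_nn_integral_cong_on)
      fix z assume z: "z \<in> ?I"
      have zb: "z * b < 1" "0 < z * b" using mult_strict_mono[of z 1 b 1] z b by auto
      have A: "0 < 1 - z * b" using zb by simp
      \<comment> \<open>The sum \<open>A + B\<close> of that lemma reproduces the constant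
        \<open>c = 1 - a\<close> already created by the \<open>U\<close>-substitution. This is why
        both final factors are Euler kernels with the same parameter.\<close>
      have eq: "1 - z * b + a * z * b = 1 - c * (z * b)" by (simp add: c_def algebra_simps)
      have AB: "0 < 1 - z * b + a * z * b"
        using add_pos_pos[OF A mult_pos_pos[OF a(1) zb(2)]] by (simp add: mult.assoc)
      have "(\<integral>\<^sup>+V\<in>?I. ?e2 V b z \<partial>lborel)
         = ennreal (z powr (-1-r) * (1 - c * b) powr r * (1 - b) powr (-1-r)) *
           (\<integral>\<^sup>+V\<in>?I. ennreal (jacobi_weight r V / ((1 - z * b) + (a * z * b) * V)) \<partial>lborel)"
        by (subst set_nn_integral_cmult_real[symmetric]) (auto simp: mult.commute)
      also have "\<dots> = ennreal (z powr (-1-r) * (1 - c * b) powr r * (1 - b) powr (-1-r)) *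
           ennreal (Beta (r + 1) (- r) * ((1 - z * b) powr r * (1 - c * (z * b)) powr (-1-r)))"
        by (subst nn_integral_jacobi_weight_over_linear[OF r A AB]) (simp add: eq)
      finally show "(\<integral>\<^sup>+V\<in>?I. ?e2 V b z \<partial>lborel) = ennreal (Beta (r + 1) (- r) * ((1 - z * b) powr r * (1 - c * (z * b)) powr (-1-r))
           * (z powr (-1-r) * (1 - c * b) powr r * (1 - b) powr (-1-r)))"
        by (subst (asm) ennreal_mult'[symmetric]) (auto simp: mult.commute)
    qed
    also have "\<dots> = ennreal (Beta (r + 1) (- r)) * (\<integral>\<^sup>+z\<in>?I. ennreal (((1 - z * b) powr r * (1 - c * (z * b)) powr (-1-r))
           * (z powr (-1-r) * (1 - c * b) powr r * (1 - b) powr (-1-r))) \<partial>lborel)"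
      using Beta_nonneg by (subst set_nn_integral_cmult_real[symmetric]) (auto simp: mult.assoc)
    also have "(\<integral>\<^sup>+z\<in>?I. ennreal (((1 - z * b) powr r * (1 - c * (z * b)) powr (-1-r))
           * (z powr (-1-r) * (1 - c * b) powr r * (1 - b) powr (-1-r))) \<partial>lborel)
       = (\<integral>\<^sup>+v\<in>{0<..<b}. ennreal (euler_kernel r c b * euler_kernel (-1-r) c v) \<partial>lborel)"
    proof (rule nn_integral_change_of_variables[symmetric, where g = "\<lambda>z. z * b"
        and g' = "\<lambda>z. b" and k = "\<lambda>v. v / b"])
      fix z assume z: "z \<in> ?I"
      show "((\<lambda>z. z * b) has_real_derivative b) (at z)" by (auto intro!: derivative_eq_intros)
      have zb: "z * b < 1" using mult_strict_mono[of z 1 b 1] z b by auto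
      have "b * (b powr r * (z * b) powr (-1-r)) = z powr (-1-r)"
        by (rule ln_eqI) (use z b in \<open>simp_all add: ln_mult ln_powr algebra_simps\<close>)
      then show "((1 - z * b) powr r * (1 - c * (z * b)) powr (-1-r)) * (z powr (-1-r) * (1 - c * b) powr r * (1 - b) powr (-1-r))
         = \<bar>b\<bar> * (euler_kernel r c b * euler_kernel (-1-r) c (z * b))"
        unfolding euler_kernel_def jacobi_weight_def using b zb by (simp add: mult_ac)
    next
      show "(\<lambda>z. ((1 - z * b) powr r * (1 - c * (z * b)) powr (-1-r)) * (z powr (-1-r) * (1 - c * b) powr r * (1 - b) powr (-1-r)))
         \<in> borel_measurable borel" by measurable
      show "(\<lambda>v. euler_kernel r c b * euler_kernel (-1-r) c v) \<in> borel_measurable borel" by measurable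
    qed (use b in \<open>simp_all add: field_simps\<close>)
    finally show "(\<integral>\<^sup>+z\<in>?I. (\<integral>\<^sup>+V\<in>?I. ?e2 V b z \<partial>lborel) \<partial>lborel)
      = ennreal (Beta (r + 1) (- r)) * (\<integral>\<^sup>+v\<in>{0<..<b}. ennreal (euler_kernel r c b * euler_kernel (-1-r) c v) \<partial>lborel)" .
  qed
  \<comment> \<open>The range of \<open>v\<close> moves with \<open>b\<close>; written as a
    conditional, it is jointly measurable, as pulling out the constant requires.\<close>
  also have "\<dots> = (\<integral>\<^sup>+b. ennreal (Beta (r + 1) (- r)) * ((\<integral>\<^sup>+v. ennreal (euler_kernel r c b * euler_kernel (-1-r) c v)
        * (if 0 < v \<and> v < b then 1 else 0) \<partial>lborel) * indicator ?I b) \<partial>lborel)"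
    by (intro nn_integral_cong) (auto simp: mult.assoc indicator_def intro!: arg_cong[where f = "\<lambda>x. _ * x"] nn_integral_cong)
  also have "\<dots> = ennreal (Beta (r + 1) (- r)) * (\<integral>\<^sup>+b. (\<integral>\<^sup>+v. ennreal (euler_kernel r c b * euler_kernel (-1-r) c v)
        * (if 0 < v \<and> v < b then 1 else 0) \<partial>lborel) * indicator ?I b \<partial>lborel)"
    by (rule nn_integral_cmult) measurable
  also have "\<dots> = ?R"
    unfolding c_def by (intro arg_cong2[where f = "(*)"] refl nn_integral_cong) (auto simp: indicator_def intro!: nn_integral_cong)
  finally show ?thesis .
qed

subsection \<open>Differentiation under the integral sign and the Legendre equation\<close>

text \<open>The Euler integral and the triple integral are both of this form, with \<open>u\<close>
  the identity or the coordinate \<open>U\<close>, so differentiation in \<open>b\<close> is carried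
  out once over an arbitrary measure space.\<close>

definition powr_integral :: "'a measure \<Rightarrow> ('a \<Rightarrow> real) \<Rightarrow> ('a \<Rightarrow> real) \<Rightarrow> real \<Rightarrow> real \<Rightarrow> real" where
  "powr_integral M u k r b = (\<integral>x. (1 - b * u x) powr r * k x \<partial>M)"

text \<open>The minimum with 1 covers negative \<open>c\<close>: there \<open>1 - c * B\<close> may
  exceed 1, while \<open>1 - b * u\<close> equals 1 at \<open>u = 0\<close>.\<close>

lemma one_minus_mult_lower_bound:
  fixes b c u B :: real
  assumes "0 \<le> u" "u \<le> B" "b \<le> c"
  shows "min 1 (1 - c * B) \<le> 1 - b * u"
proof (cases "c \<le> 0")
  case True
  then have "b * u \<le> 0" using assms by (simp add: mult_nonpos_nonneg)
  then show ?thesis by simp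
next
  case False
  then have "b * u \<le> c * B"
    using mult_right_mono[of b c u] mult_left_mono[of u B c] assms by linarith
  then show ?thesis by simp
qed

lemma powr_bounded_on_support:
  fixes u k :: "'a \<Rightarrow> real"
  assumes u: "k x \<noteq> 0 \<Longrightarrow> 0 \<le> u x \<and> u x \<le> B" and b: "b \<le> c" "c * B < 1" and r: "r \<le> 0"
  shows "\<bar>(1 - b * u x) powr r * k x\<bar> \<le> (min 1 (1 - c * B)) powr r * \<bar>k x\<bar>"
proof (cases "k x = 0")
  case False
  have "(1 - b * u x) powr r \<le> (min 1 (1 - c * B)) powr r"
    using one_minus_mult_lower_bound[of "u x" B b c] u[OF False] b r by (intro powr_mono2') auto
  then show ?thesis by (simp add: abs_mult mult_right_mono)
qed simp

text \<open>The multiplier is bounded wherever \<open>k\<close> is nonzero. Constraining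
  \<open>u\<close> on that set only lets the region of integration be encoded in
  \<open>k\<close>.\<close>

lemma integrable_powr_mult:
  fixes u k :: "'a \<Rightarrow> real"
  assumes k: "integrable M k" and [measurable]: "u \<in> borel_measurable M"
    and u: "\<And>x. k x \<noteq> 0 \<Longrightarrow> 0 \<le> u x \<and> u x \<le> B" and r: "r \<le> 0" and b: "b * B < 1"
  shows "integrable M (\<lambda>x. (1 - b * u x) powr r * k x)"
proof (rule Bochner_Integration.integrable_bound)
  show "integrable M (\<lambda>x. (min 1 (1 - b * B)) powr r * \<bar>k x\<bar>)"
    using k by (intro integrable_mult_right integrable_abs)
  have [measurable]: "k \<in> borel_measurable M" using k by auto
  show "(\<lambda>x. (1 - b * u x) powr r * k x) \<in> borel_measurable M" by measurable
  show "AE x in M. norm ((1 - b * u x) powr r * k x) \<le> norm ((min 1 (1 - b * B)) powr r * \<bar>k x\<bar>)"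
  proof (rule AE_I2)
    fix x
    have "\<bar>(1 - b * u x) powr r * k x\<bar> \<le> (min 1 (1 - b * B)) powr r * \<bar>k x\<bar>"
      by (rule powr_bounded_on_support) (use u r b in auto)
    then show "norm ((1 - b * u x) powr r * k x) \<le> norm ((min 1 (1 - b * B)) powr r * \<bar>k x\<bar>)"
      by (simp add: abs_mult)
  qed
qed

text \<open>Dominated convergence for difference quotients: on a half-line around \<open>b\<close>
  the derivative of the integrand is bounded by a constant times \<open>k\<close>, and the mean
  value inequality passes this bound on to the quotients. The new weight has no larger support and
  the exponent stays nonpositive, so the lemma can be iterated.\<close>

lemma has_real_derivative_powr_integral:
  fixes u k :: "'a \<Rightarrow> real"
  assumes k: "integrable M k" and [measurable]: "u \<in> borel_measurable M"
    and u: "\<And>x. k x \<noteq> 0 \<Longrightarrow> 0 \<le> u x \<and> u x \<le> B" and B: "0 < B" and r: "r \<le> 0" and b: "b * B < 1"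
  shows "(powr_integral M u k r has_real_derivative powr_integral M u (\<lambda>x. - r * u x * k x) (r - 1) b) (at b)"
proof -
  have [measurable]: "k \<in> borel_measurable M" using k by auto
  \<comment> \<open>The midpoint leaves room on both sides: \<open>b\<close> is interior to
    \<open>S\<close>, and \<open>1 - y * u x\<close> stays above the positive \<open>m\<close> for
    \<open>y\<close> in \<open>S\<close>.\<close>
  define c where "c = (b + 1 / B) / 2"
  have c: "b < c" "c * B < 1" using b B by (auto simp: c_def field_simps)
  define m where "m = min 1 (1 - c * B)"
  define S where "S = {..<c}"
  have deriv: "((\<lambda>y. (1 - y * v) powr r) has_real_derivative (- r * v * (1 - y * v) powr (r - 1))) (at y)"
    if "0 \<le> v" "v \<le> B" "y \<in> S" for y v
  proof -
    have "1 - y * v > 0" using one_minus_mult_lower_bound[of v B y c] that c by (auto simp: S_def)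
    then show ?thesis by (auto intro!: derivative_eq_intros simp: algebra_simps)
  qed
  have "((\<lambda>y. (powr_integral M u k r y - powr_integral M u k r b) / (y - b))
      \<longlongrightarrow> powr_integral M u (\<lambda>x. - r * u x * k x) (r - 1) b) (at b within S)"
    unfolding tendsto_at_iff_sequentially comp_def
  proof (intro allI impI)
    fix X :: "nat \<Rightarrow> real" assume X: "\<forall>i. X i \<in> S - {b}" "X \<longlonglongrightarrow> b"
    have Xn: "X n < c" "X n \<noteq> b" for n using X(1) by (auto simp: S_def)
    have X_lim: "filterlim X (at b within S) sequentially"
      using X by (auto simp: filterlim_at)
    have int: "integrable M (\<lambda>x. (1 - y * u x) powr r * k x)" if "y \<in> S" for y
    proof (rule integrable_powr_mult[OF k _ u r])
      have "y * B < c * B" using that B by (simp add: S_def)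
      then show "y * B < 1" using c by simp
    qed auto
    have eq: "(powr_integral M u k r (X n) - powr_integral M u k r b) / (X n - b)
        = (\<integral>x. ((1 - X n * u x) powr r - (1 - b * u x) powr r) / (X n - b) * k x \<partial>M)" for n
    proof -
      have "(powr_integral M u k r (X n) - powr_integral M u k r b) / (X n - b)
         = (\<integral>x. ((1 - X n * u x) powr r * k x - (1 - b * u x) powr r * k x) / (X n - b) \<partial>M)"
        using int[of "X n"] int[of b] Xn[of n] c unfolding powr_integral_def by (simp add: S_def)
      then show ?thesis by (simp add: algebra_simps)
    qed
    show "(\<lambda>n. (powr_integral M u k r (X n) - powr_integral M u k r b) / (X n - b))
      \<longlonglongrightarrow> powr_integral M u (\<lambda>x. - r * u x * k x) (r - 1) b"
      unfolding eq unfolding powr_integral_def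
    proof (rule integral_dominated_convergence)
      show "integrable M (\<lambda>x. \<bar>r\<bar> * B * m powr (r - 1) * \<bar>k x\<bar>)"
        using k by (intro integrable_mult_right integrable_abs)
      show "AE x in M. (\<lambda>n. ((1 - X n * u x) powr r - (1 - b * u x) powr r) / (X n - b) * k x)
          \<longlonglongrightarrow> (1 - b * u x) powr (r - 1) * (- r * u x * k x)"
      proof (rule AE_I2)
        fix x
        show "(\<lambda>n. ((1 - X n * u x) powr r - (1 - b * u x) powr r) / (X n - b) * k x)
          \<longlonglongrightarrow> (1 - b * u x) powr (r - 1) * (- r * u x * k x)"
        proof (cases "k x = 0")
          case False
          have "((\<lambda>y. (1 - y * u x) powr r) has_real_derivative (- r * u x * (1 - b * u x) powr (r - 1))) (at b within S)"
            using u[OF False] c by (intro has_field_derivative_at_within[OF deriv]) (auto simp: S_def)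
          then have "(\<lambda>n. ((1 - X n * u x) powr r - (1 - b * u x) powr r) / (X n - b))
              \<longlonglongrightarrow> (- r * u x * (1 - b * u x) powr (r - 1))"
            unfolding has_field_derivative_iff by (rule filterlim_compose[OF _ X_lim])
          then have "(\<lambda>n. ((1 - X n * u x) powr r - (1 - b * u x) powr r) / (X n - b) * k x)
              \<longlonglongrightarrow> (- r * u x * (1 - b * u x) powr (r - 1)) * k x"
            by (intro tendsto_mult tendsto_const)
          then show ?thesis by (simp add: mult_ac)
        qed simp
      qed
      show "AE x in M. norm (((1 - X n * u x) powr r - (1 - b * u x) powr r) / (X n - b) * k x)
          \<le> \<bar>r\<bar> * B * m powr (r - 1) * \<bar>k x\<bar>" for n
      proof (rule AE_I2)
        fix x
        show "norm (((1 - X n * u x) powr r - (1 - b * u x) powr r) / (X n - b) * k x)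
          \<le> \<bar>r\<bar> * B * m powr (r - 1) * \<bar>k x\<bar>"
        proof (cases "k x = 0")
          case False
          note ux = u[OF False]
          have "norm ((1 - X n * u x) powr r - (1 - b * u x) powr r) \<le> (\<bar>r\<bar> * B * m powr (r - 1)) * norm (X n - b)"
          proof (rule field_differentiable_bound[where S = S and f' = "\<lambda>y. - r * u x * (1 - y * u x) powr (r - 1)"])
            show "convex S" by (simp add: S_def)
            show "((\<lambda>y. (1 - y * u x) powr r) has_field_derivative - r * u x * (1 - y * u x) powr (r - 1)) (at y within S)"
              if "y \<in> S" for y using ux that by (intro has_field_derivative_at_within[OF deriv]) auto
            show "norm (- r * u x * (1 - y * u x) powr (r - 1)) \<le> \<bar>r\<bar> * B * m powr (r - 1)" if "y \<in> S" for y
            proof -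
              have "(1 - y * u x) powr (r - 1) \<le> m powr (r - 1)"
                unfolding m_def using one_minus_mult_lower_bound[of "u x" B y c] ux that c r
                by (intro powr_mono2') (auto simp: S_def)
              then have "\<bar>r\<bar> * \<bar>u x\<bar> * \<bar>(1 - y * u x) powr (r - 1)\<bar> \<le> \<bar>r\<bar> * B * m powr (r - 1)"
                using ux by (intro mult_mono) auto
              then show ?thesis by (simp add: abs_mult)
            qed
            show "X n \<in> S" "b \<in> S" using Xn[of n] c by (auto simp: S_def)
          qed
          then have "norm (((1 - X n * u x) powr r - (1 - b * u x) powr r) / (X n - b)) \<le> \<bar>r\<bar> * B * m powr (r - 1)"
            unfolding norm_divide using Xn[of n] by (subst pos_divide_le_eq) auto
          from mult_right_mono[OF this norm_ge_zero[of "k x"]] show ?thesis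
            unfolding norm_mult[symmetric] by simp
        qed simp
      qed
    next
      show "(\<lambda>x. (1 - b * u x) powr (r - 1) * (- r * u x * k x)) \<in> borel_measurable M" by measurable
      show "(\<lambda>x. ((1 - X n * u x) powr r - (1 - b * u x) powr r) / (X n - b) * k x) \<in> borel_measurable M" for n
        by measurable
    qed
  qed
  then have "(powr_integral M u k r has_real_derivative powr_integral M u (\<lambda>x. - r * u x * k x) (r - 1) b) (at b within S)"
    by (simp add: has_field_derivative_iff)
  moreover have "at b within S = at b" using c by (intro at_within_open) (auto simp: S_def)
  ultimately show ?thesis by simp
qed

text \<open>The operator b(1-b) d^2/db^2 + (1-2b) d/db + r(r+1), whose regular solution at 0 is
  P_r(1-2b), applied in \<open>b\<close> to \<open>(1 - b * v) powr r\<close>.\<close>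

definition legendre_op :: "real \<Rightarrow> real \<Rightarrow> real \<Rightarrow> real" where
  "legendre_op r b v = b * (1 - b) * (r * (r - 1) * v\<^sup>2 * (1 - b * v) powr (r - 2))
     - (1 - 2 * b) * (r * v * (1 - b * v) powr (r - 1)) + r * (r + 1) * (1 - b * v) powr r"

text \<open>Integrability of the transformed integrand is part of the conclusion because the
  right-hand side for the triple integral is evaluated by Fubini.\<close>

lemma powr_integral_ode:
  fixes u k :: "'a \<Rightarrow> real"
  assumes k: "integrable M k" and [measurable]: "u \<in> borel_measurable M"
    and u: "\<And>x. k x \<noteq> 0 \<Longrightarrow> 0 \<le> u x \<and> u x \<le> B" and B: "0 < B" and r: "r \<le> 0"
  obtains y1 y2 where
    "\<And>b. b * B < 1 \<Longrightarrow> (powr_integral M u k r has_real_derivative y1 b) (at b)"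
    "\<And>b. b * B < 1 \<Longrightarrow> (y1 has_real_derivative y2 b) (at b)"
    "\<And>b. b * B < 1 \<Longrightarrow> b * (1 - b) * y2 b + (1 - 2 * b) * y1 b + r * (r + 1) * powr_integral M u k r b
       = (\<integral>x. legendre_op r b (u x) * k x \<partial>M)"
    "\<And>b. b * B < 1 \<Longrightarrow> integrable M (\<lambda>x. legendre_op r b (u x) * k x)"
proof
  have [measurable]: "k \<in> borel_measurable M" using k by auto
  have weighted: "integrable M (\<lambda>x. u x * f x)" if f: "integrable M f" "\<And>x. f x \<noteq> 0 \<Longrightarrow> k x \<noteq> 0" for f
  proof (rule Bochner_Integration.integrable_bound)
    have [measurable]: "f \<in> borel_measurable M" using f by auto
    show "integrable M (\<lambda>x. B * f x)" using f by simp
    show "(\<lambda>x. u x * f x) \<in> borel_measurable M" by measurable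
    show "AE x in M. norm (u x * f x) \<le> norm (B * f x)"
    proof (rule AE_I2)
      fix x show "norm (u x * f x) \<le> norm (B * f x)"
        using u[of x] f(2)[of x] B by (cases "f x = 0") (auto simp: abs_mult intro!: mult_right_mono)
    qed
  qed
  \<comment> \<open>Absorbing the factors from each differentiation into the weight keeps both
    derivatives in the form \<open>powr_integral\<close>, with exponents \<open>r - 1\<close> and
    \<open>r - 2\<close>.\<close>
  define k1 where "k1 = (\<lambda>x. - r * u x * k x)"
  define k2 where "k2 = (\<lambda>x. - (r - 1) * u x * k1 x)"
  have k1: "integrable M k1"
    using integrable_mult_right[OF weighted[OF k], of "- r"] by (simp add: k1_def mult.assoc)
  have k2: "integrable M k2"
    using integrable_mult_right[OF weighted[OF k1], of "- (r - 1)"] by (simp add: k2_def k1_def mult.assoc)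
  have u1: "0 \<le> u x \<and> u x \<le> B" if "k1 x \<noteq> 0" for x using u that by (auto simp: k1_def)
  have u2: "0 \<le> u x \<and> u x \<le> B" if "k2 x \<noteq> 0" for x using u1 that by (auto simp: k2_def)
  show "(powr_integral M u k r has_real_derivative powr_integral M u k1 (r - 1) b) (at b)" if "b * B < 1" for b
    unfolding k1_def by (rule has_real_derivative_powr_integral[OF k _ u B r that]) auto
  show "(powr_integral M u k1 (r - 1) has_real_derivative powr_integral M u k2 (r - 2) b) (at b)" if "b * B < 1" for b
    using has_real_derivative_powr_integral[OF k1 _ u1 B _ that, where r = "r - 1"] r by (simp add: k2_def)
  fix b assume b: "b * B < 1"
  have i: "integrable M (\<lambda>x. (1 - b * u x) powr r * k x)"
    by (rule integrable_powr_mult[OF k _ u r b]) auto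
  have i1: "integrable M (\<lambda>x. (1 - b * u x) powr (r - 1) * k1 x)"
    by (rule integrable_powr_mult[OF k1 _ u1 _ b]) (use r in auto)
  have i2: "integrable M (\<lambda>x. (1 - b * u x) powr (r - 2) * k2 x)"
    by (rule integrable_powr_mult[OF k2 _ u2 _ b]) (use r in auto)
  have eq: "legendre_op r b (u x) * k x = b * (1 - b) * ((1 - b * u x) powr (r - 2) * k2 x)
      + (1 - 2 * b) * ((1 - b * u x) powr (r - 1) * k1 x) + r * (r + 1) * ((1 - b * u x) powr r * k x)" for x
    unfolding legendre_op_def k2_def k1_def by (simp add: algebra_simps power2_eq_square)
  show "integrable M (\<lambda>x. legendre_op r b (u x) * k x)"
    unfolding eq using i i1 i2 by simp
  show "b * (1 - b) * powr_integral M u k2 (r - 2) b + (1 - 2 * b) * powr_integral M u k1 (r - 1) b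
      + r * (r + 1) * powr_integral M u k r b = (\<integral>x. legendre_op r b (u x) * k x \<partial>M)"
    unfolding eq powr_integral_def using i i1 i2 by simp
qed

lemma powr_decrease:
  fixes x :: real
  assumes "0 < x"
  shows "x powr r = x * x powr (r - 1)"
  using powr_mult_base[of x "r - 1"] assms by simp

text \<open>This is the exactness that makes Euler's integral solve the Legendre equation. The
  primitive carries the positive exponents \<open>r + 1\<close> and \<open>- r\<close>, so it
  extends by zero to 0 and 1.\<close>

lemma legendre_op_jacobi_weight_left:
  assumes r: "-1 < r" "r < 0" and u: "0 < u" "u < 1" and b: "0 < 1 - b * u"
  shows "((\<lambda>u. r * u powr (r + 1) * (1 - u) powr (- r) * (1 - b * u) powr (r - 1)) has_real_derivative
     jacobi_weight r u * legendre_op r b u) (at u)"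
proof -
  \<comment> \<open>Taking out the lowest power of each base leaves a polynomial identity for
    \<open>algebra\<close>.\<close>
  define A C X where "A = u powr r" and "C = (1 - u) powr (- 1 - r)" and "X = (1 - b * u) powr (r - 2)"
  have 1: "u powr (r + 1) = u * A" "(1 - u) powr (- r) = (1 - u) * C"
      "(1 - b * u) powr (r - 1) = (1 - b * u) * X"
    unfolding A_def C_def X_def
    using powr_decrease[of u "r + 1"] powr_decrease[of "1 - u" "- r"] powr_decrease[of "1 - b * u" "r - 1"] u b
    by (simp_all add: minus_diff_commute)
  have 2: "(1 - b * u) powr r = (1 - b * u)\<^sup>2 * X"
    using powr_decrease[of "1 - b * u" r] 1(3) b by (simp add: power2_eq_square)
  have "((\<lambda>u. r * u powr (r + 1) * (1 - u) powr (- r) * (1 - b * u) powr (r - 1)) has_real_derivative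
     r * ((r + 1) * u powr r * (1 - u) powr (- r) * (1 - b * u) powr (r - 1)
       + u powr (r + 1) * (r * (1 - u) powr (- 1 - r)) * (1 - b * u) powr (r - 1)
       + u powr (r + 1) * (1 - u) powr (- r) * (- b * (r - 1) * (1 - b * u) powr (r - 2)))) (at u)"
    using u b by (auto intro!: derivative_eq_intros simp: minus_diff_commute) (simp add: algebra_simps)
  moreover have "r * ((r + 1) * A * ((1 - u) * C) * ((1 - b * u) * X)
       + (u * A) * (r * C) * ((1 - b * u) * X)
       + (u * A) * ((1 - u) * C) * (- b * (r - 1) * X))
     = A * C * (b * (1 - b) * (r * (r - 1) * u\<^sup>2 * X)
     - (1 - 2 * b) * (r * u * ((1 - b * u) * X)) + r * (r + 1) * ((1 - b * u)\<^sup>2 * X))"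
    by algebra
  ultimately show ?thesis
    unfolding jacobi_weight_def legendre_op_def 1 2 A_def[symmetric] C_def[symmetric] X_def[symmetric]
    using u by (simp add: abs_of_pos C_def[symmetric])
qed

text \<open>Beyond 1 the primitive changes sign, because the derivative of |1-u| does.\<close>

lemma legendre_op_jacobi_weight_right:
  assumes r: "-1 < r" "r < 0" and u: "1 < u" and b: "0 < 1 - b * u"
  shows "((\<lambda>u. - r * u powr (r + 1) * (u - 1) powr (- r) * (1 - b * u) powr (r - 1)) has_real_derivative
     jacobi_weight r u * legendre_op r b u) (at u)"
proof -
  define A C X where "A = u powr r" and "C = (u - 1) powr (- 1 - r)" and "X = (1 - b * u) powr (r - 2)"
  have 1: "u powr (r + 1) = u * A" "(u - 1) powr (- r) = (u - 1) * C"
      "(1 - b * u) powr (r - 1) = (1 - b * u) * X"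
    unfolding A_def C_def X_def
    using powr_decrease[of u "r + 1"] powr_decrease[of "u - 1" "- r"] powr_decrease[of "1 - b * u" "r - 1"] u b
    by (simp_all add: minus_diff_commute)
  have 2: "(1 - b * u) powr r = (1 - b * u)\<^sup>2 * X"
    using powr_decrease[of "1 - b * u" r] 1(3) b by (simp add: power2_eq_square)
  have "((\<lambda>u. - r * u powr (r + 1) * (u - 1) powr (- r) * (1 - b * u) powr (r - 1)) has_real_derivative
     - r * ((r + 1) * u powr r * (u - 1) powr (- r) * (1 - b * u) powr (r - 1)
       + u powr (r + 1) * (- r * (u - 1) powr (- 1 - r)) * (1 - b * u) powr (r - 1)
       + u powr (r + 1) * (u - 1) powr (- r) * (- b * (r - 1) * (1 - b * u) powr (r - 2)))) (at u)"
    using u b by (auto intro!: derivative_eq_intros simp: minus_diff_commute) (simp add: algebra_simps)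
  moreover have "- r * ((r + 1) * A * ((u - 1) * C) * ((1 - b * u) * X)
       + (u * A) * (- r * C) * ((1 - b * u) * X)
       + (u * A) * ((u - 1) * C) * (- b * (r - 1) * X))
     = A * C * (b * (1 - b) * (r * (r - 1) * u\<^sup>2 * X)
     - (1 - 2 * b) * (r * u * ((1 - b * u) * X)) + r * (r + 1) * ((1 - b * u)\<^sup>2 * X))"
    by algebra
  ultimately show ?thesis
    unfolding jacobi_weight_def legendre_op_def 1 2 A_def[symmetric] C_def[symmetric] X_def[symmetric]
    using u by (simp add: abs_of_neg C_def[symmetric])
qed

subsection \<open>The inhomogeneous Legendre equation of the triple integral\<close>

lemma set_integrable_lborel_iff_absolutely_integrable:
  fixes f :: "real \<Rightarrow> real"
  assumes [measurable]: "f \<in> borel_measurable borel" "S \<in> sets borel"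
  shows "set_integrable lborel S f \<longleftrightarrow> f absolutely_integrable_on S"
  unfolding set_integrable_def by (rule integrable_completion[symmetric]) measurable

lemma set_integral_nonneg_has_integral:
  fixes f :: "real \<Rightarrow> real"
  assumes f: "f \<in> borel_measurable borel" "S \<in> sets borel" and nn: "\<And>x. x \<in> S \<Longrightarrow> 0 \<le> f x"
    and I: "(f has_integral I) S"
  shows "set_integrable lborel S f" "(LINT x:S|lborel. f x) = I"
proof -
  have "f absolutely_integrable_on S"
    using nonnegative_absolutely_integrable_1[of f S] I nn by (auto simp: has_integral_integrable_integral)
  then show *: "set_integrable lborel S f"
    by (simp only: set_integrable_lborel_iff_absolutely_integrable[OF f])
  show "(LINT x:S|lborel. f x) = I"
    using set_borel_integral_eq_integral(2)[OF *] I by (simp add: integral_unique)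
qed

lemma set_integrable_jacobi_weight_unit:
  assumes r: "-1 < r" "r < 0"
  shows "set_integrable lborel {0<..<1} (jacobi_weight r)"
  unfolding set_integrable_lborel_iff_absolutely_integrable[OF jacobi_weight_measurable borel_open[OF open_greaterThanLessThan]]
  by (subst absolutely_integrable_on_iff_nn_integral) (auto simp: nn_integral_jacobi_weight[OF r])

text \<open>For \<open>u > 1\<close> the factor \<open>u powr r\<close> is at most 1, and
  \<open>(u - 1) powr (- 1 - r)\<close> is integrable at 1 because its primitive has the positive
  exponent \<open>- r\<close>.\<close>

lemma set_integrable_jacobi_weight_right:
  assumes r: "-1 < r" "r < 0"
  shows "set_integrable lborel {1<..<c} (jacobi_weight r)"
proof (cases "1 < c")
  case c: True
  have "((\<lambda>u. (u - 1) powr (- 1 - r)) has_integral (c - 1) powr (- r) / (- r) - (1 - 1) powr (- r) / (- r)) {1..c}"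
  proof (rule fundamental_theorem_of_calculus_interior)
    show "continuous_on {1..c} (\<lambda>u. (u - 1) powr (- r) / (- r))"
      using r by (intro continuous_intros continuous_on_powr') auto
    show "((\<lambda>u. (u - 1) powr (- r) / (- r)) has_vector_derivative (u - 1) powr (- 1 - r)) (at u)"
      if "u \<in> {1<..<c}" for u
      unfolding has_real_derivative_iff_has_vector_derivative[symmetric]
      using that r by (auto intro!: derivative_eq_intros simp: minus_diff_commute)
  qed (use c in auto)
  then have i: "set_integrable lborel {1<..<c} (\<lambda>u. (u - 1) powr (- 1 - r))"
    by (intro set_integral_nonneg_has_integral(1)) (auto simp: has_integral_Icc_iff_Ioo)
  show ?thesis
  proof (rule set_integrable_bound[OF i])
    show "AE u in lborel. u \<in> {1<..<c} \<longrightarrow> norm (jacobi_weight r u) \<le> norm ((u - 1) powr (- 1 - r))"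
    proof (rule AE_I2, rule impI)
      fix u assume u: "u \<in> {1<..<c}"
      then have "u powr r \<le> 1" using powr_mono2'[of r 1 u] r by auto
      then have "u powr r * (u - 1) powr (- 1 - r) \<le> 1 * (u - 1) powr (- 1 - r)"
        by (rule mult_right_mono) auto
      then show "norm (jacobi_weight r u) \<le> norm ((u - 1) powr (- 1 - r))"
        using u by (simp add: jacobi_weight_def abs_mult)
    qed
  qed (simp add: set_borel_measurable_def)
next
  case False
  then show ?thesis by simp
qed

lemma set_integrable_jacobi_weight:
  assumes r: "-1 < r" "r < 0" and W: "0 \<le> W"
  shows "set_integrable lborel {min W 1<..<max W 1} (jacobi_weight r)"
proof (cases "W \<le> 1")
  case True
  then show ?thesis
    using set_integrable_subset[OF set_integrable_jacobi_weight_unit[OF r], of "{W<..<1}"] W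
    by (cases "W = 1") (auto simp: min_def max_def subset_iff)
next
  case False
  then show ?thesis using set_integrable_jacobi_weight_right[OF r, of W] by (simp add: min_def max_def)
qed

lemma legendre_op_measurable [measurable]: "legendre_op r b \<in> borel_measurable borel"
  unfolding legendre_op_def by measurable

lemma one_minus_mult_pos:
  fixes b u c :: real
  assumes "0 \<le> b" "b * c < 1" "u \<le> c"
  shows "0 < 1 - b * u"
  using mult_left_mono[OF assms(3,1)] assms(2) by simp

text \<open>The primitives on both sides vanish at 1 and have opposite signs, while the interval is
  taken without orientation. So one expression in |1-W| covers both orders of \<open>W\<close> and
  1.\<close>

lemma has_integral_legendre_op_jacobi_weight:
  assumes r: "-1 < r" "r < 0" and W: "0 \<le> W" "W \<noteq> 1" and b: "0 \<le> b" "b * max W 1 < 1"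
  shows "((\<lambda>u. jacobi_weight r u * legendre_op r b u) has_integral
     - r * W powr (r + 1) * \<bar>1 - W\<bar> powr (- r) * (1 - b * W) powr (r - 1)) {min W 1..max W 1}"
proof (cases "W < 1")
  case True
  define h where "h = (\<lambda>u. r * u powr (r + 1) * (1 - u) powr (- r) * (1 - b * u) powr (r - 1))"
  have pos: "0 < 1 - b * u" if "u \<le> 1" for u using one_minus_mult_pos[OF b, of u] that by simp
  have "((\<lambda>u. jacobi_weight r u * legendre_op r b u) has_integral h 1 - h W) {W..1}"
  proof (rule fundamental_theorem_of_calculus_interior)
    show "continuous_on {W..1} h"
      unfolding h_def using r W pos
      by (intro continuous_intros continuous_on_powr') (auto simp: less_imp_neq[symmetric])
    show "(h has_vector_derivative jacobi_weight r u * legendre_op r b u) (at u)" if "u \<in> {W<..<1}" for u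
      unfolding has_real_derivative_iff_has_vector_derivative[symmetric] h_def
      using that W pos[of u] by (intro legendre_op_jacobi_weight_left r) auto
  qed (use True in auto)
  then show ?thesis using True r by (simp add: h_def min_def max_def)
next
  case False
  define h where "h = (\<lambda>u. - r * u powr (r + 1) * (u - 1) powr (- r) * (1 - b * u) powr (r - 1))"
  have pos: "0 < 1 - b * u" if "u \<le> W" for u using one_minus_mult_pos[OF b, of u] that by simp
  have "((\<lambda>u. jacobi_weight r u * legendre_op r b u) has_integral h W - h 1) {1..W}"
  proof (rule fundamental_theorem_of_calculus_interior)
    show "continuous_on {1..W} h"
      unfolding h_def using r W pos
      by (intro continuous_intros continuous_on_powr') (auto simp: less_imp_neq[symmetric])
    show "(h has_vector_derivative jacobi_weight r u * legendre_op r b u) (at u)" if "u \<in> {1<..<W}" for u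
      unfolding has_real_derivative_iff_has_vector_derivative[symmetric] h_def
      using that W pos[of u] by (intro legendre_op_jacobi_weight_right r) auto
  qed (use False in auto)
  then show ?thesis using False W r by (simp add: h_def min_def max_def)
qed

lemma set_integrable_legendre_op_jacobi_weight:
  assumes r: "-1 < r" "r < 0" and W: "0 \<le> W" and b: "0 \<le> b" "b * max W 1 < 1"
  shows "set_integrable lborel {min W 1<..<max W 1} (\<lambda>u. jacobi_weight r u * legendre_op r b u)"
proof -
  have pos: "0 < 1 - b * u" if "u \<le> max W 1" for u using one_minus_mult_pos[OF b, of u] that by simp
  have "continuous_on {0..max W 1} (legendre_op r b)"
    unfolding legendre_op_def using pos
    by (intro continuous_intros continuous_on_powr') (auto simp: less_imp_neq[symmetric] less_imp_le)
  then have "bounded (legendre_op r b ` {0..max W 1})"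
    by (intro compact_imp_bounded compact_continuous_image) auto
  then obtain C where C: "\<And>u. u \<in> {0..max W 1} \<Longrightarrow> \<bar>legendre_op r b u\<bar> \<le> C"
    unfolding bounded_iff by (metis imageI real_norm_def)
  have i: "set_integrable lborel {min W 1<..<max W 1} (\<lambda>u. C * jacobi_weight r u)"
    using set_integrable_jacobi_weight[OF r W] by simp
  show ?thesis
  proof (rule set_integrable_bound[OF i])
    show "AE u in lborel. u \<in> {min W 1<..<max W 1} \<longrightarrow> norm (jacobi_weight r u * legendre_op r b u) \<le> norm (C * jacobi_weight r u)"
    proof (rule AE_I2, rule impI)
      fix u assume "u \<in> {min W 1<..<max W 1}"
      then have "u \<in> {0..max W 1}" using W by auto
      then have "\<bar>legendre_op r b u\<bar> \<le> \<bar>C\<bar>" using C[of u] by linarith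
      then show "norm (jacobi_weight r u * legendre_op r b u) \<le> norm (C * jacobi_weight r u)"
        using mult_right_mono[OF _ jacobi_weight_nonneg[of r u]] by (simp add: abs_mult mult.commute[of "jacobi_weight r u"])
    qed
  qed (simp add: set_borel_measurable_def)
qed

lemma integral_legendre_op_jacobi_weight:
  assumes r: "-1 < r" "r < 0" and W: "0 \<le> W" "W \<noteq> 1" and b: "0 \<le> b" "b * max W 1 < 1"
  shows "(LINT u:{min W 1<..<max W 1}|lborel. jacobi_weight r u * legendre_op r b u)
     = - r * W powr (r + 1) * \<bar>1 - W\<bar> powr (- r) * (1 - b * W) powr (r - 1)"
  using set_borel_integral_eq_integral(2)[OF set_integrable_legendre_op_jacobi_weight[OF r W(1) b]]
    has_integral_legendre_op_jacobi_weight[OF assms]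
  by (simp add: has_integral_Icc_iff_Ioo integral_unique)

text \<open>The second exactness: up to the factor -1/(a-b), the primitive is the
  \<open>r\<close>-th power of (1-bW)/(1-aW). It vanishes at \<open>1 / a\<close> because
  \<open>- r > 0\<close>, so only the endpoint \<open>V\<close> contributes. The pole at b = a of
  the inhomogeneity originates here.\<close>

lemma integral_quotient_kernel:
  fixes r a b V :: real
  assumes r: "-1 < r" "r < 0" and b: "0 \<le> b" "b < a" and V: "0 < V" "V < 1 / a"
  shows "(LINT W:{V<..<1/a}|lborel. - r * ((1 - b * W) powr (r - 1) * (1 - a * W) powr (- 1 - r)))
    = (1 - b * V) powr r * (1 - a * V) powr (- r) / (a - b)"
proof -
  have a: "0 < a" using b by linarith
  have posb: "0 < 1 - b * W" if "W \<le> 1 / a" for W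
    by (rule one_minus_mult_pos[OF b(1) _ that]) (use b a in simp)
  have posa: "0 < 1 - a * W" if "W < 1 / a" for W using that a by (simp add: field_simps)
  define h where "h = (\<lambda>W. - ((1 - b * W) powr r * (1 - a * W) powr (- r)) / (a - b))"
  have "((\<lambda>W. - r * ((1 - b * W) powr (r - 1) * (1 - a * W) powr (- 1 - r))) has_integral h (1 / a) - h V) {V..1/a}"
  proof (rule fundamental_theorem_of_calculus_interior)
    have "0 \<le> 1 - a * W" if "W \<le> 1 / a" for W using that a by (simp add: field_simps)
    then show "continuous_on {V..1/a} h"
      unfolding h_def using r b posb
      by (intro continuous_intros continuous_on_powr') (auto simp: less_imp_neq[symmetric] less_imp_le)
    fix W assume "W \<in> {V<..<1/a}"
    then have pb: "0 < 1 - b * W" and pa: "0 < 1 - a * W" using posb posa by auto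
    define X Y where "X = (1 - b * W) powr (r - 1)" and "Y = (1 - a * W) powr (- 1 - r)"
    have e: "(1 - b * W) powr r = (1 - b * W) * X" "(1 - a * W) powr (- r) = (1 - a * W) * Y"
      using powr_decrease[OF pb, of r] powr_decrease[OF pa, of "- r"] by (simp_all add: X_def Y_def minus_diff_commute)
    have "((\<lambda>W. (1 - b * W) powr r) has_real_derivative - b * (r * X)) (at W)"
      unfolding X_def using pb by (auto intro!: derivative_eq_intros)
    moreover have "((\<lambda>W. (1 - a * W) powr (- r)) has_real_derivative - a * (- r * Y)) (at W)"
      unfolding Y_def using pa by (auto intro!: derivative_eq_intros simp: minus_diff_commute)
    ultimately have "(h has_real_derivative - ((- b * (r * X)) * (1 - a * W) powr (- r) + (- a * (- r * Y)) * (1 - b * W) powr r) / (a - b)) (at W)"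
      unfolding h_def by (intro DERIV_cdivide DERIV_minus DERIV_mult)
    moreover have "- ((- b * (r * X)) * ((1 - a * W) * Y) + (- a * (- r * Y)) * ((1 - b * W) * X))
        = (a - b) * (- r * (X * Y))"
      by algebra
    ultimately have "(h has_real_derivative - r * (X * Y)) (at W)"
      unfolding e using b by simp
    then show "(h has_vector_derivative - r * ((1 - b * W) powr (r - 1) * (1 - a * W) powr (- 1 - r))) (at W)"
      by (simp add: has_real_derivative_iff_has_vector_derivative X_def Y_def)
  qed (use V in auto)
  then have "((\<lambda>W. - r * ((1 - b * W) powr (r - 1) * (1 - a * W) powr (- 1 - r))) has_integral
     (1 - b * V) powr r * (1 - a * V) powr (- r) / (a - b)) {V<..<1/a}"
    using a r by (simp add: h_def has_integral_Icc_iff_Ioo)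
  then show ?thesis
    using r by (intro set_integral_nonneg_has_integral(2)) (auto simp: mult_nonpos_nonneg)
qed

text \<open>For \<open>0 <= b < 1\<close> this is \<open>Beta (r + 1) (- r)\<close> times P_r(1-2b).
  Leaving it unnormalised keeps constants out of the integral identities.\<close>

definition legendre_integral :: "real \<Rightarrow> real \<Rightarrow> real" where
  "legendre_integral r = powr_integral lborel (\<lambda>u. u) (\<lambda>u. indicator {0<..<1} u * jacobi_weight r u) r"

lemma legendre_integral_eq: "legendre_integral r b = (LINT u:{0<..<1}|lborel. euler_kernel r b u)"
  unfolding legendre_integral_def powr_integral_def set_lebesgue_integral_def
  by (rule Bochner_Integration.integral_cong) (auto simp: euler_kernel_def)

lemma legendre_integral_ode:
  assumes r: "-1 < r" "r < 0"
  obtains y1 y2 where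
    "\<And>b. b < 1 \<Longrightarrow> (legendre_integral r has_real_derivative y1 b) (at b)"
    "\<And>b. b < 1 \<Longrightarrow> (y1 has_real_derivative y2 b) (at b)"
    "\<And>b. 0 \<le> b \<Longrightarrow> b < 1 \<Longrightarrow> b * (1 - b) * y2 b + (1 - 2 * b) * y1 b + r * (r + 1) * legendre_integral r b = 0"
proof -
  have i: "integrable lborel (\<lambda>u. indicator {0<..<1} u * jacobi_weight r u)"
    using set_integrable_jacobi_weight_unit[OF r] by (simp add: set_integrable_def)
  obtain y1 y2 where y:
    "\<And>b. b * 1 < 1 \<Longrightarrow> (legendre_integral r has_real_derivative y1 b) (at b)"
    "\<And>b. b * 1 < 1 \<Longrightarrow> (y1 has_real_derivative y2 b) (at b)"
    "\<And>b. b * 1 < 1 \<Longrightarrow> b * (1 - b) * y2 b + (1 - 2 * b) * y1 b + r * (r + 1) * legendre_integral r b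
       = (\<integral>u. legendre_op r b u * (indicator {0<..<1} u * jacobi_weight r u) \<partial>lborel)"
    unfolding legendre_integral_def
    by (rule powr_integral_ode[OF i, of "\<lambda>u. u" 1 r]) (use r in \<open>auto simp: indicator_def split: if_splits\<close>)
  \<comment> \<open>The exact-derivative formula at \<open>W = 0\<close>, where
    \<open>0 powr (r + 1) = 0\<close> removes the remaining boundary term.\<close>
  have "(\<integral>u. legendre_op r b u * (indicator {0<..<1} u * jacobi_weight r u) \<partial>lborel) = 0" if "0 \<le> b" "b < 1" for b
  proof -
    have "(\<integral>u. legendre_op r b u * (indicator {0<..<1} u * jacobi_weight r u) \<partial>lborel)
      = (LINT u:{min 0 1<..<max 0 1}|lborel. jacobi_weight r u * legendre_op r b u)"
      unfolding set_lebesgue_integral_def by (intro Bochner_Integration.integral_cong) auto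
    also have "\<dots> = 0" using that by (subst integral_legendre_op_jacobi_weight[OF r]) auto
    finally show ?thesis .
  qed
  then show thesis using y by (intro that[of y1 y2]) auto
qed

text \<open>The factor \<open>(1 - b * U) powr r\<close>, which carries all dependence on
  \<open>b\<close>, is supplied by \<open>powr_integral\<close>. With the region built into the
  kernel, \<open>U\<close> lies in [0, 1/a] on the support, which gives differentiability for
  \<open>b < a\<close>.\<close>

definition triple_kernel :: "real \<Rightarrow> real \<Rightarrow> real \<times> real \<times> real \<Rightarrow> real" where
  "triple_kernel r a = (\<lambda>(V, W, U).
     if 0 < V \<and> V < 1 \<and> V < W \<and> W < 1 / a \<and> min W 1 < U \<and> U < max W 1
     then euler_kernel r a V * (euler_kernel (-1-r) a W * jacobi_weight r U) else 0)"

abbreviation lborel3 :: "(real \<times> real \<times> real) measure" where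
  "lborel3 \<equiv> lborel \<Otimes>\<^sub>M (lborel \<Otimes>\<^sub>M lborel)"

interpretation lborel_lborel2: pair_sigma_finite lborel "lborel \<Otimes>\<^sub>M lborel :: (real \<times> real) measure" ..

lemma triple_kernel_measurable [measurable]: "triple_kernel r a \<in> borel_measurable lborel3"
  unfolding triple_kernel_def by measurable

lemma triple_kernel_support:
  assumes a: "0 < a" "a < 1" and x: "triple_kernel r a x \<noteq> 0"
  shows "0 \<le> (case x of (V, W, U) \<Rightarrow> U) \<and> (case x of (V, W, U) \<Rightarrow> U) \<le> 1 / a"
proof -
  obtain V W U where VWU: "x = (V, W, U)" by (cases x)
  have "0 < V" "V < W" "W < 1 / a" "min W 1 < U" "U < max W 1"
    using x unfolding VWU triple_kernel_def by (auto split: if_splits)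
  moreover have "1 < 1 / a" using a by simp
  ultimately have "0 \<le> U" "U \<le> 1 / a" by linarith+
  then show ?thesis by (simp add: VWU)
qed

lemma triple_kernel_measurable_Pair [measurable (raw)]:
  assumes [measurable]: "f \<in> borel_measurable M" "g \<in> borel_measurable M" "h \<in> borel_measurable M"
  shows "(\<lambda>x. triple_kernel r a (f x, g x, h x)) \<in> borel_measurable M"
  unfolding triple_kernel_def prod.case by measurable

lemma nn_integral_triple_kernel_eq:
  assumes r: "-1 < r" "r < 0" and a: "0 < a" "a < 1"
  shows "(\<integral>\<^sup>+x. ennreal (triple_kernel r a x) \<partial>lborel3)
    = ennreal (Beta (r + 1) (- r)) * (\<integral>\<^sup>+b\<in>{0<..<1}. (\<integral>\<^sup>+v\<in>{0<..<b}.
            ennreal (euler_kernel r (1-a) b * euler_kernel (-1-r) (1-a) v) \<partial>lborel) \<partial>lborel)"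
proof -
  have "(\<integral>\<^sup>+x. ennreal (triple_kernel r a x) \<partial>lborel3)
     = (\<integral>\<^sup>+V. (\<integral>\<^sup>+W. (\<integral>\<^sup>+U. ennreal (triple_kernel r a (V, W, U)) \<partial>lborel) \<partial>lborel) \<partial>lborel)"
    by (simp add: lborel.nn_integral_fst[symmetric] lborel_pair.P.nn_integral_fst[symmetric])
  also have "\<dots> = (\<integral>\<^sup>+V\<in>{0<..<1}. (\<integral>\<^sup>+W\<in>{V<..<1/a}. (\<integral>\<^sup>+U\<in>{min W 1<..<max W 1}.
            ennreal (euler_kernel r a V * (euler_kernel (-1-r) a W * jacobi_weight r U)) \<partial>lborel) \<partial>lborel) \<partial>lborel)"
    by (intro nn_integral_cong) (auto simp: triple_kernel_def indicator_def intro!: nn_integral_cong)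
  finally show ?thesis using nn_integral_triple_kernel[OF assms] by simp
qed


lemma set_integrable_euler_kernel:
  assumes r: "-1 < r" "r < 0" and c: "c < 1"
  shows "set_integrable lborel {0<..<1} (euler_kernel r c)"
proof -
  have "integrable lborel (\<lambda>u. (1 - c * u) powr r * (indicator {0<..<1} u * jacobi_weight r u))"
    by (rule integrable_powr_mult[where B = 1])
       (use set_integrable_jacobi_weight_unit[OF r] r c in \<open>auto simp: set_integrable_def indicator_def split: if_splits\<close>)
  then show ?thesis by (simp add: set_integrable_def euler_kernel_def mult_ac)
qed

lemma nn_integral_euler_kernel:
  assumes r: "-1 < r" "r < 0" and c: "c < 1"
  shows "(\<integral>\<^sup>+u\<in>{0<..<1}. ennreal (euler_kernel r c u) \<partial>lborel) = ennreal (legendre_integral r c)"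
proof -
  have "(\<integral>\<^sup>+u\<in>{0<..<1}. ennreal (euler_kernel r c u) \<partial>lborel) = (\<integral>\<^sup>+u. ennreal (indicator {0<..<1} u *\<^sub>R euler_kernel r c u) \<partial>lborel)"
    by (intro nn_integral_cong) (auto split: split_indicator)
  also have "\<dots> = ennreal (legendre_integral r c)"
    unfolding legendre_integral_eq set_lebesgue_integral_def
    using set_integrable_euler_kernel[OF assms] by (intro nn_integral_eq_integral) (auto simp: set_integrable_def)
  finally show ?thesis .
qed

text \<open>After an exchange of variables in the second integral, the regions v < b and b < v fill
  the unit square up to the diagonal, which is null.\<close>

lemma nn_integral_triangles:
  fixes f g :: "real \<Rightarrow> real"
  assumes [measurable]: "f \<in> borel_measurable borel" "g \<in> borel_measurable borel"
    and nn: "\<And>x. 0 \<le> f x" "\<And>x. 0 \<le> g x"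
  shows "(\<integral>\<^sup>+b\<in>{0<..<1}. (\<integral>\<^sup>+v\<in>{0<..<b}. ennreal (f b * g v) \<partial>lborel) \<partial>lborel)
     + (\<integral>\<^sup>+b\<in>{0<..<1}. (\<integral>\<^sup>+v\<in>{0<..<b}. ennreal (g b * f v) \<partial>lborel) \<partial>lborel)
    = (\<integral>\<^sup>+b\<in>{0<..<1}. ennreal (f b) \<partial>lborel) * (\<integral>\<^sup>+v\<in>{0<..<1}. ennreal (g v) \<partial>lborel)"
proof -
  let ?T = "\<lambda>P b v. (if 0 < b \<and> b < 1 \<and> 0 < v \<and> v < (1::real) \<and> P b v then ennreal (f b * g v) else 0)"
  have 1: "(\<integral>\<^sup>+b\<in>{0<..<1}. (\<integral>\<^sup>+v\<in>{0<..<b}. ennreal (f b * g v) \<partial>lborel) \<partial>lborel)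
    = (\<integral>\<^sup>+b. (\<integral>\<^sup>+v. ?T (\<lambda>b v. v < b) b v \<partial>lborel) \<partial>lborel)"
    by (intro nn_integral_cong) (auto simp: indicator_def intro!: nn_integral_cong)
  have "(\<integral>\<^sup>+b\<in>{0<..<1}. (\<integral>\<^sup>+v\<in>{0<..<b}. ennreal (g b * f v) \<partial>lborel) \<partial>lborel)
    = (\<integral>\<^sup>+b. (\<integral>\<^sup>+v. ?T (\<lambda>b v. b < v) v b \<partial>lborel) \<partial>lborel)"
    by (intro nn_integral_cong) (auto simp: indicator_def mult.commute intro!: nn_integral_cong)
  also have "\<dots> = (\<integral>\<^sup>+b. (\<integral>\<^sup>+v. ?T (\<lambda>b v. b < v) b v \<partial>lborel) \<partial>lborel)"
    by (rule lborel_pair.Fubini') measurable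
  finally have "(\<integral>\<^sup>+b\<in>{0<..<1}. (\<integral>\<^sup>+v\<in>{0<..<b}. ennreal (f b * g v) \<partial>lborel) \<partial>lborel)
     + (\<integral>\<^sup>+b\<in>{0<..<1}. (\<integral>\<^sup>+v\<in>{0<..<b}. ennreal (g b * f v) \<partial>lborel) \<partial>lborel)
    = (\<integral>\<^sup>+b. (\<integral>\<^sup>+v. ?T (\<lambda>b v. v < b) b v \<partial>lborel) + (\<integral>\<^sup>+v. ?T (\<lambda>b v. b < v) b v \<partial>lborel) \<partial>lborel)"
    unfolding 1 by (subst nn_integral_add) simp_all
  also have "\<dots> = (\<integral>\<^sup>+b. (\<integral>\<^sup>+v\<in>{0<..<1}. ennreal (g v) \<partial>lborel) * (ennreal (f b) * indicator {0<..<1} b) \<partial>lborel)"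
  proof (rule nn_integral_cong)
    fix b
    have "(\<integral>\<^sup>+v. ?T (\<lambda>b v. v < b) b v \<partial>lborel) + (\<integral>\<^sup>+v. ?T (\<lambda>b v. b < v) b v \<partial>lborel)
      = (\<integral>\<^sup>+v. ?T (\<lambda>b v. v < b) b v + ?T (\<lambda>b v. b < v) b v \<partial>lborel)"
      by (subst nn_integral_add) simp_all
    also have "\<dots> = (\<integral>\<^sup>+v. (ennreal (f b) * indicator {0<..<1} b) * (ennreal (g v) * indicator {0<..<1} v) \<partial>lborel)"
    proof (rule nn_integral_cong_AE)
      show "AE v in lborel. ?T (\<lambda>b v. v < b) b v + ?T (\<lambda>b v. b < v) b v
          = (ennreal (f b) * indicator {0<..<1} b) * (ennreal (g v) * indicator {0<..<1} v)"
        using AE_lborel_singleton[of b] by eventually_elim (auto simp: indicator_def ennreal_mult nn)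
    qed
    also have "\<dots> = (\<integral>\<^sup>+v\<in>{0<..<1}. ennreal (g v) \<partial>lborel) * (ennreal (f b) * indicator {0<..<1} b)"
      by (subst nn_integral_cmult) (simp_all add: mult.commute)
    finally show "(\<integral>\<^sup>+v. ?T (\<lambda>b v. v < b) b v \<partial>lborel) + (\<integral>\<^sup>+v. ?T (\<lambda>b v. b < v) b v \<partial>lborel)
      = (\<integral>\<^sup>+v\<in>{0<..<1}. ennreal (g v) \<partial>lborel) * (ennreal (f b) * indicator {0<..<1} b)" .
  qed
  also have "\<dots> = (\<integral>\<^sup>+b\<in>{0<..<1}. ennreal (f b) \<partial>lborel) * (\<integral>\<^sup>+v\<in>{0<..<1}. ennreal (g v) \<partial>lborel)"
    by (subst nn_integral_cmult) (simp_all add: mult.commute)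
  finally show ?thesis .
qed

text \<open>One triangle is dominated by the whole square, a product of two finite Euler integrals.
  Integrability of the triple kernel follows from this.\<close>

lemma kernel_triangle_finite:
  assumes r: "-1 < r" "r < 0" and c: "c < 1"
  shows "(\<integral>\<^sup>+b\<in>{0<..<1}. (\<integral>\<^sup>+v\<in>{0<..<b}. ennreal (euler_kernel r c b * euler_kernel (-1-r) c v) \<partial>lborel) \<partial>lborel) < \<infinity>"
    (is "?x < \<infinity>")
proof -
  have "?x \<le> ?x + (\<integral>\<^sup>+b\<in>{0<..<1}. (\<integral>\<^sup>+v\<in>{0<..<b}. ennreal (euler_kernel (-1-r) c b * euler_kernel r c v) \<partial>lborel) \<partial>lborel)"
    by simp
  also have "\<dots> = ennreal (legendre_integral r c) * ennreal (legendre_integral (-1-r) c)"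
    using nn_integral_triangles[of "euler_kernel r c" "euler_kernel (-1-r) c"] r c by (simp add: nn_integral_euler_kernel)
  also have "\<dots> < \<infinity>" by (simp add: ennreal_mult_less_top)
  finally show ?thesis .
qed

lemma integrable_triple_kernel:
  assumes r: "-1 < r" "r < 0" and a: "0 < a" "a < 1"
  shows "integrable lborel3 (triple_kernel r a)"
proof (rule integrableI_nonneg)
  show "AE x in lborel3. 0 \<le> triple_kernel r a x"
    by (auto simp: triple_kernel_def)
  show "(\<integral>\<^sup>+x. ennreal (triple_kernel r a x) \<partial>lborel3) < \<infinity>"
    unfolding nn_integral_triple_kernel_eq[OF assms]
    using kernel_triangle_finite[OF r, of "1 - a"] a
    by (simp add: ennreal_mult_less_top)
qed measurable

definition triple_integral :: "real \<Rightarrow> real \<Rightarrow> real \<Rightarrow> real" where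
  "triple_integral r a = powr_integral lborel3 (\<lambda>(V, W, U). U) (triple_kernel r a) r"

text \<open>Integration in \<open>U\<close> leaves a boundary term at \<open>W\<close> whose factors
  \<open>W powr (r + 1)\<close> and |1-W| to the power \<open>- r\<close> cancel against
  \<open>euler_kernel (-1-r) a W\<close>. What remains is exact in \<open>W\<close>, and its
  boundary value at \<open>V\<close> turns \<open>euler_kernel r a V\<close> into
  \<open>euler_kernel r b V / (a - b)\<close>.\<close>

lemma integral_legendre_op_triple_kernel:
  assumes r: "-1 < r" "r < 0" and a: "a < 1" and b: "0 \<le> b" "b < a"
    and i: "integrable lborel3 (\<lambda>x. legendre_op r b ((\<lambda>(V, W, U). U) x) * triple_kernel r a x)"
  shows "(\<integral>x. legendre_op r b ((\<lambda>(V, W, U). U) x) * triple_kernel r a x \<partial>lborel3)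
    = legendre_integral r b / (a - b)"
proof -
  have a0: "0 < a" using b by simp
  let ?f = "\<lambda>x. legendre_op r b ((\<lambda>(V, W, U). U) x) * triple_kernel r a x"
  have inner: "(\<integral>U. ?f (V, W, U) \<partial>lborel)
     = indicator {0<..<1} V * (euler_kernel r a V * (indicator {V<..<1/a} W *
        (- r * ((1 - b * W) powr (r - 1) * (1 - a * W) powr (- 1 - r)))))" if "W \<noteq> 1" for V W
  proof (cases "V \<in> {0<..<1} \<and> W \<in> {V<..<1/a}")
    case True
    have b1: "b * max W 1 < 1"
    proof -
      have "b * (1 / a) < 1" using b a0 by simp
      moreover have "b * max W 1 \<le> b * (1 / a)"
        using True a a0 b by (intro mult_left_mono) (auto simp: field_simps)
      ultimately show ?thesis by simp
    qed
    have "(\<integral>U. ?f (V, W, U) \<partial>lborel) = (\<integral>U. (euler_kernel r a V * euler_kernel (-1-r) a W) * (indicator {min W 1<..<max W 1} U *\<^sub>R (jacobi_weight r U * legendre_op r b U)) \<partial>lborel)"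
      using True by (intro Bochner_Integration.integral_cong) (auto simp: triple_kernel_def)
    also have "\<dots> = (euler_kernel r a V * euler_kernel (-1-r) a W) * (LINT U:{min W 1<..<max W 1}|lborel. jacobi_weight r U * legendre_op r b U)"
      unfolding set_lebesgue_integral_def by simp
    also have "\<dots> = (euler_kernel r a V * euler_kernel (-1-r) a W) * (- r * W powr (r + 1) * \<bar>1 - W\<bar> powr (- r) * (1 - b * W) powr (r - 1))"
      using True that b b1 by (subst integral_legendre_op_jacobi_weight[OF r]) auto
    also have "\<dots> = euler_kernel r a V * (- r * ((1 - b * W) powr (r - 1) * (1 - a * W) powr (- 1 - r)))
        * ((W powr (- 1 - r) * W powr (r + 1)) * (\<bar>1 - W\<bar> powr r * \<bar>1 - W\<bar> powr (- r)))"
      by (simp add: euler_kernel_def[of "-1-r"] jacobi_weight_def mult_ac)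
    also have "(W powr (- 1 - r) * W powr (r + 1)) * (\<bar>1 - W\<bar> powr r * \<bar>1 - W\<bar> powr (- r)) = 1"
      using True that by (simp flip: powr_add)
    finally show ?thesis using True by simp
  next
    case False
    then show ?thesis by (auto simp: triple_kernel_def indicator_def)
  qed
  have mid: "(\<integral>W. (\<integral>U. ?f (V, W, U) \<partial>lborel) \<partial>lborel) = indicator {0<..<1} V * (euler_kernel r b V / (a - b))" for V
  proof -
    have "(\<integral>W. (\<integral>U. ?f (V, W, U) \<partial>lborel) \<partial>lborel)
      = (\<integral>W. indicator {0<..<1} V * euler_kernel r a V * (indicator {V<..<1/a} W *\<^sub>R
        (- r * ((1 - b * W) powr (r - 1) * (1 - a * W) powr (- 1 - r)))) \<partial>lborel)"
    proof (rule integral_cong_AE)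
      show "AE W in lborel. (\<integral>U. ?f (V, W, U) \<partial>lborel) = indicator {0<..<1} V * euler_kernel r a V * (indicator {V<..<1/a} W *\<^sub>R
        (- r * ((1 - b * W) powr (r - 1) * (1 - a * W) powr (- 1 - r))))"
        using AE_lborel_singleton[of 1]
      proof eventually_elim
        case (elim W)
        then show ?case using inner[of W V] by (simp add: mult_ac)
      qed
    qed simp_all
    also have "\<dots> = indicator {0<..<1} V * euler_kernel r a V *
       (LINT W:{V<..<1/a}|lborel. - r * ((1 - b * W) powr (r - 1) * (1 - a * W) powr (- 1 - r)))"
      unfolding set_lebesgue_integral_def by simp
    also have "\<dots> = indicator {0<..<1} V * (euler_kernel r b V / (a - b))"
    proof (cases "V \<in> {0<..<1}")
      case True
      then have V: "0 < V" "V < 1 / a" and p: "0 < 1 - a * V"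
        using a a0 mult_strict_mono[of a 1 V 1] by (auto simp: field_simps)
      have "(1 - a * V) powr r * (1 - a * V) powr (- r) = 1" using p by (simp flip: powr_add)
      then show ?thesis
        unfolding integral_quotient_kernel[OF r b V] euler_kernel_def
        by (simp add: mult.assoc)
    qed simp
    finally show ?thesis .
  qed
  have "integral\<^sup>L lborel3 ?f = (\<integral>V. (\<integral>y. ?f (V, y) \<partial>(lborel \<Otimes>\<^sub>M lborel)) \<partial>lborel)"
    by (rule lborel_lborel2.integral_fst'[OF i, symmetric])
  also have "\<dots> = (\<integral>V. indicator {0<..<1} V * (euler_kernel r b V / (a - b)) \<partial>lborel)"
  proof (rule integral_cong_AE)
    show "AE V in lborel. (\<integral>y. ?f (V, y) \<partial>(lborel \<Otimes>\<^sub>M lborel)) = indicator {0<..<1} V * (euler_kernel r b V / (a - b))"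
      \<comment> \<open>Sections are known to be integrable for almost every \<open>V\<close> only,
        which is enough under the outer integral.\<close>
      using lborel_lborel2.AE_integrable_fst'[OF i]
    proof eventually_elim
      fix V assume "integrable (lborel \<Otimes>\<^sub>M lborel) (\<lambda>y. ?f (V, y))"
      from lborel_pair.integral_fst'[OF this] mid[of V]
      show "(\<integral>y. ?f (V, y) \<partial>(lborel \<Otimes>\<^sub>M lborel)) = indicator {0<..<1} V * (euler_kernel r b V / (a - b))"
        by simp
    qed
    show "(\<lambda>V. \<integral>y. ?f (V, y) \<partial>(lborel \<Otimes>\<^sub>M lborel)) \<in> borel_measurable lborel"
      using lborel_lborel2.integrable_fst'[OF i] by auto
  qed measurable
  also have "\<dots> = legendre_integral r b / (a - b)"
    unfolding legendre_integral_eq set_lebesgue_integral_def by simp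
  finally show ?thesis .
qed

lemma triple_integral_ode:
  assumes r: "-1 < r" "r < 0" and a: "0 < a" "a < 1"
  obtains y1 y2 where
    "\<And>b. b < a \<Longrightarrow> (triple_integral r a has_real_derivative y1 b) (at b)"
    "\<And>b. b < a \<Longrightarrow> (y1 has_real_derivative y2 b) (at b)"
    "\<And>b. 0 \<le> b \<Longrightarrow> b < a \<Longrightarrow> b * (1 - b) * y2 b + (1 - 2 * b) * y1 b + r * (r + 1) * triple_integral r a b
        = legendre_integral r b / (a - b)"
proof -
  obtain y1 y2 where y:
    "\<And>b. b * (1 / a) < 1 \<Longrightarrow> (triple_integral r a has_real_derivative y1 b) (at b)"
    "\<And>b. b * (1 / a) < 1 \<Longrightarrow> (y1 has_real_derivative y2 b) (at b)"
    "\<And>b. b * (1 / a) < 1 \<Longrightarrow> b * (1 - b) * y2 b + (1 - 2 * b) * y1 b + r * (r + 1) * triple_integral r a b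
       = (\<integral>x. legendre_op r b ((\<lambda>(V, W, U). U) x) * triple_kernel r a x \<partial>lborel3)"
    "\<And>b. b * (1 / a) < 1 \<Longrightarrow> integrable lborel3 (\<lambda>x. legendre_op r b ((\<lambda>(V, W, U). U) x) * triple_kernel r a x)"
    unfolding triple_integral_def
  proof (rule powr_integral_ode[OF integrable_triple_kernel[OF assms], of "\<lambda>(V, W, U). U" "1 / a" r])
    show "0 \<le> (case x of (V, W, U) \<Rightarrow> U) \<and> (case x of (V, W, U) \<Rightarrow> U) \<le> 1 / a" if "triple_kernel r a x \<noteq> 0" for x
      by (rule triple_kernel_support[OF a that])
  qed (use r a in auto)
  have *: "b * (1 / a) < 1 \<longleftrightarrow> b < a" for b using a by simp
  show thesis
    using y integral_legendre_op_triple_kernel[OF r a(2)] unfolding * by (intro that[of y1 y2]) auto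
qed

subsection \<open>Legendre functions, Wronskian and variation of parameters\<close>

lemma Beta_pos:
  fixes r :: real
  assumes "-1 < r" "r < 0"
  shows "0 < Beta (r + 1) (- r)"
  using assms by (simp add: Beta_def)

lemma triple_kernel_nonneg: "0 \<le> triple_kernel r a x"
  by (cases x) (auto simp: triple_kernel_def)

lemma legendre_integral_nonneg: "0 \<le> legendre_integral r c"
  unfolding legendre_integral_eq set_lebesgue_integral_def
  by (intro Bochner_Integration.integral_nonneg) auto

lemma triple_integral_0:
  assumes r: "-1 < r" "r < 0" and a: "0 < a" "a < 1"
  shows "0 \<le> triple_integral r a 0"
    and "ennreal (triple_integral r a 0) = ennreal (Beta (r + 1) (- r)) * (\<integral>\<^sup>+b\<in>{0<..<1}. (\<integral>\<^sup>+v\<in>{0<..<b}.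
            ennreal (euler_kernel r (1-a) b * euler_kernel (-1-r) (1-a) v) \<partial>lborel) \<partial>lborel)"
proof -
  have eq: "triple_integral r a 0 = (\<integral>x. triple_kernel r a x \<partial>lborel3)"
    by (simp add: triple_integral_def powr_integral_def)
  show "0 \<le> triple_integral r a 0"
    unfolding eq by (intro Bochner_Integration.integral_nonneg triple_kernel_nonneg)
  show "ennreal (triple_integral r a 0) = ennreal (Beta (r + 1) (- r)) * (\<integral>\<^sup>+b\<in>{0<..<1}. (\<integral>\<^sup>+v\<in>{0<..<b}.
            ennreal (euler_kernel r (1-a) b * euler_kernel (-1-r) (1-a) v) \<partial>lborel) \<partial>lborel)"
    unfolding eq nn_integral_triple_kernel_eq[OF assms, symmetric]
    by (intro nn_integral_eq_integral[symmetric] integrable_triple_kernel assms AE_I2 triple_kernel_nonneg)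
qed

text \<open>The Beta factor is symmetric under r -> -1-r, so both triangles carry the same constant
  and can be joined to a square.\<close>

lemma triple_integral_0_sum:
  assumes r: "-1 < r" "r < 0" and a: "0 < a" "a < 1"
  shows "triple_integral r a 0 + triple_integral (-1-r) a 0
    = Beta (r + 1) (- r) * (legendre_integral r (1-a) * legendre_integral (-1-r) (1-a))"
proof -
  have r': "-1 < -1-r" "-1-r < 0" using r by auto
  have B: "Beta (-1-r + 1) (- (-1-r)) = Beta (r + 1) (- r)"
    using Beta_commute[of "- r" "r + 1"] by (simp add: add.commute)
  have "ennreal (triple_integral r a 0 + triple_integral (-1-r) a 0)
     = ennreal (triple_integral r a 0) + ennreal (triple_integral (-1-r) a 0)"
    using triple_integral_0(1)[OF r a] triple_integral_0(1)[OF r' a] by simp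
  also have "\<dots> = ennreal (Beta (r + 1) (- r)) *
      (ennreal (legendre_integral r (1-a)) * ennreal (legendre_integral (-1-r) (1-a)))"
    unfolding triple_integral_0(2)[OF r a] triple_integral_0(2)[OF r' a] B distrib_left[symmetric]
    using nn_integral_triangles[of "euler_kernel r (1-a)" "euler_kernel (-1-r) (1-a)"] r a by (simp add: nn_integral_euler_kernel)
  also have "\<dots> = ennreal (Beta (r + 1) (- r) * (legendre_integral r (1-a) * legendre_integral (-1-r) (1-a)))"
    using Beta_pos[OF r] legendre_integral_nonneg by (simp add: ennreal_mult)
  finally show ?thesis
    using triple_integral_0(1)[OF r a] triple_integral_0(1)[OF r' a] Beta_pos[OF r] legendre_integral_nonneg[of r "1-a"]
      legendre_integral_nonneg[of "-1-r" "1-a"]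
    by (subst (asm) ennreal_inj) auto
qed

section \<open>Hypergeometric series and reflection of the Euler integral\<close>

lemma nn_integral_power_jacobi_weight:
  assumes r: "-1 < r" "r < 0"
  shows "(\<integral>\<^sup>+u\<in>{0<..<1}. ennreal (u ^ n * jacobi_weight r u) \<partial>lborel)
    = ennreal (Beta (r + 1) (- r) * pochhammer (r + 1) n / fact n)"
proof -
  have "(\<integral>\<^sup>+u\<in>{0<..<1}. ennreal (u ^ n * jacobi_weight r u) \<partial>lborel)
     = (\<integral>\<^sup>+u\<in>{0<..<1}. ennreal (u powr (r + 1 + real n - 1) * (1 - u) powr (- r - 1)) \<partial>lborel)"
    by (intro set_nn_integral_cong_on) (simp add: jacobi_weight_def powr_add powr_realpow minus_diff_commute mult_ac)
  also have "\<dots> = ennreal (Beta (r + 1 + real n) (- r))"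
    using r by (intro nn_integral_Beta) auto
  also have "Beta (r + 1 + real n) (- r) = Beta (r + 1) (- r) * pochhammer (r + 1) n / fact n"
  proof -
    have "Gamma (r + 1 + real n) = pochhammer (r + 1) n * Gamma (r + 1)"
    proof -
      have "r + 1 \<notin> \<int>\<^sub>\<le>\<^sub>0" using r by (auto dest: nonpos_Ints_nonpos)
      moreover have "0 < Gamma (r + 1)" using r by (intro Gamma_real_pos) simp
      ultimately show ?thesis using pochhammer_Gamma[of "r + 1" n] by simp
    qed
    then show ?thesis by (simp add: Beta_def Gamma_fact add.commute)
  qed
  finally show ?thesis .
qed

text \<open>Binomial expansion of \<open>(1 - t * u) powr r\<close>. For \<open>r < 0\<close> and
  \<open>t >= 0\<close> all coefficients are nonnegative, so monotone convergence permits termwise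
  integration against the weight, with Beta values as moments.\<close>

lemma legendre_integral_sums:
  assumes r: "-1 < r" "r < 0" and t: "0 \<le> t" "t < 1"
  shows "(\<lambda>n. pochhammer (- r) n * pochhammer (r + 1) n / (fact n * fact n) * t ^ n)
     sums (legendre_integral r t / Beta (r + 1) (- r))"
proof -
  define B where "B = Beta (r + 1) (- r)"
  have B: "0 < B" using Beta_pos[OF r] by (simp add: B_def)
  define d where "d n = pochhammer (- r) n / fact n * t ^ n" for n
  have d: "0 \<le> d n" for n
    unfolding d_def using r t pochhammer_pos[of "- r" n] by (simp add: less_imp_le)
  have e: "0 \<le> d n * (B * pochhammer (r + 1) n / fact n)" for n
    using d B r pochhammer_pos[of "r + 1" n] by (simp add: less_imp_le)
  have "ennreal (legendre_integral r t) = (\<integral>\<^sup>+u\<in>{0<..<1}. ennreal (euler_kernel r t u) \<partial>lborel)"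
    using nn_integral_euler_kernel[OF r t(2)] by simp
  also have "\<dots> = (\<integral>\<^sup>+u. (\<Sum>n. ennreal (d n) * (ennreal (u ^ n * jacobi_weight r u) * indicator {0<..<1} u)) \<partial>lborel)"
  proof (rule nn_integral_cong)
    fix u :: real
    show "ennreal (euler_kernel r t u) * indicator {0<..<1} u
      = (\<Sum>n. ennreal (d n) * (ennreal (u ^ n * jacobi_weight r u) * indicator {0<..<1} u))"
    proof (cases "u \<in> {0<..<1}")
      case True
      have "t * u < 1" using mult_strict_mono[of t 1 u 1] True t by auto
      then have "(\<lambda>n. (r gchoose n) * (- (t * u)) ^ n) sums (1 + (- (t * u))) powr r"
        using True t by (intro gen_binomial_real) auto
      also have "(\<lambda>n. (r gchoose n) * (- (t * u)) ^ n) = (\<lambda>n. d n * u ^ n)"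
      proof
        fix n
        have "(- 1) ^ n * (- (t * u)) ^ n = (t * u) ^ n"
          by (simp flip: power_mult_distrib)
        then show "(r gchoose n) * (- (t * u)) ^ n = d n * u ^ n"
          by (simp add: gbinomial_pochhammer d_def power_mult_distrib field_simps)
      qed
      finally have s: "(\<lambda>n. d n * u ^ n * jacobi_weight r u) sums (euler_kernel r t u)"
        unfolding euler_kernel_def using sums_mult2[of "\<lambda>n. d n * u ^ n" "(1 - t * u) powr r" "jacobi_weight r u"] by (simp add: mult.commute)
      have "(\<Sum>n. ennreal (d n * u ^ n * jacobi_weight r u)) = ennreal (euler_kernel r t u)"
        using s True d by (intro suminf_ennreal_eq) auto
      moreover have "ennreal (d n * u ^ n * jacobi_weight r u) = ennreal (d n) * ennreal (u ^ n * jacobi_weight r u)" for n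
        using d True by (simp add: ennreal_mult mult.assoc)
      ultimately show ?thesis using True by simp
    qed simp
  qed
  also have "\<dots> = (\<Sum>n. \<integral>\<^sup>+u. ennreal (d n) * (ennreal (u ^ n * jacobi_weight r u) * indicator {0<..<1} u) \<partial>lborel)"
    by (rule nn_integral_suminf) measurable
  also have "\<dots> = (\<Sum>n. ennreal (d n * (B * pochhammer (r + 1) n / fact n)))"
  proof (rule suminf_cong)
    fix n
    have "(\<integral>\<^sup>+u. ennreal (d n) * (ennreal (u ^ n * jacobi_weight r u) * indicator {0<..<1} u) \<partial>lborel)
      = ennreal (d n) * (\<integral>\<^sup>+u\<in>{0<..<1}. ennreal (u ^ n * jacobi_weight r u) \<partial>lborel)"
      by (rule nn_integral_cmult) measurable
    then show "(\<integral>\<^sup>+u. ennreal (d n) * (ennreal (u ^ n * jacobi_weight r u) * indicator {0<..<1} u) \<partial>lborel)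
      = ennreal (d n * (B * pochhammer (r + 1) n / fact n))"
      unfolding nn_integral_power_jacobi_weight[OF r] B_def ennreal_mult'[OF d] by simp
  qed
  finally have eq: "(\<Sum>n. ennreal (d n * (B * pochhammer (r + 1) n / fact n))) = ennreal (legendre_integral r t)" ..
  then have s: "summable (\<lambda>n. d n * (B * pochhammer (r + 1) n / fact n))"
    using e by (intro summable_suminf_not_top) auto
  have "ennreal (\<Sum>n. d n * (B * pochhammer (r + 1) n / fact n)) = ennreal (legendre_integral r t)"
    using eq suminf_ennreal2[OF e s] by (simp only:)
  then have "(\<Sum>n. d n * (B * pochhammer (r + 1) n / fact n)) = legendre_integral r t"
    using suminf_nonneg[OF s e] legendre_integral_nonneg[of r t] by (simp only: ennreal_inj)
  with s have "(\<lambda>n. d n * (B * pochhammer (r + 1) n / fact n)) sums legendre_integral r t"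
    by (simp add: sums_iff)
  then have "(\<lambda>n. d n * (B * pochhammer (r + 1) n / fact n) / B) sums (legendre_integral r t / B)"
    by (rule sums_divide)
  then show ?thesis
    using B by (simp add: d_def B_def[symmetric] mult_ac)
qed

lemma hyp2F1_eq_legendre_integral:
  assumes r: "-1 < r" "r < 0" and t: "0 \<le> t" "t < 1"
  shows "hyp2F1 (- of_real r) (of_real r + 1) 1 (of_real t) = of_real (legendre_integral r t / Beta (r + 1) (- r))"
proof -
  have "fps_nth (fps_hypergeo [- complex_of_real r, of_real r + 1] [1] 1) n * of_real t ^ n
     = of_real (pochhammer (- r) n * pochhammer (r + 1) n / (fact n * fact n) * t ^ n)" for n
    using pochhammer_of_real[of "- r" n, where 'a = complex] pochhammer_of_real[of "r + 1" n, where 'a = complex]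
    by (simp add: pochhammer_fact[symmetric])
  moreover have "(\<lambda>n. complex_of_real (pochhammer (- r) n * pochhammer (r + 1) n / (fact n * fact n) * t ^ n))
      sums of_real (legendre_integral r t / Beta (r + 1) (- r))"
    using legendre_integral_sums[OF assms] by (simp only: sums_of_real_iff)
  ultimately show ?thesis
    using t by (simp add: hyp2F1_def eval_fps_def sums_iff)
qed

text \<open>The map r -> -1-r exchanges the two upper parameters \<open>- r\<close> and
  \<open>r + 1\<close> of a series symmetric in them.\<close>

lemma legendre_integral_reflect:
  assumes r: "-1 < r" "r < 0" and t: "0 \<le> t" "t < 1"
  shows "legendre_integral (-1-r) t = legendre_integral r t"
proof -
  have r': "-1 < -1-r" "-1-r < 0" using r by auto
  have B: "Beta (-1-r + 1) (- (-1-r)) = Beta (r + 1) (- r)"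
    using Beta_commute[of "- r" "r + 1"] by (simp add: add.commute)
  have "legendre_integral (-1-r) t / Beta (r + 1) (- r) = legendre_integral r t / Beta (r + 1) (- r)"
    using legendre_integral_sums[OF r' t] legendre_integral_sums[OF r t]
    unfolding B by (simp add: sums_iff mult.commute add.commute)
  then show ?thesis using Beta_pos[OF r] by simp
qed

lemma legendre_integral_0:
  assumes r: "-1 < r" "r < 0"
  shows "legendre_integral r 0 = Beta (r + 1) (- r)"
proof -
  have "ennreal (legendre_integral r 0) = ennreal (Beta (r + 1) (- r))"
    using nn_integral_euler_kernel[OF r, of 0] nn_integral_jacobi_weight[OF r] by (simp add: euler_kernel_def)
  then show ?thesis
    using legendre_integral_nonneg[of r 0] Beta_pos[OF r] by (subst (asm) ennreal_inj) auto
qed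

lemma Beta_reflection:
  fixes r :: real
  assumes "-1 < r" "r < 0"
  shows "Beta (r + 1) (- r) = - pi / sin (r * pi)"
proof -
  have "complex_of_real (Gamma (- r) * Gamma (1 + r)) = Gamma (of_real (- r)) * Gamma (1 - of_real (- r))"
    using Gamma_complex_of_real[of "- r"] Gamma_complex_of_real[of "1 + r"] by simp
  also have "\<dots> = of_real pi / sin (of_real pi * of_real (- r))"
    by (rule Gamma_reflection_complex)
  also have "\<dots> = complex_of_real (pi / sin (pi * (- r)))"
    by (simp flip: sin_of_real)
  finally have "Gamma (- r) * Gamma (1 + r) = pi / sin (pi * (- r))"
    by (simp only: of_real_eq_iff)
  then show ?thesis by (simp add: Beta_def mult.commute add.commute)
qed

section \<open>Behaviour at the logarithmic singularity\<close>

lemma legendre_integral_upper_bound: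
  assumes r: "-1 < r" "r < 0" and x: "0 \<le> x" "x < 1"
  shows "legendre_integral r x \<le> (1 - x) powr r * Beta (r + 1) (- r)"
proof -
  have "legendre_integral r x \<le> (LINT u:{0<..<1}|lborel. (1 - x) powr r * euler_kernel r 0 u)"
    unfolding legendre_integral_eq
  proof (rule set_integral_mono)
    fix u :: real assume u: "u \<in> {0<..<1}"
    have "x * u \<le> x" using u x mult_left_mono[of u 1 x] by simp
    then have "(1 - x * u) powr r \<le> (1 - x) powr r" using x r by (intro powr_mono2') auto
    then have "jacobi_weight r u * (1 - x * u) powr r \<le> jacobi_weight r u * (1 - x) powr r" by (rule mult_left_mono) simp
    then show "euler_kernel r x u \<le> (1 - x) powr r * euler_kernel r 0 u" by (simp add: euler_kernel_def mult.commute)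
  qed (use set_integrable_euler_kernel[OF r x(2)] set_integrable_euler_kernel[OF r, of 0] in auto)
  also have "\<dots> = (1 - x) powr r * legendre_integral r 0"
    unfolding legendre_integral_eq by simp
  finally show ?thesis by (simp add: legendre_integral_0[OF r])
qed

text \<open>The bound by \<open>(1 - x) powr r\<close> is far above the true logarithmic growth, but
  it suffices because \<open>r + 1 > 0\<close>.\<close>

lemma tendsto_legendre_integral_at_1:
  assumes r: "-1 < r" "r < 0"
  shows "((\<lambda>x. (1 - x) * legendre_integral r x) \<longlongrightarrow> 0) (at_left 1)"
proof (rule tendsto_sandwich)
  show "\<forall>\<^sub>F x in at_left 1. 0 \<le> (1 - x) * legendre_integral r x"
    by (rule eventually_at_leftI[of 0]) (auto simp: legendre_integral_nonneg)
  have "\<forall>\<^sub>F x in at_left (1::real). 0 < x \<and> x < 1"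
    by (rule eventually_at_leftI[of 0]) auto
  then show "\<forall>\<^sub>F x in at_left 1. (1 - x) * legendre_integral r x \<le> (1 - x) powr (r + 1) * Beta (r + 1) (- r)"
  proof eventually_elim
    case (elim x)
    then have "(1 - x) * legendre_integral r x \<le> (1 - x) * ((1 - x) powr r * Beta (r + 1) (- r))"
      using legendre_integral_upper_bound[OF r, of x] by (intro mult_left_mono) auto
    also have "\<dots> = (1 - x) powr (r + 1) * Beta (r + 1) (- r)"
      using powr_decrease[of "1 - x" "r + 1"] elim by simp
    finally show ?case .
  qed
  have "((\<lambda>x::real. (1 - x) powr (r + 1) * Beta (r + 1) (- r)) \<longlongrightarrow> (1 - 1) powr (r + 1) * Beta (r + 1) (- r)) (at_left 1)"
    using r by (intro tendsto_intros) (auto simp: eventually_at_filter)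
  then show "((\<lambda>x::real. (1 - x) powr (r + 1) * Beta (r + 1) (- r)) \<longlongrightarrow> 0) (at_left 1)"
    using r by simp
qed simp

text \<open>Differentiation under the integral writes \<open>(1 - x) * y x\<close> as the mean of
  \<open>u powr (r + 1)\<close> under a probability density \<open>g x\<close> on (0, 1). As
  \<open>x\<close> tends to 1 this density concentrates at \<open>u = 1\<close>, where the averaged
  function is 1. The limit fixes the constant of the Wronskian.\<close>

lemma tendsto_legendre_integral_deriv_at_1:
  assumes r: "-1 < r" "r < 0" and y: "\<And>x. x < 1 \<Longrightarrow> (legendre_integral r has_real_derivative y x) (at x)"
  shows "((\<lambda>x. (1 - x) * y x) \<longlongrightarrow> 1) (at_left 1)"
proof -
  \<comment> \<open>\<open>\<rho> x \<delta>\<close> is the mass of the density \<open>g x\<close>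
    on the interval from \<open>\<delta>\<close> to 1: it is 1 at 0, and \<open>g x\<close> is minus
    its derivative.\<close>
  define \<rho> where "\<rho> x u = ((1 - u) / (1 - x * u)) powr (- r)" for x u :: real
  define g where "g x u = - r * (1 - x) * (1 - u) powr (- 1 - r) * (1 - x * u) powr (r - 1)" for x u :: real
  have pos: "0 < 1 - x * u" if "0 < x" "x < 1" "u \<le> 1" for x u :: real
    using one_minus_mult_pos[of x 1 u] that by simp
  have gi: "set_integrable lborel {\<delta><..<1} (g x)" "(LINT u:{\<delta><..<1}|lborel. g x u) = \<rho> x \<delta>"
    if x: "0 < x" "x < 1" and \<delta>: "0 \<le> \<delta>" "\<delta> < 1" for x \<delta>
  proof -
    have "(g x has_integral (- \<rho> x 1) - (- \<rho> x \<delta>)) {\<delta>..1}"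
    proof (rule fundamental_theorem_of_calculus_interior)
      show "continuous_on {\<delta>..1} (\<lambda>u. - \<rho> x u)"
        unfolding \<rho>_def using r pos[OF x]
        by (intro continuous_intros continuous_on_powr') (auto simp: less_imp_neq[symmetric] less_imp_le)
      fix u assume u: "u \<in> {\<delta><..<1}"
      then have p: "0 < 1 - u" "0 < 1 - x * u" using pos[OF x, of u] by auto
      have "((\<lambda>u. (1 - u) / (1 - x * u)) has_real_derivative (x - 1) / (1 - x * u)\<^sup>2) (at u)"
        using p by (auto intro!: derivative_eq_intros simp: power2_eq_square algebra_simps)
      then have "((\<lambda>u. ((1 - u) / (1 - x * u)) powr (- r)) has_real_derivative
          (- r) * ((1 - u) / (1 - x * u)) powr (- r - of_nat 1) * ((x - 1) / (1 - x * u)\<^sup>2)) (at u)"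
        using p by (intro DERIV_fun_powr) auto
      have K: "((1 - u) / (1 - x * u)) powr (- r - of_nat 1) / (1 - x * u)\<^sup>2
          = (1 - u) powr (- 1 - r) * (1 - x * u) powr (r - 1)"
        by (rule ln_eqI) (use p in \<open>simp_all add: ln_mult ln_div ln_powr ln_realpow algebra_simps\<close>)
      note dd = \<open>((\<lambda>u. ((1 - u) / (1 - x * u)) powr (- r)) has_real_derivative _) (at u)\<close>
      have "(- r) * ((1 - u) / (1 - x * u)) powr (- r - of_nat 1) * ((x - 1) / (1 - x * u)\<^sup>2)
          = - r * (x - 1) * (((1 - u) / (1 - x * u)) powr (- r - of_nat 1) / (1 - x * u)\<^sup>2)"
        by simp
      also have "\<dots> = - g x u"
        unfolding g_def K by (simp add: algebra_simps)
      finally have "((\<lambda>u. ((1 - u) / (1 - x * u)) powr (- r)) has_real_derivative - g x u) (at u)"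
        using dd by simp
      then have "((\<lambda>u. - \<rho> x u) has_real_derivative g x u) (at u)"
        unfolding \<rho>_def using DERIV_minus by fastforce
      then show "((\<lambda>u. - \<rho> x u) has_vector_derivative g x u) (at u)"
        by (simp add: has_real_derivative_iff_has_vector_derivative)
    qed (use \<delta> in auto)
    then have *: "(g x has_integral \<rho> x \<delta>) {\<delta><..<1}"
      using r by (simp add: \<rho>_def has_integral_Icc_iff_Ioo)
    have gm: "g x \<in> borel_measurable borel" unfolding g_def by measurable
    have "0 \<le> g x u" for u unfolding g_def using r x by (intro mult_nonneg_nonneg) auto
    then show "set_integrable lborel {\<delta><..<1} (g x)" "(LINT u:{\<delta><..<1}|lborel. g x u) = \<rho> x \<delta>"
      using set_integral_nonneg_has_integral[OF gm _ _ *] by auto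
  qed
  have gnn: "0 \<le> g x u" if "0 < x" "x < 1" for x u unfolding g_def using r that by (intro mult_nonneg_nonneg) auto
  have i: "integrable lborel (\<lambda>u. indicator {0<..<1} u * jacobi_weight r u)"
    using set_integrable_jacobi_weight_unit[OF r] by (simp add: set_integrable_def)
  have yx: "(1 - x) * y x = (LINT u:{0<..<1}|lborel. u powr (r + 1) * g x u)" if x: "0 < x" "x < 1" for x
  proof -
    have "y x = powr_integral lborel (\<lambda>u. u) (\<lambda>u. - r * u * (indicator {0<..<1} u * jacobi_weight r u)) (r - 1) x"
    proof (rule DERIV_unique[OF y[OF x(2)]])
      show "(legendre_integral r has_real_derivative
         powr_integral lborel (\<lambda>u. u) (\<lambda>u. - r * u * (indicator {0<..<1} u * jacobi_weight r u)) (r - 1) x) (at x)"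
        unfolding legendre_integral_def
        by (rule has_real_derivative_powr_integral[OF i, where B = 1])
           (use r x in \<open>auto simp: indicator_def split: if_splits\<close>)
    qed
    then have "(1 - x) * y x = (\<integral>u. (1 - x) * ((1 - x * u) powr (r - 1) * (- r * u * (indicator {0<..<1} u * jacobi_weight r u))) \<partial>lborel)"
      by (simp add: powr_integral_def)
    also have "\<dots> = (LINT u:{0<..<1}|lborel. u powr (r + 1) * g x u)"
      unfolding set_lebesgue_integral_def
      by (intro Bochner_Integration.integral_cong)
         (auto simp: indicator_def g_def jacobi_weight_def powr_decrease[of _ "r + 1"])
    finally show ?thesis .
  qed
  have ui: "set_integrable lborel {0<..<1} (\<lambda>u. u powr (r + 1) * g x u)" if x: "0 < x" "x < 1" for x
  proof (rule set_integrable_bound[OF gi(1)[OF x, of 0]])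
    show "AE u in lborel. u \<in> {0<..<1} \<longrightarrow> norm (u powr (r + 1) * g x u) \<le> norm (g x u)"
    proof (rule AE_I2, rule impI)
      fix u :: real assume "u \<in> {0<..<1}"
      then have "u powr (r + 1) \<le> 1" using r by (intro powr_le1) auto
      then show "norm (u powr (r + 1) * g x u) \<le> norm (g x u)"
        using mult_right_mono[of "u powr (r + 1)" 1 "\<bar>g x u\<bar>"] by (simp add: abs_mult)
    qed
  qed (auto simp: set_borel_measurable_def g_def)
  have ev: "\<forall>\<^sub>F x in at_left (1::real). 0 < x \<and> x < 1"
    by (rule eventually_at_leftI[of 0]) auto
  show ?thesis
  proof (rule tendsto_sandwich)
    show "\<forall>\<^sub>F x in at_left 1. (1 - x) * y x \<le> 1"
      using ev
    proof eventually_elim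
      case (elim x)
      then have x: "0 < x" "x < 1" by auto
      have "(LINT u:{0<..<1}|lborel. u powr (r + 1) * g x u) \<le> (LINT u:{0<..<1}|lborel. g x u)"
      proof (rule set_integral_mono[OF ui[OF x] gi(1)[OF x]])
        fix u :: real assume "u \<in> {0<..<1}"
        then have "u powr (r + 1) \<le> 1" using r by (intro powr_le1) auto
        then show "u powr (r + 1) * g x u \<le> g x u"
          using mult_right_mono[of "u powr (r + 1)" 1 "g x u"] gnn[OF x] by simp
      qed auto
      then show ?case using yx[OF x] gi(2)[OF x, of 0] by (simp add: \<rho>_def)
    qed
    text \<open>The mass of the derivative concentrates at \<open>u = 1\<close>: cutting at distance \<open>sqrt (1 - x)\<close>
      loses nothing in the limit.\<close>
    show "\<forall>\<^sub>F x in at_left 1. (1 - sqrt (1 - x)) powr (r + 1) * \<rho> x (1 - sqrt (1 - x)) \<le> (1 - x) * y x"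
      using ev
    proof eventually_elim
      case (elim x)
      then have x: "0 < x" "x < 1" by auto
      define \<delta> where "\<delta> = 1 - sqrt (1 - x)"
      have \<delta>: "0 \<le> \<delta>" "\<delta> < 1" using x by (auto simp: \<delta>_def)
      have ud: "set_integrable lborel {\<delta><..<1} (\<lambda>u. u powr (r + 1) * g x u)"
        by (rule set_integrable_subset[OF ui[OF x]]) (use \<delta> in auto)
      have "\<delta> powr (r + 1) * \<rho> x \<delta> = (LINT u:{\<delta><..<1}|lborel. \<delta> powr (r + 1) * g x u)"
        using gi(2)[OF x \<delta>] by simp
      also have "\<dots> \<le> (LINT u:{\<delta><..<1}|lborel. u powr (r + 1) * g x u)"
      proof (rule set_integral_mono)
        show "set_integrable lborel {\<delta><..<1} (\<lambda>u. \<delta> powr (r + 1) * g x u)"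
          using gi(1)[OF x \<delta>] by simp
        show "set_integrable lborel {\<delta><..<1} (\<lambda>u. u powr (r + 1) * g x u)"
          by (rule ud)
        fix u assume "u \<in> {\<delta><..<1}"
        then show "\<delta> powr (r + 1) * g x u \<le> u powr (r + 1) * g x u"
          using r \<delta> by (intro mult_right_mono powr_mono2 gnn[OF x]) auto
      qed
      also have "\<dots> \<le> (LINT u:{0<..<1}|lborel. u powr (r + 1) * g x u)"
        unfolding set_lebesgue_integral_def
      proof (rule integral_mono)
        show "integrable lborel (\<lambda>u. indicator {\<delta><..<1} u *\<^sub>R (u powr (r + 1) * g x u))"
          using ud by (simp only: set_integrable_def)
        show "integrable lborel (\<lambda>u. indicator {0<..<1} u *\<^sub>R (u powr (r + 1) * g x u))"
          using ui[OF x] by (simp add: set_integrable_def)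
        show "indicator {\<delta><..<1} u *\<^sub>R (u powr (r + 1) * g x u) \<le> indicator {0<..<1} u *\<^sub>R (u powr (r + 1) * g x u)" for u
          using \<delta> gnn[OF x] by (auto simp: indicator_def)
      qed
      finally show ?case by (simp add: \<delta>_def yx[OF x])
    qed
    have ev_eq: "\<forall>\<^sub>F x in at_left 1. (1 - sqrt (1 - x)) powr (r + 1) * (1 / (1 + sqrt (1 - x) - (1 - x))) powr (- r)
        = (1 - sqrt (1 - x)) powr (r + 1) * \<rho> x (1 - sqrt (1 - x))"
      using ev
    proof eventually_elim
      case (elim x)
      define q where "q = sqrt (1 - x)"
      have q: "0 < q" "x = 1 - q * q" using elim by (auto simp: q_def)
      \<comment> \<open>The factor \<open>q\<close> cancels in the quotient defining
        \<open>\<rho>\<close>, which leaves an expression continuous at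
        \<open>x = 1\<close>.\<close>
      have "1 - x * (1 - q) = q * (1 + q - q * q)" unfolding q(2) by algebra
      then have "\<rho> x (1 - q) = (1 / (1 + q - q * q)) powr (- r)"
        unfolding \<rho>_def using q(1) by simp
      then show ?case using q by (simp add: q_def[symmetric])
    qed
    have "((\<lambda>x. (1 - sqrt (1 - x)) powr (r + 1) * (1 / (1 + sqrt (1 - x) - (1 - x))) powr (- r))
       \<longlongrightarrow> (1 - sqrt (1 - 1)) powr (r + 1) * (1 / (1 + sqrt (1 - 1) - (1 - 1))) powr (- r)) (at_left 1)"
      by (intro tendsto_intros) auto
    from Lim_transform_eventually[OF this ev_eq]
    show "((\<lambda>x. (1 - sqrt (1 - x)) powr (r + 1) * \<rho> x (1 - sqrt (1 - x))) \<longlongrightarrow> 1) (at_left 1)"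
      by simp
  qed simp
qed


lemma DERIV_reflect_1:
  fixes g g' :: "real \<Rightarrow> real"
  assumes "(g has_real_derivative g' (1 - x)) (at (1 - x))"
  shows "((\<lambda>x. g (1 - x)) has_real_derivative - g' (1 - x)) (at x)"
proof -
  have "((\<lambda>x::real. 1 - x) has_real_derivative - 1) (at x)" by (auto intro!: derivative_eq_intros)
  from DERIV_chain2[OF assms this] show ?thesis by simp
qed

lemma tendsto_legendre_integral_at_0:
  assumes r: "-1 < r" "r < 0" and y: "\<And>x. x < 1 \<Longrightarrow> (legendre_integral r has_real_derivative y x) (at x)"
  shows "((\<lambda>x. x * legendre_integral r (1 - x)) \<longlongrightarrow> 0) (at_right 0)"
    and "((\<lambda>x. x * y (1 - x)) \<longlongrightarrow> 1) (at_right 0)"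
proof -
  have "((\<lambda>x::real. 1 - x) \<longlongrightarrow> 1 - 0) (at_right 0)" by (intro tendsto_intros)
  then have fl: "filterlim (\<lambda>x::real. 1 - x) (at_left 1) (at_right 0)"
    unfolding filterlim_at by (auto intro!: eventually_at_rightI[of 0 1])
  show "((\<lambda>x. x * legendre_integral r (1 - x)) \<longlongrightarrow> 0) (at_right 0)"
    using filterlim_compose[OF tendsto_legendre_integral_at_1[OF r] fl] by simp
  show "((\<lambda>x. x * y (1 - x)) \<longlongrightarrow> 1) (at_right 0)"
    using filterlim_compose[OF tendsto_legendre_integral_deriv_at_1[OF r y] fl] by simp
qed

text \<open>Abel's identity makes \<open>t * (1 - t)\<close> times the Wronskian of the solution and
  its reflection constant; the plus sign comes from differentiating a function of
  \<open>1 - t\<close>. The constant is read off as the limit at 0, where the reflection is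
  singular: \<open>t * legendre_integral r (1 - t)\<close> tends to 0 and
  \<open>t * y1 (1 - t)\<close> to 1.\<close>

lemma legendre_wronskian:
  assumes r: "-1 < r" "r < 0"
    and y: "\<And>x. x < 1 \<Longrightarrow> (legendre_integral r has_real_derivative y1 x) (at x)"
      "\<And>x. x < 1 \<Longrightarrow> (y1 has_real_derivative y2 x) (at x)"
      "\<And>x. 0 \<le> x \<Longrightarrow> x < 1 \<Longrightarrow> x * (1 - x) * y2 x + (1 - 2 * x) * y1 x + r * (r + 1) * legendre_integral r x = 0"
    and t: "0 < t" "t < 1"
  shows "t * (1 - t) * (legendre_integral r t * y1 (1 - t) + y1 t * legendre_integral r (1 - t)) = Beta (r + 1) (- r)"
proof -
  let ?f = "legendre_integral r"
  define w where "w t = t * (1 - t) * (?f t * y1 (1 - t) + y1 t * ?f (1 - t))" for t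
  have dw: "(w has_real_derivative 0) (at x)" if x: "0 < x" "x < 1" for x
  proof -
    have "(w has_real_derivative (1 - 2 * x) * (?f x * y1 (1 - x) + y1 x * ?f (1 - x))
        + x * (1 - x) * ((y1 x * y1 (1 - x) - ?f x * y2 (1 - x)) + (y2 x * ?f (1 - x) - y1 x * y1 (1 - x)))) (at x)"
      unfolding w_def using x
      by (auto intro!: derivative_eq_intros y(1) y(2) DERIV_reflect_1[where g = ?f and g' = y1] DERIV_reflect_1[where g = y1 and g' = y2]
          simp: algebra_simps)
    moreover have "(1 - 2 * x) * (?f x * y1 (1 - x) + y1 x * ?f (1 - x))
        + x * (1 - x) * ((y1 x * y1 (1 - x) - ?f x * y2 (1 - x)) + (y2 x * ?f (1 - x) - y1 x * y1 (1 - x))) = 0"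
      using y(3)[of x] y(3)[of "1 - x"] x by simp algebra
    ultimately show ?thesis by simp
  qed
  have const: "w x = w t" if "0 < x" "x < 1" for x
    by (rule has_field_derivative_zero_constant[of "{0<..<1}" w, THEN exE])
       (use dw that t in \<open>auto intro: has_field_derivative_at_within\<close>)
  have ev: "\<forall>\<^sub>F x in at_right (0::real). 0 < x \<and> x < 1"
    by (rule eventually_at_rightI[of 0 1]) auto
  note A = tendsto_legendre_integral_at_0(1)[OF r y(1)] and B = tendsto_legendre_integral_at_0(2)[OF r y(1)]
  have f0: "(?f \<longlongrightarrow> ?f 0) (at_right 0)" and y0: "(y1 \<longlongrightarrow> y1 0) (at_right 0)"
    using DERIV_isCont[OF y(1)[of 0]] DERIV_isCont[OF y(2)[of 0]]
    by (auto simp: isCont_def intro: tendsto_within_subset)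
  have "((\<lambda>x. (1 - x) * (?f x * (x * y1 (1 - x)) + y1 x * (x * ?f (1 - x)))) \<longlongrightarrow> (1 - 0) * (?f 0 * 1 + y1 0 * 0)) (at_right 0)"
    by (intro tendsto_intros A B f0 y0)
  then have "((\<lambda>x::real. w t) \<longlongrightarrow> (1 - 0) * (?f 0 * 1 + y1 0 * 0)) (at_right 0)"
  proof (rule Lim_transform_eventually)
    show "\<forall>\<^sub>F x in at_right 0. (1 - x) * (?f x * (x * y1 (1 - x)) + y1 x * (x * ?f (1 - x))) = w t"
      using ev
    proof eventually_elim
      case (elim x)
      have "(1 - x) * (?f x * (x * y1 (1 - x)) + y1 x * (x * ?f (1 - x))) = w x"
        unfolding w_def by algebra
      then show ?case using const elim by simp
    qed
  qed
  then have "w t = ?f 0"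
    using tendsto_unique[of "at_right (0::real)"] by (simp add: tendsto_const_iff)
  then show ?thesis by (simp add: w_def legendre_integral_0[OF r])
qed


lemma variation_of_parameters:
  assumes r: "-1 < r" "r < 0" and b: "0 < b" "b < a" and a: "a < 1"
  defines "f \<equiv> legendre_integral r"
  obtains I1 I2 where
    "((\<lambda>t. (f t)\<^sup>2 / (t - a)) has_integral I1) {0..b}"
    "((\<lambda>t. f t * f (1 - t) / (t - a)) has_integral I2) {0..b}"
    "f (1 - b) * I1 - f b * I2
      = Beta (r + 1) (- r) / 2 * (triple_integral r a b + triple_integral (-1-r) a b - (f (1 - a))\<^sup>2 * f b)"
proof -
  have r': "-1 < -1-r" "-1-r < 0" using r by auto
  have a0: "0 < a" using b by simp
  obtain f1 f2 where f: "\<And>x. x < 1 \<Longrightarrow> (f has_real_derivative f1 x) (at x)"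
    "\<And>x. x < 1 \<Longrightarrow> (f1 has_real_derivative f2 x) (at x)"
    "\<And>x. 0 \<le> x \<Longrightarrow> x < 1 \<Longrightarrow> x * (1 - x) * f2 x + (1 - 2 * x) * f1 x + r * (r + 1) * f x = 0"
    unfolding f_def using legendre_integral_ode[OF r] by metis
  obtain u1 u2 where u: "\<And>x. x < a \<Longrightarrow> (triple_integral r a has_real_derivative u1 x) (at x)"
    "\<And>x. x < a \<Longrightarrow> (u1 has_real_derivative u2 x) (at x)"
    "\<And>x. 0 \<le> x \<Longrightarrow> x < a \<Longrightarrow> x * (1 - x) * u2 x + (1 - 2 * x) * u1 x + r * (r + 1) * triple_integral r a x
        = legendre_integral r x / (a - x)"
    using triple_integral_ode[OF r a0 a] by metis
  obtain v1 v2 where v: "\<And>x. x < a \<Longrightarrow> (triple_integral (-1-r) a has_real_derivative v1 x) (at x)"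
    "\<And>x. x < a \<Longrightarrow> (v1 has_real_derivative v2 x) (at x)"
    "\<And>x. 0 \<le> x \<Longrightarrow> x < a \<Longrightarrow> x * (1 - x) * v2 x + (1 - 2 * x) * v1 x + (-1-r) * (-1-r + 1) * triple_integral (-1-r) a x
        = legendre_integral (-1-r) x / (a - x)"
    using triple_integral_ode[OF r' a0 a] by metis
  \<comment> \<open>Since the two triple integrals sum to \<open>Beta (r + 1) (- r) * c\<close> at 0
    and \<open>f 0\<close> is that Beta value, subtracting the homogeneous solution
    \<open>c * f\<close> makes \<open>y\<close> vanish at 0.\<close>
  define c where "c = (f (1 - a))\<^sup>2"
  define y where "y x = triple_integral r a x + triple_integral (-1-r) a x - c * f x" for x
  define y1 where "y1 x = u1 x + v1 x - c * f1 x" for x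
  define y2 where "y2 x = u2 x + v2 x - c * f2 x" for x
  have dy: "(y has_real_derivative y1 x) (at x)" "(y1 has_real_derivative y2 x) (at x)" if "x < a" for x
    unfolding y_def y1_def y2_def using that a
    by (auto intro!: derivative_eq_intros u(1,2) v(1,2) f(1,2))
  have ode: "x * (1 - x) * y2 x + (1 - 2 * x) * y1 x + r * (r + 1) * y x = 2 * f x / (a - x)"
    if x: "0 \<le> x" "x < a" for x
  proof -
    have "x * (1 - x) * v2 x + (1 - 2 * x) * v1 x + r * (r + 1) * triple_integral (-1-r) a x = f x / (a - x)"
      using v(3)[OF x] legendre_integral_reflect[OF r, of x] x a by (simp add: f_def algebra_simps)
    moreover have "x * (1 - x) * u2 x + (1 - 2 * x) * u1 x + r * (r + 1) * triple_integral r a x = f x / (a - x)"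
      using u(3)[OF x] by (simp add: f_def)
    moreover have "x * (1 - x) * f2 x + (1 - 2 * x) * f1 x + r * (r + 1) * f x = 0"
      using f(3)[of x] x a by simp
    ultimately have "x * (1 - x) * y2 x + (1 - 2 * x) * y1 x + r * (r + 1) * y x = f x / (a - x) + f x / (a - x)"
      unfolding y_def y1_def y2_def by algebra
    then show ?thesis by simp
  qed
  have y0: "y 0 = 0"
    using triple_integral_0_sum[OF r a0 a] legendre_integral_reflect[OF r, of "1 - a"] a a0
    by (simp add: y_def c_def f_def legendre_integral_0[OF r] power2_eq_square)
  \<comment> \<open>\<open>m1\<close> and \<open>m2\<close> are \<open>t * (1 - t)\<close> times the
    Wronskians of \<open>y\<close> with \<open>f\<close> and with its reflection. The inhomogeneity
    \<open>2 * f x / (a - x)\<close> makes their derivatives -2 times the two integrands.\<close>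
  define m1 where "m1 t = t * (1 - t) * (f t * y1 t - f1 t * y t)" for t
  define m2 where "m2 t = t * (1 - t) * (f (1 - t) * y1 t + f1 (1 - t) * y t)" for t
  have dm1: "(m1 has_real_derivative - 2 * ((f t)\<^sup>2 / (t - a))) (at t)" if t: "0 \<le> t" "t < a" for t
  proof -
    have "(m1 has_real_derivative (1 - 2 * t) * (f t * y1 t - f1 t * y t)
       + t * (1 - t) * ((f1 t * y1 t + f t * y2 t) - (f2 t * y t + f1 t * y1 t))) (at t)"
      unfolding m1_def using t a
      by (auto intro!: derivative_eq_intros f(1,2) dy simp: algebra_simps)
    also have "(1 - 2 * t) * (f t * y1 t - f1 t * y t)
       + t * (1 - t) * ((f1 t * y1 t + f t * y2 t) - (f2 t * y t + f1 t * y1 t)) = f t * (2 * f t / (a - t))"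
      using f(3)[of t] ode[OF t] t a by simp algebra
    also have "\<dots> = - 2 * ((f t)\<^sup>2 / (t - a))"
      using t by (simp add: field_simps power2_eq_square)
    finally show ?thesis .
  qed
  have dm2: "(m2 has_real_derivative - 2 * (f t * f (1 - t) / (t - a))) (at t)" if t: "0 < t" "t < a" for t
  proof -
    have "(m2 has_real_derivative (1 - 2 * t) * (f (1 - t) * y1 t + f1 (1 - t) * y t)
       + t * (1 - t) * ((- f1 (1 - t) * y1 t + f (1 - t) * y2 t) + (- f2 (1 - t) * y t + f1 (1 - t) * y1 t))) (at t)"
      unfolding m2_def using t a
      by (auto intro!: derivative_eq_intros f(1,2) dy DERIV_reflect_1[where g = f and g' = f1]
          DERIV_reflect_1[where g = f1 and g' = f2] simp: algebra_simps)
    also have "(1 - 2 * t) * (f (1 - t) * y1 t + f1 (1 - t) * y t)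
       + t * (1 - t) * ((- f1 (1 - t) * y1 t + f (1 - t) * y2 t) + (- f2 (1 - t) * y t + f1 (1 - t) * y1 t))
       = f (1 - t) * (2 * f t / (a - t))"
      using f(3)[of "1 - t"] ode[of t] t a by simp algebra
    also have "\<dots> = - 2 * (f t * f (1 - t) / (t - a))"
      using t by (simp add: field_simps)
    finally show ?thesis .
  qed
  have "((\<lambda>t. - 2 * ((f t)\<^sup>2 / (t - a))) has_integral m1 b - m1 0) {0..b}"
  proof (rule fundamental_theorem_of_calculus)
    show "(m1 has_vector_derivative - 2 * ((f t)\<^sup>2 / (t - a))) (at t within {0..b})" if "t \<in> {0..b}" for t
      using dm1[of t] that b by (simp add: has_real_derivative_iff_has_vector_derivative has_vector_derivative_at_within)
  qed (use b in simp)
  from has_integral_mult_right[OF this, of "- 1 / 2"]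
  have I1: "((\<lambda>t. (f t)\<^sup>2 / (t - a)) has_integral - m1 b / 2) {0..b}"
    by (simp add: m1_def)
  have "((\<lambda>t. - 2 * (f t * f (1 - t) / (t - a))) has_integral m2 b - m2 0) {0..b}"
  proof (rule fundamental_theorem_of_calculus_interior)
    have "continuous (at t within {0..b}) m2" if t: "t \<in> {0..b}" for t
    proof (cases "t = 0")
      case True
      \<comment> \<open>Because \<open>t * f1 (1 - t)\<close> tends to 1, the limit of
        \<open>m2\<close> at 0 is \<open>y 0\<close>. The normalisation \<open>y 0 = 0\<close> is
        what makes \<open>m2\<close> continuous there.\<close>
      have "(f1 \<longlongrightarrow> f1 0) (at_right 0)" "(y \<longlongrightarrow> y 0) (at_right 0)" "(y1 \<longlongrightarrow> y1 0) (at_right 0)"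
        using DERIV_isCont[OF f(2)[of 0]] DERIV_isCont[OF dy(1)[of 0]] DERIV_isCont[OF dy(2)[of 0]] a0
        by (auto simp: isCont_def intro: tendsto_within_subset)
      then have "((\<lambda>t. (1 - t) * ((t * f (1 - t)) * y1 t + (t * f1 (1 - t)) * y t))
          \<longlongrightarrow> (1 - 0) * (0 * y1 0 + 1 * y 0)) (at_right 0)"
        unfolding f_def
        by (intro tendsto_intros tendsto_legendre_integral_at_0(1)[OF r f(1)[unfolded f_def]]
            tendsto_legendre_integral_at_0(2)[OF r f(1)[unfolded f_def]])
      moreover have "(\<lambda>t. (1 - t) * ((t * f (1 - t)) * y1 t + (t * f1 (1 - t)) * y t)) = m2"
        unfolding m2_def by (rule ext) algebra
      ultimately have "(m2 \<longlongrightarrow> 0) (at_right 0)" by (simp add: y0)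
      moreover have "m2 0 = 0" by (simp add: m2_def)
      ultimately show ?thesis
        using True b by (simp add: continuous_within at_within_Icc_at_right)
    next
      case False
      then show ?thesis
        using DERIV_isCont[OF dm2[of t]] t b by (simp add: continuous_at_imp_continuous_at_within)
    qed
    then show "continuous_on {0..b} m2" by (simp add: continuous_on_eq_continuous_within)
    show "(m2 has_vector_derivative - 2 * (f t * f (1 - t) / (t - a))) (at t)" if "t \<in> {0<..<b}" for t
      using dm2[of t] that b by (simp add: has_real_derivative_iff_has_vector_derivative)
  qed (use b in simp)
  from has_integral_mult_right[OF this, of "- 1 / 2"]
  have I2: "((\<lambda>t. f t * f (1 - t) / (t - a)) has_integral - m2 b / 2) {0..b}"
    by (simp add: m2_def)
  have W: "b * (1 - b) * (f b * f1 (1 - b) + f1 b * f (1 - b)) = Beta (r + 1) (- r)"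
    unfolding f_def using b a f[unfolded f_def] by (intro legendre_wronskian[OF r]) auto
  \<comment> \<open>This combination eliminates \<open>y1 b\<close> and leaves the Wronskian of the
    two homogeneous solutions times \<open>y b\<close>.\<close>
  have "f (1 - b) * (- m1 b / 2) - f b * (- m2 b / 2) = Beta (r + 1) (- r) / 2 * y b"
    unfolding W[symmetric] m1_def m2_def by (simp add: field_simps)
  with I1 I2 show thesis
    by (intro that[of "- m1 b / 2" "- m2 b / 2"]) (auto simp: y_def c_def)
qed

subsection \<open>The iterated contour integrals\<close>

lemma measurable_nn_integral_Ioo [measurable (raw)]:
  fixes F :: "real \<Rightarrow> ennreal" and l u :: "real \<Rightarrow> real"
  assumes [measurable]: "F \<in> borel_measurable borel" "l \<in> borel_measurable borel" "u \<in> borel_measurable borel"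
  shows "(\<lambda>w. \<integral>\<^sup>+x\<in>{l w<..<u w}. F x \<partial>lborel) \<in> borel_measurable borel"
proof -
  have "(\<lambda>w. \<integral>\<^sup>+x\<in>{l w<..<u w}. F x \<partial>lborel)
     = (\<lambda>w. \<integral>\<^sup>+x. (if l w < x \<and> x < u w then F x else 0) \<partial>lborel)"
    by (intro ext nn_integral_cong) (auto simp: indicator_def)
  then show ?thesis by simp
qed

lemma nn_integral_triangle_swap:
  fixes P Q :: "real \<Rightarrow> ennreal"
  assumes [measurable]: "P \<in> borel_measurable borel" "Q \<in> borel_measurable borel"
  shows "(\<integral>\<^sup>+V\<in>{0<..<1}. P V * (\<integral>\<^sup>+W\<in>{0<..<V}. Q W \<partial>lborel) \<partial>lborel)
    = (\<integral>\<^sup>+W\<in>{0<..<1}. Q W * (\<integral>\<^sup>+V\<in>{W<..<1}. P V \<partial>lborel) \<partial>lborel)"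
proof -
  have "(\<integral>\<^sup>+V\<in>{0<..<1}. P V * (\<integral>\<^sup>+W\<in>{0<..<V}. Q W \<partial>lborel) \<partial>lborel)
    = (\<integral>\<^sup>+V. (\<integral>\<^sup>+W. (P V * indicator {0<..<1} V) * (Q W * indicator {0<..<V} W) \<partial>lborel) \<partial>lborel)"
    by (rule nn_integral_cong, subst nn_integral_cmult) (simp_all add: mult_ac)
  also have "\<dots> = (\<integral>\<^sup>+V. (\<integral>\<^sup>+W. (if 0 < W \<and> W < V \<and> V < 1 then P V * Q W else 0) \<partial>lborel) \<partial>lborel)"
    by (intro nn_integral_cong) (auto simp: indicator_def)
  also have "\<dots> = (\<integral>\<^sup>+W. (\<integral>\<^sup>+V. (if 0 < W \<and> W < V \<and> V < 1 then P V * Q W else 0) \<partial>lborel) \<partial>lborel)"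
    by (rule lborel_pair.Fubini'[symmetric]) measurable
  also have "\<dots> = (\<integral>\<^sup>+W. (\<integral>\<^sup>+V. (Q W * indicator {0<..<1} W) * (P V * indicator {W<..<1} V) \<partial>lborel) \<partial>lborel)"
    by (intro nn_integral_cong) (auto simp: indicator_def mult.commute)
  also have "\<dots> = (\<integral>\<^sup>+W\<in>{0<..<1}. Q W * (\<integral>\<^sup>+V\<in>{W<..<1}. P V \<partial>lborel) \<partial>lborel)"
    by (rule nn_integral_cong, subst nn_integral_cmult) (simp_all add: mult_ac)
  finally show ?thesis .
qed

lemma set_nn_integral_cmult_left:
  fixes F :: "real \<Rightarrow> ennreal"
  assumes "F \<in> borel_measurable borel" "A \<in> sets borel"
  shows "(\<integral>\<^sup>+x\<in>A. F x * c \<partial>lborel) = (\<integral>\<^sup>+x\<in>A. F x \<partial>lborel) * c"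
  using set_nn_integral_cmult[OF assms, of c] by (simp add: mult.commute)

lemma nn_integral_split_at:
  fixes Q :: "real \<Rightarrow> ennreal"
  assumes [measurable]: "Q \<in> borel_measurable borel" and "a < v" "v < b"
  shows "(\<integral>\<^sup>+W\<in>{a<..<b}. Q W \<partial>lborel) = (\<integral>\<^sup>+W\<in>{a<..<v}. Q W \<partial>lborel) + (\<integral>\<^sup>+W\<in>{v<..<b}. Q W \<partial>lborel)"
proof -
  have "(\<integral>\<^sup>+W\<in>{a<..<b}. Q W \<partial>lborel) = (\<integral>\<^sup>+W. Q W * indicator {a<..<v} W + Q W * indicator {v<..<b} W \<partial>lborel)"
  proof (rule nn_integral_cong_AE)
    show "AE W in lborel. Q W * indicator {a<..<b} W = Q W * indicator {a<..<v} W + Q W * indicator {v<..<b} W"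
      using AE_lborel_singleton[of v] by eventually_elim (use assms in \<open>auto simp: indicator_def\<close>)
  qed
  then show ?thesis by (simp add: nn_integral_add)
qed

lemma nn_integral_triple_integral:
  assumes r: "-1 < r" "r < 0" and a: "0 < a" "a < 1" and b: "b < a"
  shows "0 \<le> triple_integral r a b"
    "ennreal (triple_integral r a b) = (\<integral>\<^sup>+V\<in>{0<..<1}. ennreal (euler_kernel r a V) * (\<integral>\<^sup>+W\<in>{V<..<1/a}.
       ennreal (euler_kernel (-1-r) a W) * (\<integral>\<^sup>+U\<in>{min W 1<..<max W 1}. ennreal (euler_kernel r b U) \<partial>lborel) \<partial>lborel) \<partial>lborel)"
proof -
  let ?g = "\<lambda>x. (1 - b * (\<lambda>(V, W, U). U) x) powr r * triple_kernel r a x"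
  have eq: "triple_integral r a b = (\<integral>x. ?g x \<partial>lborel3)"
    by (simp add: triple_integral_def powr_integral_def)
  have nn: "0 \<le> ?g x" for x by (simp add: triple_kernel_nonneg)
  show "0 \<le> triple_integral r a b"
    unfolding eq by (intro Bochner_Integration.integral_nonneg nn)
  have int: "integrable lborel3 ?g"
  proof (rule integrable_powr_mult[OF integrable_triple_kernel[OF r a], where B = "1 / a"])
    show "0 \<le> (case x of (V, W, U) \<Rightarrow> U) \<and> (case x of (V, W, U) \<Rightarrow> U) \<le> 1 / a" if "triple_kernel r a x \<noteq> 0" for x
      using triple_kernel_support[OF a that] .
  qed (use r a b in auto)
  have "ennreal (triple_integral r a b) = (\<integral>\<^sup>+x. ennreal (?g x) \<partial>lborel3)"
    unfolding eq using int nn by (intro nn_integral_eq_integral[symmetric]) auto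
  also have "\<dots> = (\<integral>\<^sup>+V. (\<integral>\<^sup>+W. (\<integral>\<^sup>+U. ennreal (?g (V, W, U)) \<partial>lborel) \<partial>lborel) \<partial>lborel)"
    by (simp add: lborel.nn_integral_fst[symmetric] lborel_pair.P.nn_integral_fst[symmetric] split_beta')
  also have "\<dots> = (\<integral>\<^sup>+V\<in>{0<..<1}. ennreal (euler_kernel r a V) * (\<integral>\<^sup>+W\<in>{V<..<1/a}.
       ennreal (euler_kernel (-1-r) a W) * (\<integral>\<^sup>+U\<in>{min W 1<..<max W 1}. ennreal (euler_kernel r b U) \<partial>lborel) \<partial>lborel) \<partial>lborel)"
  proof (rule nn_integral_cong)
    fix V
    have N: "(\<lambda>W. \<integral>\<^sup>+U\<in>{min W 1<..<max W 1}. ennreal (euler_kernel r b U) \<partial>lborel) \<in> borel_measurable borel"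
      by (rule measurable_nn_integral_Ioo) measurable
    have "(\<integral>\<^sup>+U. ennreal (?g (V, W, U)) \<partial>lborel) = (ennreal (euler_kernel r a V) * indicator {0<..<1} V) *
       ((ennreal (euler_kernel (-1-r) a W) * (\<integral>\<^sup>+U\<in>{min W 1<..<max W 1}. ennreal (euler_kernel r b U) \<partial>lborel)) * indicator {V<..<1/a} W)" for W
    proof -
      have "(\<integral>\<^sup>+U. ennreal (?g (V, W, U)) \<partial>lborel) = (\<integral>\<^sup>+U. (ennreal (euler_kernel r a V) * indicator {0<..<1} V * (ennreal (euler_kernel (-1-r) a W) * indicator {V<..<1/a} W))
          * (ennreal (euler_kernel r b U) * indicator {min W 1<..<max W 1} U) \<partial>lborel)"
      proof (rule nn_integral_cong)
        fix U
        have "ennreal ((1 - b * U) powr r * (euler_kernel r a V * (euler_kernel (-1-r) a W * jacobi_weight r U)))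
           = ennreal (euler_kernel r a V) * (ennreal (euler_kernel (-1-r) a W) * ennreal (euler_kernel r b U))"
          by (simp add: euler_kernel_def[of r b U] mult_ac flip: ennreal_mult)
        then show "ennreal (?g (V, W, U)) = (ennreal (euler_kernel r a V) * indicator {0<..<1} V * (ennreal (euler_kernel (-1-r) a W) * indicator {V<..<1/a} W))
          * (ennreal (euler_kernel r b U) * indicator {min W 1<..<max W 1} U)"
          by (auto simp: triple_kernel_def indicator_def mult.assoc)
      qed
      also have "\<dots> = (ennreal (euler_kernel r a V) * indicator {0<..<1} V * (ennreal (euler_kernel (-1-r) a W) * indicator {V<..<1/a} W))
          * (\<integral>\<^sup>+U\<in>{min W 1<..<max W 1}. ennreal (euler_kernel r b U) \<partial>lborel)"
        by (rule nn_integral_cmult) measurable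
      finally show ?thesis by (simp only: mult_ac)
    qed
    then have "(\<integral>\<^sup>+W. (\<integral>\<^sup>+U. ennreal (?g (V, W, U)) \<partial>lborel) \<partial>lborel)
      = (\<integral>\<^sup>+W. (ennreal (euler_kernel r a V) * indicator {0<..<1} V) *
       ((ennreal (euler_kernel (-1-r) a W) * (\<integral>\<^sup>+U\<in>{min W 1<..<max W 1}. ennreal (euler_kernel r b U) \<partial>lborel)) * indicator {V<..<1/a} W) \<partial>lborel)"
      by (simp only:)
    also have "\<dots> = (ennreal (euler_kernel r a V) * indicator {0<..<1} V) * (\<integral>\<^sup>+W\<in>{V<..<1/a}.
       ennreal (euler_kernel (-1-r) a W) * (\<integral>\<^sup>+U\<in>{min W 1<..<max W 1}. ennreal (euler_kernel r b U) \<partial>lborel) \<partial>lborel)"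
      by (rule nn_integral_cmult) (use N in simp)
    finally show "(\<integral>\<^sup>+W. (\<integral>\<^sup>+U. ennreal (?g (V, W, U)) \<partial>lborel) \<partial>lborel)
      = ennreal (euler_kernel r a V) * (\<integral>\<^sup>+W\<in>{V<..<1/a}.
       ennreal (euler_kernel (-1-r) a W) * (\<integral>\<^sup>+U\<in>{min W 1<..<max W 1}. ennreal (euler_kernel r b U) \<partial>lborel) \<partial>lborel) * indicator {0<..<1} V"
      by (simp only: mult_ac)
  qed
  finally show "ennreal (triple_integral r a b) = \<dots>" .
qed

text \<open>The left-hand product is an integral over \<open>V\<close> in (0, 1) and
  \<open>W\<close> in (0, 1/a), cut at W = V. The part with W > V is the triple integral; in the
  part with W < V, exchanging orders twice brings \<open>U\<close> outside and \<open>V\<close>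
  inside. No integrability is presupposed.\<close>

lemma nn_integral_kernel_decomposition:
  assumes r: "-1 < r" "r < 0" and a: "0 < a" "a < 1" and b: "b < a"
  shows "ennreal (legendre_integral r a) * (\<integral>\<^sup>+W\<in>{0<..<1/a}. ennreal (euler_kernel (-1-r) a W) *
       (\<integral>\<^sup>+U\<in>{min W 1<..<max W 1}. ennreal (euler_kernel r b U) \<partial>lborel) \<partial>lborel)
    = (\<integral>\<^sup>+U\<in>{0<..<1}. ennreal (euler_kernel r b U) * (\<integral>\<^sup>+W\<in>{0<..<U}. ennreal (euler_kernel (-1-r) a W) *
       (\<integral>\<^sup>+V\<in>{W<..<1}. ennreal (euler_kernel r a V) \<partial>lborel) \<partial>lborel) \<partial>lborel)
      + ennreal (triple_integral r a b)"
proof -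
  define N where "N W = (\<integral>\<^sup>+U\<in>{min W 1<..<max W 1}. ennreal (euler_kernel r b U) \<partial>lborel)" for W
  define G where "G W = ennreal (euler_kernel (-1-r) a W) * N W" for W
  have [measurable]: "N \<in> borel_measurable borel" unfolding N_def by measurable
  have [measurable]: "G \<in> borel_measurable borel" unfolding G_def by measurable
  have "ennreal (legendre_integral r a) * (\<integral>\<^sup>+W\<in>{0<..<1/a}. G W \<partial>lborel)
     = (\<integral>\<^sup>+V\<in>{0<..<1}. ennreal (euler_kernel r a V) * (\<integral>\<^sup>+W\<in>{0<..<1/a}. G W \<partial>lborel) \<partial>lborel)"
    by (subst set_nn_integral_cmult_left) (simp_all add: nn_integral_euler_kernel[OF r a(2)])
  also have "\<dots> = (\<integral>\<^sup>+V\<in>{0<..<1}. ennreal (euler_kernel r a V) * (\<integral>\<^sup>+W\<in>{0<..<V}. G W \<partial>lborel)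
     + ennreal (euler_kernel r a V) * (\<integral>\<^sup>+W\<in>{V<..<1/a}. G W \<partial>lborel) \<partial>lborel)"
  proof (rule set_nn_integral_cong_on)
    fix V :: real assume V: "V \<in> {0<..<1}"
    have "1 < 1 / a" using a by simp
    then have "V < 1 / a" using V by auto
    then show "ennreal (euler_kernel r a V) * (\<integral>\<^sup>+W\<in>{0<..<1/a}. G W \<partial>lborel)
      = ennreal (euler_kernel r a V) * (\<integral>\<^sup>+W\<in>{0<..<V}. G W \<partial>lborel) + ennreal (euler_kernel r a V) * (\<integral>\<^sup>+W\<in>{V<..<1/a}. G W \<partial>lborel)"
      using V by (subst nn_integral_split_at[of G 0 V "1 / a"]) (simp_all add: distrib_left)
  qed
  also have "\<dots> = (\<integral>\<^sup>+V\<in>{0<..<1}. ennreal (euler_kernel r a V) * (\<integral>\<^sup>+W\<in>{0<..<V}. G W \<partial>lborel) \<partial>lborel)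
     + (\<integral>\<^sup>+V\<in>{0<..<1}. ennreal (euler_kernel r a V) * (\<integral>\<^sup>+W\<in>{V<..<1/a}. G W \<partial>lborel) \<partial>lborel)"
    by (simp add: nn_integral_add distrib_right)
  also have "(\<integral>\<^sup>+V\<in>{0<..<1}. ennreal (euler_kernel r a V) * (\<integral>\<^sup>+W\<in>{0<..<V}. G W \<partial>lborel) \<partial>lborel)
     = (\<integral>\<^sup>+W\<in>{0<..<1}. G W * (\<integral>\<^sup>+V\<in>{W<..<1}. ennreal (euler_kernel r a V) \<partial>lborel) \<partial>lborel)"
    by (rule nn_integral_triangle_swap) measurable
  \<comment> \<open>Here \<open>W < 1\<close>, so the interval between \<open>W\<close> and 1 is
    \<open>{W<..<1}\<close> and the triangle exchange applies to \<open>U\<close> and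
    \<open>W\<close>.\<close>
  also have "\<dots> = (\<integral>\<^sup>+W\<in>{0<..<1}. (ennreal (euler_kernel (-1-r) a W) * (\<integral>\<^sup>+V\<in>{W<..<1}. ennreal (euler_kernel r a V) \<partial>lborel))
       * (\<integral>\<^sup>+U\<in>{W<..<1}. ennreal (euler_kernel r b U) \<partial>lborel) \<partial>lborel)"
    by (intro set_nn_integral_cong_on) (simp add: G_def N_def min_def max_def mult_ac)
  also have "\<dots> = (\<integral>\<^sup>+U\<in>{0<..<1}. ennreal (euler_kernel r b U) * (\<integral>\<^sup>+W\<in>{0<..<U}. ennreal (euler_kernel (-1-r) a W) *
       (\<integral>\<^sup>+V\<in>{W<..<1}. ennreal (euler_kernel r a V) \<partial>lborel) \<partial>lborel) \<partial>lborel)"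
    by (rule nn_integral_triangle_swap[symmetric]) measurable
  finally show ?thesis
    unfolding nn_integral_triple_integral(2)[OF assms] G_def N_def .
qed


section \<open>Real forms of the iterated integrals\<close>

lemma measurable_set_integral_Ioo [measurable (raw)]:
  fixes F :: "real \<Rightarrow> real" and l u :: "real \<Rightarrow> real"
  assumes [measurable]: "F \<in> borel_measurable borel" "l \<in> borel_measurable borel" "u \<in> borel_measurable borel"
  shows "(\<lambda>w. LINT x:{l w<..<u w}|lborel. F x) \<in> borel_measurable borel"
proof -
  have "(\<lambda>w. LINT x:{l w<..<u w}|lborel. F x) = (\<lambda>w. \<integral>x. (if l w < x \<and> x < u w then F x else 0) \<partial>lborel)"
    unfolding set_lebesgue_integral_def
    by (intro ext Bochner_Integration.integral_cong) (auto simp: indicator_def)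
  then show ?thesis by simp
qed

lemma ennreal_set_integral:
  fixes k :: "real \<Rightarrow> real"
  assumes "set_integrable lborel S k" and nn: "\<And>x. 0 \<le> k x"
  shows "ennreal (LINT x:S|lborel. k x) = (\<integral>\<^sup>+x\<in>S. ennreal (k x) \<partial>lborel)"
proof -
  have "(\<integral>\<^sup>+x\<in>S. ennreal (k x) \<partial>lborel) = (\<integral>\<^sup>+x. ennreal (indicator S x *\<^sub>R k x) \<partial>lborel)"
    by (intro nn_integral_cong) (auto split: split_indicator)
  also have "\<dots> = ennreal (LINT x:S|lborel. k x)"
    using assms unfolding set_lebesgue_integral_def set_integrable_def
    by (intro nn_integral_eq_integral) auto
  finally show ?thesis by simp
qed

lemma set_integral_nonneg_Ioo:
  fixes k :: "real \<Rightarrow> real"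
  assumes "\<And>x. 0 \<le> k x"
  shows "0 \<le> (LINT x:S|lborel. k x)"
  unfolding set_lebesgue_integral_def using assms by (intro Bochner_Integration.integral_nonneg) auto

lemma set_integral_mono_set:
  fixes k :: "real \<Rightarrow> real"
  assumes "set_integrable lborel T k" "S \<subseteq> T" "S \<in> sets borel" and nn: "\<And>x. 0 \<le> k x"
  shows "(LINT x:S|lborel. k x) \<le> (LINT x:T|lborel. k x)"
  using set_integrable_subset[OF assms(1), of S] assms(1-3) nn
  unfolding set_lebesgue_integral_def set_integrable_def
  by (intro integral_mono) (auto simp: indicator_def)

lemma set_integrable_mult_bounded:
  fixes f g :: "real \<Rightarrow> real"
  assumes g: "set_integrable lborel S g" "g \<in> borel_measurable borel" and f: "f \<in> borel_measurable borel"
    and S: "S \<in> sets borel" and bound: "\<And>x. x \<in> S \<Longrightarrow> \<bar>f x\<bar> \<le> C"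
  shows "set_integrable lborel S (\<lambda>x. f x * g x)"
proof (rule set_integrable_bound)
  show "set_integrable lborel S (\<lambda>x. C * g x)" using g(1) by simp
  show "AE x in lborel. x \<in> S \<longrightarrow> norm (f x * g x) \<le> norm (C * g x)"
  proof (rule AE_I2, rule impI)
    fix x assume "x \<in> S"
    then have "\<bar>f x\<bar> \<le> \<bar>C\<bar>" using bound[of x] by linarith
    then show "norm (f x * g x) \<le> norm (C * g x)" by (simp add: abs_mult mult_right_mono)
  qed
  show "set_borel_measurable lborel S (\<lambda>x. f x * g x)"
    using f g(2) S by (simp add: set_borel_measurable_def)
qed

lemma set_integrable_euler_kernel_between:
  assumes r: "-1 < r" "r < 0" and W: "0 \<le> W" and b: "b * max W 1 < 1"
  shows "set_integrable lborel {min W 1<..<max W 1} (euler_kernel r b)"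
proof -
  have "integrable lborel (\<lambda>u. (1 - b * u) powr r * (indicator {min W 1<..<max W 1} u * jacobi_weight r u))"
    by (rule integrable_powr_mult[where B = "max W 1"])
       (use set_integrable_jacobi_weight[OF r W] r b W in \<open>auto simp: set_integrable_def indicator_def split: if_splits\<close>)
  then show ?thesis by (simp add: set_integrable_def euler_kernel_def mult_ac)
qed

text \<open>A name for each level of nesting lets the contour integrals be identified with real ones
  from the inside out.\<close>

definition inner_integral :: "real \<Rightarrow> real \<Rightarrow> real \<Rightarrow> real" where
  "inner_integral r a W = (LINT V:{W<..<1}|lborel. euler_kernel r a V)"

definition middle_integral :: "real \<Rightarrow> real \<Rightarrow> real \<Rightarrow> real" where
  "middle_integral r a U = (LINT W:{0<..<U}|lborel. inner_integral r a W * euler_kernel (-1-r) a W)"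

definition ordered_integral :: "real \<Rightarrow> real \<Rightarrow> real \<Rightarrow> real" where
  "ordered_integral r a b = (LINT U:{0<..<1}|lborel. middle_integral r a U * euler_kernel r b U)"

text \<open>Taken without orientation, and so nonnegative for \<open>W > 1\<close> as well; the link
  to the oriented segment from \<open>W\<close> to 1 is made in
  \<open>seg_integral_straddling\<close>.\<close>

definition between_integral :: "real \<Rightarrow> real \<Rightarrow> real \<Rightarrow> real" where
  "between_integral r b W = (LINT u:{min W 1<..<max W 1}|lborel. euler_kernel r b u)"

definition straddling_integral :: "real \<Rightarrow> real \<Rightarrow> real \<Rightarrow> real" where
  "straddling_integral r a b = (LINT W:{0<..<1/a}|lborel. euler_kernel (-1-r) a W * between_integral r b W)"

lemma iterated_measurable [measurable]:
  "inner_integral r a \<in> borel_measurable borel" "middle_integral r a \<in> borel_measurable borel"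
  "between_integral r b \<in> borel_measurable borel"
proof -
  show [measurable]: "inner_integral r a \<in> borel_measurable borel" unfolding inner_integral_def by measurable
  show "middle_integral r a \<in> borel_measurable borel" unfolding middle_integral_def by measurable
  show "between_integral r b \<in> borel_measurable borel" unfolding between_integral_def by measurable
qed

lemma iterated_nonneg [simp]: "0 \<le> inner_integral r a W" "0 \<le> middle_integral r a U" "0 \<le> between_integral r b W"
proof -
  show *: "0 \<le> inner_integral r a W" for W unfolding inner_integral_def by (rule set_integral_nonneg_Ioo) simp
  show "0 \<le> middle_integral r a U" unfolding middle_integral_def by (rule set_integral_nonneg_Ioo) (simp add: *)
  show "0 \<le> between_integral r b W" unfolding between_integral_def by (rule set_integral_nonneg_Ioo) simp
qed

context
  fixes r a b :: real
  assumes r: "-1 < r" "r < 0" and a: "0 < a" "a < 1" and b: "0 \<le> b" "b < a"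
begin

lemma inner_integrable: "0 \<le> W \<Longrightarrow> set_integrable lborel {W<..<1} (euler_kernel r a)"
  by (rule set_integrable_subset[OF set_integrable_euler_kernel[OF r a(2)]]) auto

text \<open>This uniform bound makes the next level of nesting a bounded function times an
  integrable kernel.\<close>

lemma inner_integral_le: "0 \<le> W \<Longrightarrow> inner_integral r a W \<le> legendre_integral r a"
  unfolding inner_integral_def legendre_integral_eq
  by (rule set_integral_mono_set[OF set_integrable_euler_kernel[OF r a(2)]]) auto

lemma middle_integrable: "0 \<le> U \<Longrightarrow> U \<le> 1 \<Longrightarrow> set_integrable lborel {0<..<U} (\<lambda>W. inner_integral r a W * euler_kernel (-1-r) a W)"
proof (rule set_integrable_mult_bounded[where C = "legendre_integral r a"])
  assume U: "0 \<le> U" "U \<le> 1"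
  have r': "-1 < -1-r" "-1-r < 0" using r by auto
  show "set_integrable lborel {0<..<U} (euler_kernel (-1-r) a)"
    by (rule set_integrable_subset[OF set_integrable_euler_kernel[OF r' a(2)]]) (use U in auto)
  show "\<bar>inner_integral r a x\<bar> \<le> legendre_integral r a" if "x \<in> {0<..<U}" for x
    using inner_integral_le[of x] that by simp
qed auto

lemma middle_integral_le: "0 \<le> U \<Longrightarrow> U \<le> 1 \<Longrightarrow> middle_integral r a U \<le> middle_integral r a 1"
  unfolding middle_integral_def
  by (rule set_integral_mono_set[OF middle_integrable[of 1]]) auto

lemma ordered_integrable: "set_integrable lborel {0<..<1} (\<lambda>U. middle_integral r a U * euler_kernel r b U)"
proof (rule set_integrable_mult_bounded[where C = "middle_integral r a 1"])
  show "set_integrable lborel {0<..<1} (euler_kernel r b)" using set_integrable_euler_kernel[OF r, of b] b a by simp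
  show "\<bar>middle_integral r a x\<bar> \<le> middle_integral r a 1" if "x \<in> {0<..<1}" for x
    using middle_integral_le[of x] that by simp
qed auto

lemma ennreal_ordered_integral:
  "ennreal (ordered_integral r a b) = (\<integral>\<^sup>+U\<in>{0<..<1}. ennreal (euler_kernel r b U) * (\<integral>\<^sup>+W\<in>{0<..<U}. ennreal (euler_kernel (-1-r) a W) *
       (\<integral>\<^sup>+V\<in>{W<..<1}. ennreal (euler_kernel r a V) \<partial>lborel) \<partial>lborel) \<partial>lborel)"
proof -
  have "ennreal (ordered_integral r a b) = (\<integral>\<^sup>+U\<in>{0<..<1}. ennreal (middle_integral r a U * euler_kernel r b U) \<partial>lborel)"
    unfolding ordered_integral_def by (rule ennreal_set_integral[OF ordered_integrable]) simp
  also have "\<dots> = (\<integral>\<^sup>+U\<in>{0<..<1}. ennreal (euler_kernel r b U) * (\<integral>\<^sup>+W\<in>{0<..<U}. ennreal (euler_kernel (-1-r) a W) *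
       (\<integral>\<^sup>+V\<in>{W<..<1}. ennreal (euler_kernel r a V) \<partial>lborel) \<partial>lborel) \<partial>lborel)"
  proof (rule set_nn_integral_cong_on)
    fix U :: real assume U: "U \<in> {0<..<1}"
    have "ennreal (middle_integral r a U) = (\<integral>\<^sup>+W\<in>{0<..<U}. ennreal (inner_integral r a W * euler_kernel (-1-r) a W) \<partial>lborel)"
      unfolding middle_integral_def by (rule ennreal_set_integral[OF middle_integrable]) (use U in auto)
    also have "\<dots> = (\<integral>\<^sup>+W\<in>{0<..<U}. ennreal (euler_kernel (-1-r) a W) *
       (\<integral>\<^sup>+V\<in>{W<..<1}. ennreal (euler_kernel r a V) \<partial>lborel) \<partial>lborel)"
    proof (rule set_nn_integral_cong_on)
      fix W :: real assume W: "W \<in> {0<..<U}"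
      have "ennreal (inner_integral r a W) = (\<integral>\<^sup>+V\<in>{W<..<1}. ennreal (euler_kernel r a V) \<partial>lborel)"
        unfolding inner_integral_def by (rule ennreal_set_integral[OF inner_integrable]) (use W in auto)
      then show "ennreal (inner_integral r a W * euler_kernel (-1-r) a W)
        = ennreal (euler_kernel (-1-r) a W) * (\<integral>\<^sup>+V\<in>{W<..<1}. ennreal (euler_kernel r a V) \<partial>lborel)"
        by (simp add: ennreal_mult mult.commute)
    qed
    finally show "ennreal (middle_integral r a U * euler_kernel r b U) = ennreal (euler_kernel r b U) * (\<integral>\<^sup>+W\<in>{0<..<U}. ennreal (euler_kernel (-1-r) a W) *
       (\<integral>\<^sup>+V\<in>{W<..<1}. ennreal (euler_kernel r a V) \<partial>lborel) \<partial>lborel)"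
      by (simp add: ennreal_mult mult.commute)
  qed
  finally show ?thesis .
qed

lemma between_integrable:
  assumes "0 \<le> W" "W \<le> 1 / a"
  shows "set_integrable lborel {min W 1<..<max W 1} (euler_kernel r b)"
proof (rule set_integrable_euler_kernel_between[OF r assms(1)])
  have "max W 1 \<le> 1 / a" using assms a by simp
  then have "b * max W 1 \<le> b * (1 / a)" using b by (intro mult_left_mono)
  also have "b * (1 / a) < 1" using b a by simp
  finally show "b * max W 1 < 1" .
qed

text \<open>As \<open>r < 0\<close>, the integrand only grows when the parameter moves from 0 to
  \<open>a\<close>, so the positive Beta value at 0 is a lower bound. Positivity permits dividing by
  this factor in the decomposition.\<close>

lemma legendre_integral_pos: "0 < legendre_integral r a"
proof -
  have "legendre_integral r 0 \<le> legendre_integral r a"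
    unfolding legendre_integral_eq
  proof (rule set_integral_mono)
    fix u :: real assume u: "u \<in> {0<..<1}"
    have "a * u \<le> 1 * 1" using u a by (intro mult_mono) auto
    moreover have "a * u < 1" using mult_strict_mono[of a 1 u 1] u a by auto
    moreover have "0 < a * u" using u a by simp
    ultimately have "1 powr r \<le> (1 - a * u) powr r" using r by (intro powr_mono2') auto
    then show "euler_kernel r 0 u \<le> euler_kernel r a u" unfolding euler_kernel_def by (intro mult_left_mono) auto
  qed (use set_integrable_euler_kernel[OF r] a in auto)
  then show ?thesis using legendre_integral_0[OF r] Beta_pos[OF r] by simp
qed

lemma straddling_nn:
  "(\<integral>\<^sup>+W\<in>{0<..<1/a}. ennreal (euler_kernel (-1-r) a W * between_integral r b W) \<partial>lborel)
   = (\<integral>\<^sup>+W\<in>{0<..<1/a}. ennreal (euler_kernel (-1-r) a W) * (\<integral>\<^sup>+U\<in>{min W 1<..<max W 1}. ennreal (euler_kernel r b U) \<partial>lborel) \<partial>lborel)"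
proof (rule set_nn_integral_cong_on)
  fix W assume W: "W \<in> {0<..<1/a}"
  have "ennreal (between_integral r b W) = (\<integral>\<^sup>+U\<in>{min W 1<..<max W 1}. ennreal (euler_kernel r b U) \<partial>lborel)"
    unfolding between_integral_def by (rule ennreal_set_integral[OF between_integrable]) (use W in auto)
  then show "ennreal (euler_kernel (-1-r) a W * between_integral r b W)
    = ennreal (euler_kernel (-1-r) a W) * (\<integral>\<^sup>+U\<in>{min W 1<..<max W 1}. ennreal (euler_kernel r b U) \<partial>lborel)"
    by (simp add: ennreal_mult)
qed

lemma straddling_decomposition_nn:
  "ennreal (legendre_integral r a) * (\<integral>\<^sup>+W\<in>{0<..<1/a}. ennreal (euler_kernel (-1-r) a W * between_integral r b W) \<partial>lborel)
    = ennreal (ordered_integral r a b) + ennreal (triple_integral r a b)"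
  unfolding straddling_nn ennreal_ordered_integral using nn_integral_kernel_decomposition[OF r a b(2)] .

text \<open>Finiteness is inferred from the decomposition: its right-hand side is finite and the
  factor in front of the integral is positive. This avoids estimates at 0, 1 and
  \<open>1 / a\<close>.\<close>

lemma straddling_integrable: "set_integrable lborel {0<..<1/a} (\<lambda>W. euler_kernel (-1-r) a W * between_integral r b W)"
proof -
  have "ennreal (legendre_integral r a) * (\<integral>\<^sup>+W\<in>{0<..<1/a}. ennreal (euler_kernel (-1-r) a W * between_integral r b W) \<partial>lborel) < \<infinity>"
    unfolding straddling_decomposition_nn by simp
  then have "(\<integral>\<^sup>+W\<in>{0<..<1/a}. ennreal (euler_kernel (-1-r) a W * between_integral r b W) \<partial>lborel) < \<infinity>"
    using legendre_integral_pos by (auto simp: ennreal_mult_less_top)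
  then show ?thesis
    by (subst set_integrable_lborel_iff_absolutely_integrable, measurable, subst absolutely_integrable_on_iff_nn_integral) auto
qed

lemma straddling_decomposition:
  "legendre_integral r a * straddling_integral r a b = ordered_integral r a b + triple_integral r a b"
proof -
  have o: "0 \<le> ordered_integral r a b"
    unfolding ordered_integral_def by (rule set_integral_nonneg_Ioo) simp
  have t: "0 \<le> triple_integral r a b" by (rule nn_integral_triple_integral(1)[OF r a b(2)])
  have s: "0 \<le> straddling_integral r a b"
    unfolding straddling_integral_def by (rule set_integral_nonneg_Ioo) simp
  have "ennreal (straddling_integral r a b) = (\<integral>\<^sup>+W\<in>{0<..<1/a}. ennreal (euler_kernel (-1-r) a W * between_integral r b W) \<partial>lborel)"
    unfolding straddling_integral_def by (rule ennreal_set_integral[OF straddling_integrable]) simp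
  then have "ennreal (legendre_integral r a) * ennreal (straddling_integral r a b)
     = ennreal (ordered_integral r a b) + ennreal (triple_integral r a b)"
    using straddling_decomposition_nn by simp
  then have "ennreal (legendre_integral r a * straddling_integral r a b) = ennreal (ordered_integral r a b + triple_integral r a b)"
    using legendre_integral_nonneg s o t by (simp add: ennreal_mult)
  then show ?thesis
    using legendre_integral_nonneg[of r a] s o t by (subst (asm) ennreal_inj) auto
qed

end


section \<open>From contour integrals to Lebesgue integrals\<close>

lemma seg_integral_of_real:
  fixes h :: "complex \<Rightarrow> complex" and k :: "real \<Rightarrow> real"
  assumes l: "l < u" and k: "set_integrable lborel {l<..<u} k"
    and h: "\<And>x. l < x \<Longrightarrow> x < u \<Longrightarrow> h (of_real x) = of_real (k x)"
  shows "seg_integral (of_real l) (of_real u) h = of_real (LINT x:{l<..<u}|lborel. k x)"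
proof -
  have "(k has_integral (LINT x:{l<..<u}|lborel. k x)) {l<..<u}"
    using set_borel_integral_eq_integral[OF k] by (simp add: has_integral_integrable_integral)
  then have "((\<lambda>x. complex_of_real (k x)) has_integral of_real (LINT x:{l<..<u}|lborel. k x)) {l<..<u}"
    by (rule has_integral_of_real)
  then have "((\<lambda>x. h (of_real x)) has_integral of_real (LINT x:{l<..<u}|lborel. k x)) {l<..<u}"
    by (rule has_integral_eq[rotated]) (simp add: h)
  then have "((\<lambda>x. h (of_real x)) has_integral of_real (LINT x:{l<..<u}|lborel. k x)) {l..u}"
    by (simp add: has_integral_Icc_iff_Ioo)
  then show ?thesis
    using l by (subst contour_integral_linepath_Reals_eq) (auto simp: integral_unique)
qed

text \<open>For \<open>U > 1\<close> the segment from \<open>U\<close> to 1 runs backwards along the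
  real line.\<close>

lemma seg_integral_swap_ends: "seg_integral a b h = - seg_integral b a h"
  using contour_integral_reversepath[OF valid_path_linepath, of b a h] by simp

lemma powr_minus_one_minus: "x powr (-1-r) = 1 / x powr (r + 1)" for x r :: real
proof -
  have "-1-r = - (r + 1)" by simp
  then show ?thesis by (simp only: powr_minus_divide)
qed

text \<open>All three bases are positive here, so the principal powers are the real ones.\<close>

lemma inverse_YY:
  assumes "0 < V" "V < 1" "a * V < 1"
  shows "1 / YY (of_real r) (of_real a) (of_real V) = of_real (euler_kernel r a V)"
proof -
  have "YY (of_real r) (of_real a) (of_real V) = of_real ((1 - V) powr (r + 1) / (V powr r * (1 - a * V) powr r))"
  proof -
    have "(1 - of_real V :: complex) powr (of_real r + 1) = of_real ((1 - V) powr (r + 1))"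
      using assms powr_of_real[of "1 - V" "r + 1"] by simp
    moreover have "(of_real V :: complex) powr of_real r = of_real (V powr r)"
      using assms by (simp add: powr_of_real)
    moreover have "(1 - of_real a * of_real V :: complex) powr of_real r = of_real ((1 - a * V) powr r)"
      using assms powr_of_real[of "1 - a * V" r] by simp
    ultimately show ?thesis by (simp add: YY_def)
  qed
  moreover have "1 / ((1 - V) powr (r + 1) / (V powr r * (1 - a * V) powr r)) = euler_kernel r a V"
  proof -
    have "euler_kernel r a V = V powr r * (1 / (1 - V) powr (r + 1)) * (1 - a * V) powr r"
      using assms unfolding euler_kernel_def jacobi_weight_def powr_minus_one_minus by (simp only: abs_of_pos diff_gt_0_iff_gt)
    then show ?thesis by simp
  qed
  ultimately show ?thesis by (metis of_real_1 of_real_divide)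
qed

lemma mult_less_one:
  fixes a x :: real
  assumes "0 \<le> a" "a < 1" "0 \<le> x" "x \<le> 1"
  shows "a * x < 1"
  using mult_left_mono[OF assms(4,1)] assms(2) by simp

lemma seg_integral_ordered:
  assumes r: "-1 < r" "r < 0" and a: "0 < a" "a < 1" and b: "0 \<le> b" "b < a"
  shows "seg_integral 0 1 (\<lambda>U. seg_integral 0 U (\<lambda>W. seg_integral W 1 (\<lambda>V. 1 / YY (of_real r) (of_real a) V)
        * (1 / YY (of_real (-1-r)) (of_real a) W)) * (1 / YY (of_real r) (of_real b) U))
    = of_real (ordered_integral r a b)"
proof -
  have less: "a * x < 1" "b * x < 1" if "0 < x" "x < 1" for x
    using mult_less_one[of a x] mult_less_one[of b x] a b that by auto
  have inner: "seg_integral (of_real W) 1 (\<lambda>V. 1 / YY (of_real r) (of_real a) V) = of_real (inner_integral r a W)"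
    if W: "0 \<le> W" "W < 1" for W
  proof -
    have "seg_integral (of_real W) (of_real 1) (\<lambda>V. 1 / YY (of_real r) (of_real a) V) = of_real (inner_integral r a W)"
      unfolding inner_integral_def
      by (rule seg_integral_of_real[OF W(2) inner_integrable[OF r a b W(1)]]) (use W less in \<open>auto intro!: inverse_YY\<close>)
    then show ?thesis by simp
  qed
  let ?M = "\<lambda>W. seg_integral W 1 (\<lambda>V. 1 / YY (of_real r) (of_real a) V) * (1 / YY (of_real (-1-r)) (of_real a) W)"
  have middle: "seg_integral 0 (of_real U) ?M = of_real (middle_integral r a U)" if U: "0 < U" "U \<le> 1" for U
  proof -
    have "seg_integral (of_real 0) (of_real U) ?M = of_real (middle_integral r a U)"
      unfolding middle_integral_def
    proof (rule seg_integral_of_real[OF U(1) middle_integrable[OF r a b less_imp_le[OF U(1)] U(2)]])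
      fix W assume "0 < W" "W < U"
      then have W: "0 < W" "W < 1" using U by auto
      show "?M (of_real W) = of_real (inner_integral r a W * euler_kernel (-1-r) a W)"
        unfolding inner[OF less_imp_le[OF W(1)] W(2)] inverse_YY[OF W less(1)[OF W]] by simp
    qed
    then show ?thesis by simp
  qed
  have "seg_integral (of_real 0) (of_real 1) (\<lambda>U. seg_integral 0 U ?M * (1 / YY (of_real r) (of_real b) U))
      = of_real (ordered_integral r a b)"
    unfolding ordered_integral_def
  proof (rule seg_integral_of_real[OF zero_less_one ordered_integrable[OF r a b]])
    fix U :: real assume U: "0 < U" "U < 1"
    show "seg_integral 0 (of_real U) ?M * (1 / YY (of_real r) (of_real b) (of_real U))
        = of_real (middle_integral r a U * euler_kernel r b U)"
      unfolding middle[OF U(1) less_imp_le[OF U(2)]] inverse_YY[OF U less(2)[OF U]] by simp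
  qed
  then show ?thesis by simp
qed

text \<open>As \<open>U\<close> and \<open>u\<close> lie on the same side of 1, the quotient under
  the principal power is nonnegative. The sign therefore enters only through
  \<open>1 / (1 - u)\<close>, as \<open>sgn (1 - U)\<close>.\<close>

lemma straddling_integrand:
  assumes u: "0 < u" "b * u < 1" "u \<noteq> 1" and U: "U \<noteq> 1" "u < 1 \<longleftrightarrow> U < 1"
  shows "of_real u powr of_real r / (1 - of_real b * of_real u) powr of_real (- r)
      * ((1 - of_real U) / (1 - of_real u)) powr of_real r * (1 / (1 - of_real u :: complex))
    = of_real (\<bar>1 - U\<bar> powr r * (sgn (1 - U) * euler_kernel r b u))"
proof -
  have "(1 - U) / (1 - u) = (U - 1) / (u - 1)"
    using u by (subst frac_eq_eq) (auto simp: algebra_simps)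
  then have q: "(1 - U) / (1 - u) = \<bar>1 - U\<bar> / \<bar>1 - u\<bar>" "0 \<le> (1 - U) / (1 - u)"
    using assms by (auto simp: abs_if divide_nonneg_nonneg divide_nonpos_nonpos)
  have "of_real u powr of_real r / (1 - of_real b * of_real u) powr of_real (- r)
      * ((1 - of_real U) / (1 - of_real u)) powr of_real r * (1 / (1 - of_real u :: complex))
    = of_real (u powr r / (1 - b * u) powr (- r) * ((1 - U) / (1 - u)) powr r * (1 / (1 - u)))"
  proof -
    have "(of_real u :: complex) powr of_real r = of_real (u powr r)" using u by (simp add: powr_of_real)
    moreover have "(1 - of_real b * of_real u :: complex) powr of_real (- r) = of_real ((1 - b * u) powr (- r))"
      using u powr_of_real[of "1 - b * u" "- r"] by simp
    moreover have "((1 - of_real U) / (1 - of_real u) :: complex) powr of_real r = of_real (((1 - U) / (1 - u)) powr r)"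
      using powr_of_real[OF q(2), of r] by simp
    ultimately show ?thesis by simp
  qed
  also have "u powr r / (1 - b * u) powr (- r) * ((1 - U) / (1 - u)) powr r * (1 / (1 - u))
     = \<bar>1 - U\<bar> powr r * (sgn (1 - U) * euler_kernel r b u)"
  proof -
    have "\<bar>1 - u\<bar> powr (- 1 - r) = 1 / (\<bar>1 - u\<bar> powr r * \<bar>1 - u\<bar>)"
      using u by (simp add: powr_diff powr_minus field_simps)
    moreover have "1 / (1 - u) = - (1 / (u - 1))"
      using u minus_divide_right[of 1 "u - 1"] by simp
    then have "1 / (1 - u) = sgn (1 - U) / \<bar>1 - u\<bar>"
      using assms by (auto simp: sgn_if abs_if)
    moreover have "(1 - b * u) powr r = 1 / (1 - b * u) powr (- r)"
      by (simp add: powr_minus_divide)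
    ultimately show ?thesis
      unfolding q(1) euler_kernel_def jacobi_weight_def by (simp add: powr_divide mult_ac)
  qed
  finally show ?thesis .
qed

text \<open>For \<open>U > 1\<close> the sign of the integrand and the reversed segment cancel. The
  inner value is |1-U| to the power \<open>r\<close> times the unoriented integral on either side of
  1, and that power completes the outer factor to \<open>euler_kernel (-1-r) a U\<close>.\<close>

lemma seg_integral_straddling:
  assumes r: "-1 < r" "r < 0" and a: "0 < a" "a < 1" and b: "0 \<le> b" "b < a"
  shows "seg_integral 0 (1 / of_real a) (\<lambda>U. 1 / (U powr of_real (r + 1) * (1 - of_real a * U) powr of_real (r + 1)) *
      seg_integral U 1 (\<lambda>u. u powr of_real r / (1 - of_real b * u) powr of_real (- r)
        * ((1 - U) / (1 - u)) powr of_real r * (1 / (1 - u))))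
    = of_real (straddling_integral r a b)"
proof -
  let ?h = "\<lambda>U u. u powr of_real r / (1 - of_real b * u) powr of_real (- r)
        * ((1 - U) / (1 - u)) powr of_real r * (1 / (1 - u :: complex))"
  have inner: "seg_integral (of_real U) 1 (?h (of_real U)) = of_real (\<bar>1 - U\<bar> powr r * between_integral r b U)"
    if U: "0 < U" "U < 1 / a" for U
  proof -
    have i: "set_integrable lborel {min U 1<..<max U 1} (\<lambda>u. \<bar>1 - U\<bar> powr r * (sgn (1 - U) * euler_kernel r b u))"
      using between_integrable[OF r a b, of U] U by simp
    have bu: "b * u < 1" if "u < max U 1" "0 < u" for u
    proof -
      have "1 < 1 / a" using a by simp
      then have "u \<le> 1 / a" using that U by linarith
      then have "b * u \<le> b * (1 / a)" using b by (intro mult_left_mono)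
      also have "b * (1 / a) < 1" using b a by simp
      finally show ?thesis .
    qed
    consider "U < 1" | "U = 1" | "1 < U" by linarith
    then show ?thesis
    proof cases
      case 1
      have "seg_integral (of_real U) (of_real 1) (?h (of_real U))
        = of_real (LINT u:{U<..<1}|lborel. \<bar>1 - U\<bar> powr r * (sgn (1 - U) * euler_kernel r b u))"
      proof (rule seg_integral_of_real[OF 1])
        show "set_integrable lborel {U<..<1} (\<lambda>u. \<bar>1 - U\<bar> powr r * (sgn (1 - U) * euler_kernel r b u))"
          using i 1 by (simp add: min_def max_def)
        show "?h (of_real U) (of_real u) = of_real (\<bar>1 - U\<bar> powr r * (sgn (1 - U) * euler_kernel r b u))"
          if "U < u" "u < 1" for u
          by (rule straddling_integrand) (use that 1 U bu[of u] in auto)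
      qed
      then show ?thesis using 1 by (simp add: between_integral_def min_def max_def)
    next
      case 2
      \<comment> \<open>The segment degenerates to a point, and \<open>0 powr r = 0\<close> makes
        the right-hand side vanish too.\<close>
      then show ?thesis by simp
    next
      case 3
      have "seg_integral (of_real 1) (of_real U) (?h (of_real U))
        = of_real (LINT u:{1<..<U}|lborel. \<bar>1 - U\<bar> powr r * (sgn (1 - U) * euler_kernel r b u))"
      proof (rule seg_integral_of_real[OF 3])
        show "set_integrable lborel {1<..<U} (\<lambda>u. \<bar>1 - U\<bar> powr r * (sgn (1 - U) * euler_kernel r b u))"
          using i 3 by (simp add: min_def max_def)
        show "?h (of_real U) (of_real u) = of_real (\<bar>1 - U\<bar> powr r * (sgn (1 - U) * euler_kernel r b u))"
          if "1 < u" "u < U" for u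
          by (rule straddling_integrand) (use that 3 U bu[of u] in auto)
      qed
      also have "(LINT u:{1<..<U}|lborel. \<bar>1 - U\<bar> powr r * (sgn (1 - U) * euler_kernel r b u))
        = \<bar>1 - U\<bar> powr r * (sgn (1 - U) * (LINT u:{1<..<U}|lborel. euler_kernel r b u))"
        by (simp only: set_integral_mult_right)
      finally show ?thesis
        using 3 seg_integral_swap_ends[of "of_real U" 1 "?h (of_real U)"]
        by (simp add: between_integral_def min_def max_def)
    qed
  qed
  have outer: "1 / (complex_of_real U powr of_real (r + 1) * (1 - of_real a * of_real U) powr of_real (r + 1))
      * of_real (\<bar>1 - U\<bar> powr r * between_integral r b U) = of_real (euler_kernel (-1-r) a U * between_integral r b U)"
    if U: "0 < U" "U < 1 / a" for U
  proof -
    have "0 < 1 - a * U" using U a by (simp add: field_simps)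
    then have 1: "(1 - complex_of_real a * of_real U) powr of_real (r + 1) = of_real ((1 - a * U) powr (r + 1))"
      using powr_of_real[of "1 - a * U" "r + 1"] by simp
    have 2: "complex_of_real U powr of_real (r + 1) = of_real (U powr (r + 1))"
      using U powr_of_real[of U "r + 1"] by simp
    note 3 = powr_minus_one_minus
    have E: "1 / (U powr (r + 1) * (1 - a * U) powr (r + 1)) * (\<bar>1 - U\<bar> powr r * between_integral r b U)
       = euler_kernel (-1-r) a U * between_integral r b U"
      by (simp add: euler_kernel_def jacobi_weight_def 3)
    show ?thesis
      unfolding 1 2 using arg_cong[OF E, of complex_of_real] by (simp only: of_real_mult of_real_divide of_real_1)
  qed
  have "seg_integral (of_real 0) (of_real (1 / a)) (\<lambda>U. 1 / (U powr of_real (r + 1) * (1 - of_real a * U) powr of_real (r + 1)) *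
      seg_integral U 1 (?h U)) = of_real (LINT U:{0<..<1/a}|lborel. euler_kernel (-1-r) a U * between_integral r b U)"
  proof (rule seg_integral_of_real[OF _ straddling_integrable[OF r a b]])
    fix U assume U: "0 < U" "U < 1 / a"
    show "1 / (of_real U powr of_real (r + 1) * (1 - of_real a * of_real U) powr of_real (r + 1)) *
      seg_integral (of_real U) 1 (?h (of_real U)) = of_real (euler_kernel (-1-r) a U * between_integral r b U)"
      unfolding inner[OF U] by (rule outer[OF U])
  qed (use a in simp)
  then show ?thesis by (simp add: straddling_integral_def)
qed


lemma legendre_P_eq:
  assumes r: "-1 < r" "r < 0" and t: "0 \<le> t" "t < 1"
  shows "legendre_P (of_real r) (1 - 2 * of_real t) = of_real (legendre_integral r t / Beta (r + 1) (- r))"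
    and "legendre_P (of_real r) (2 * of_real (1 - t) - 1) = of_real (legendre_integral r t / Beta (r + 1) (- r))"
  using hyp2F1_eq_legendre_integral[OF assms] by (simp_all add: legendre_P_def)

theorem theorem2p2:
  fixes \<nu> \<alpha> \<beta> :: real
  assumes "-1 < \<nu>" and "\<nu> < 0" and "0 < \<beta>" and "\<beta> < \<alpha>" and "\<alpha> < 1"
  shows
    "(legendre_P \<nu> (2 * \<beta> - 1))\<^sup>2
       * seg_integral 0 \<beta> (\<lambda>t. (legendre_P \<nu> (1 - 2 * t))\<^sup>2 / (t - \<alpha>))
     - legendre_P \<nu> (1 - 2 * \<beta>) * legendre_P \<nu> (2 * \<beta> - 1)
       * seg_integral 0 \<beta>
           (\<lambda>t. legendre_P \<nu> (1 - 2 * t) * legendre_P \<nu> (2 * t - 1) / (t - \<alpha>))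
     = complex_of_real pi * (legendre_P \<nu> (2 * \<alpha> - 1))\<^sup>2
         * legendre_P \<nu> (1 - 2 * \<beta>) * legendre_P \<nu> (2 * \<beta> - 1) / (2 * sin (\<nu> * pi))
     - complex_of_real ((sin (\<nu> * pi))\<^sup>2 / (2 * pi\<^sup>2)) * legendre_P \<nu> (2 * \<beta> - 1)
         * seg_integral 0 1 (\<lambda>U.
             seg_integral 0 U (\<lambda>W.
               seg_integral W 1 (\<lambda>V. 1 / YY \<nu> \<alpha> V) * (1 / YY (- \<nu> - 1) \<alpha> W))
             * (1 / YY \<nu> \<beta> U))
     - complex_of_real ((sin (\<nu> * pi))\<^sup>2 / (2 * pi\<^sup>2)) * legendre_P \<nu> (2 * \<beta> - 1)
         * seg_integral 0 1 (\<lambda>U.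
             seg_integral 0 U (\<lambda>W.
               seg_integral W 1 (\<lambda>V. 1 / YY (- \<nu> - 1) \<alpha> V) * (1 / YY \<nu> \<alpha> W))
             * (1 / YY (- \<nu> - 1) \<beta> U))
     - complex_of_real (sin (\<nu> * pi)) * legendre_P \<nu> (1 - 2 * \<alpha>)
           * legendre_P \<nu> (2 * \<beta> - 1) / (2 * pi)
         * seg_integral 0 (1 / \<alpha>) (\<lambda>U.
             1 / (U powr (\<nu> + 1) * (1 - \<alpha> * U) powr (\<nu> + 1))
             * seg_integral U 1 (\<lambda>u.
                 u powr \<nu> / (1 - \<beta> * u) powr (- \<nu>)
                 * ((1 - U) / (1 - u)) powr \<nu> * (1 / (1 - u))))
     - complex_of_real (sin (\<nu> * pi)) * legendre_P \<nu> (1 - 2 * \<alpha>)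
           * legendre_P \<nu> (2 * \<beta> - 1) / (2 * pi)
         * seg_integral 0 (1 / \<alpha>) (\<lambda>U.
             1 / (U powr (- \<nu>) * (1 - \<alpha> * U) powr (- \<nu>))
             * seg_integral U 1 (\<lambda>u.
                 u powr (- \<nu> - 1) / (1 - \<beta> * u) powr (\<nu> + 1)
                 * ((1 - U) / (1 - u)) powr (- \<nu> - 1) * (1 / (1 - u))))"
proof -
  note r = assms(1,2)
  have r': "-1 < - \<nu> - 1" "- \<nu> - 1 < 0" using r by auto
  have a: "0 < \<alpha>" "\<alpha> < 1" and b: "0 \<le> \<beta>" "\<beta> < \<alpha>" "\<beta> < 1" using assms by auto
  define f where "f = legendre_integral \<nu>"
  define B where "B = Beta (\<nu> + 1) (- \<nu>)"
  have B: "0 < B" using Beta_pos[OF r] by (simp add: B_def)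
  define s where "s = sin (\<nu> * pi)"
  have sB: "B = - pi / s" using Beta_reflection[OF r] by (simp add: B_def s_def)
  \<comment> \<open>If \<open>s\<close> were 0, division by zero would give \<open>B = 0\<close>,
    against \<open>B > 0\<close>; so the relation can be inverted.\<close>
  then have s: "s = - pi / B" using B by (cases "s = 0") (auto simp: field_simps)
  have P: "legendre_P (of_real \<nu>) (of_real (1 - 2 * t)) = of_real (f t / B)" if "0 \<le> t" "t < 1" for t
    using legendre_P_eq(1)[OF r that] by (simp add: f_def B_def)
  have Q: "legendre_P (of_real \<nu>) (of_real (2 * t - 1)) = of_real (f (1 - t) / B)" if "0 < t" "t \<le> 1" for t
    using legendre_P_eq(2)[OF r, of "1 - t"] that by (simp add: f_def B_def)
  \<comment> \<open>Aligns the exponents produced by instantiating the lemmas with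
    \<open>- \<nu> - 1\<close> with those of the theorem.\<close>
  have e: "-1 - \<nu> = - \<nu> - 1" "-1 - (- \<nu> - 1) = \<nu>" "- \<nu> - 1 + 1 = - \<nu>" "- (- \<nu> - 1) = \<nu> + 1" by simp_all
  obtain I1 I2 where
    I1: "((\<lambda>t. (legendre_integral \<nu> t)\<^sup>2 / (t - \<alpha>)) has_integral I1) {0..\<beta>}" and
    I2: "((\<lambda>t. legendre_integral \<nu> t * legendre_integral \<nu> (1 - t) / (t - \<alpha>)) has_integral I2) {0..\<beta>}" and
    main: "legendre_integral \<nu> (1 - \<beta>) * I1 - legendre_integral \<nu> \<beta> * I2
      = Beta (\<nu> + 1) (- \<nu>) / 2 * (triple_integral \<nu> \<alpha> \<beta> + triple_integral (-1 - \<nu>) \<alpha> \<beta>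
          - (legendre_integral \<nu> (1 - \<alpha>))\<^sup>2 * legendre_integral \<nu> \<beta>)"
    by (rule variation_of_parameters[OF r assms(3-5)])
  note main = main[unfolded e, folded f_def B_def] and I = I1[folded f_def] I2[folded f_def]
  \<comment> \<open>Each integrand contains two normalised Legendre functions, hence
    \<open>B\<^sup>2\<close>. Agreement is asked on the open interval because P(2t-1) lies on the
    cut at t = 0.\<close>
  have seg: "seg_integral 0 (of_real \<beta>) h = of_real (i / B\<^sup>2)"
    if i: "(k has_integral i) {0..\<beta>}" and h: "\<And>t. 0 < t \<Longrightarrow> t < \<beta> \<Longrightarrow> h (of_real t) = of_real (k t / B\<^sup>2)" for h k i
  proof -
    have "((\<lambda>t. k t / B\<^sup>2) has_integral i / B\<^sup>2) {0<..<\<beta>}"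
      using has_integral_divide[OF i] by (simp add: has_integral_Icc_iff_Ioo)
    then have "((\<lambda>t. complex_of_real (k t / B\<^sup>2)) has_integral of_real (i / B\<^sup>2)) {0<..<\<beta>}"
      by (rule has_integral_of_real)
    then have "((\<lambda>t. h (of_real t)) has_integral of_real (i / B\<^sup>2)) {0<..<\<beta>}"
      by (rule has_integral_eq[rotated]) (simp add: h)
    then have "((\<lambda>t. h (of_real t)) has_integral of_real (i / B\<^sup>2)) {0..\<beta>}"
      by (simp add: has_integral_Icc_iff_Ioo)
    then show ?thesis
      using assms by (subst contour_integral_linepath_Reals_eq) (auto simp: integral_unique)
  qed
  have L1: "seg_integral 0 (of_real \<beta>) (\<lambda>t. (legendre_P (of_real \<nu>) (1 - 2 * t))\<^sup>2 / (t - of_real \<alpha>)) = of_real (I1 / B\<^sup>2)"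
  proof (rule seg[OF I(1)])
    fix t assume "0 < t" "t < \<beta>"
    then show "(legendre_P (of_real \<nu>) (1 - 2 * of_real t))\<^sup>2 / (of_real t - of_real \<alpha>) = of_real ((f t)\<^sup>2 / (t - \<alpha>) / B\<^sup>2)"
      using P[of t] assms by (simp add: power_divide)
  qed
  have L2: "seg_integral 0 (of_real \<beta>) (\<lambda>t. legendre_P (of_real \<nu>) (1 - 2 * t) * legendre_P (of_real \<nu>) (2 * t - 1) / (t - of_real \<alpha>))
      = of_real (I2 / B\<^sup>2)"
  proof (rule seg[OF I(2)])
    fix t assume "0 < t" "t < \<beta>"
    then show "legendre_P (of_real \<nu>) (1 - 2 * of_real t) * legendre_P (of_real \<nu>) (2 * of_real t - 1) / (of_real t - of_real \<alpha>)
        = of_real (f t * f (1 - t) / (t - \<alpha>) / B\<^sup>2)"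
      using P[of t] Q[of t] assms by (simp add: power2_eq_square)
  qed
  note O1 = seg_integral_ordered[OF r a b(1,2), unfolded e]
  note O2 = seg_integral_ordered[OF r' a b(1,2), unfolded e]
  note S1 = seg_integral_straddling[OF r a b(1,2)]
  note S2 = seg_integral_straddling[OF r' a b(1,2), unfolded e]
  have D1: "triple_integral \<nu> \<alpha> \<beta> = f \<alpha> * straddling_integral \<nu> \<alpha> \<beta> - ordered_integral \<nu> \<alpha> \<beta>"
    using straddling_decomposition[OF r a b(1,2)] by (simp add: f_def)
  have D2: "triple_integral (- \<nu> - 1) \<alpha> \<beta> = f \<alpha> * straddling_integral (- \<nu> - 1) \<alpha> \<beta> - ordered_integral (- \<nu> - 1) \<alpha> \<beta>"
    using straddling_decomposition[OF r' a b(1,2)] legendre_integral_reflect[OF r, unfolded e, of \<alpha>] a by (simp add: f_def)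
  \<comment> \<open>The variation-of-parameters identity multiplied by
    \<open>f (1 - \<beta>) / B ^ 4\<close>. With \<open>s = - pi / B\<close> the constants become
    powers of \<open>B\<close>: pi/(2s) = -B/2, s^2/(2 pi^2) = 1/(2 B^2) and s/(2 pi) =
    -1/(2B).\<close>
  have real_identity: "(f (1 - \<beta>) / B)\<^sup>2 * (I1 / B\<^sup>2) - f \<beta> / B * (f (1 - \<beta>) / B) * (I2 / B\<^sup>2)
    = pi * (f (1 - \<alpha>) / B)\<^sup>2 * (f \<beta> / B) * (f (1 - \<beta>) / B) / (2 * s)
      - s\<^sup>2 / (2 * pi\<^sup>2) * (f (1 - \<beta>) / B) * ordered_integral \<nu> \<alpha> \<beta>
      - s\<^sup>2 / (2 * pi\<^sup>2) * (f (1 - \<beta>) / B) * ordered_integral (- \<nu> - 1) \<alpha> \<beta>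
      - s * (f \<alpha> / B) * (f (1 - \<beta>) / B) / (2 * pi) * straddling_integral \<nu> \<alpha> \<beta>
      - s * (f \<alpha> / B) * (f (1 - \<beta>) / B) / (2 * pi) * straddling_integral (- \<nu> - 1) \<alpha> \<beta>"
    (is "?l = ?r")
  proof -
    have "?l = f (1 - \<beta>) / B ^ 4 * (f (1 - \<beta>) * I1 - f \<beta> * I2)"
      using B by (simp add: field_simps power2_eq_square power4_eq_xxxx)
    also have "\<dots> = f (1 - \<beta>) / (2 * B ^ 3) * (triple_integral \<nu> \<alpha> \<beta> + triple_integral (- \<nu> - 1) \<alpha> \<beta> - (f (1 - \<alpha>))\<^sup>2 * f \<beta>)"
      unfolding main using B by (simp add: power4_eq_xxxx power3_eq_cube)
    also have "\<dots> = ?r"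
    proof -
      have k: "s\<^sup>2 / (2 * pi\<^sup>2) = 1 / (2 * B\<^sup>2)" "s * (f \<alpha> / B) * (f (1 - \<beta>) / B) / (2 * pi) = - (f \<alpha> * f (1 - \<beta>) / (2 * B ^ 3))"
        "pi * (f (1 - \<alpha>) / B)\<^sup>2 * (f \<beta> / B) * (f (1 - \<beta>) / B) / (2 * s) = - ((f (1 - \<alpha>))\<^sup>2 * f \<beta> * f (1 - \<beta>) / (2 * B ^ 3))"
        unfolding s using B by (simp_all add: field_simps power2_eq_square power3_eq_cube)
      show ?thesis
        unfolding k D1 D2 using B by (simp add: field_simps power2_eq_square power3_eq_cube)
    qed
    finally show ?thesis .
  qed
  note PB = P[OF b(1,3)] and PA = P[OF less_imp_le[OF a(1)] a(2)]
    and QB = Q[OF assms(3) less_imp_le[OF b(3)]] and QA = Q[OF a(1) less_imp_le[OF a(2)]]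
  have e5: "complex_of_real (1 / \<alpha>) = 1 / of_real \<alpha>" by simp
  show ?thesis
    unfolding e5 L1 L2 O1 O2 S1 S2 PB PA QB QA
    using arg_cong[OF real_identity[unfolded s_def], of complex_of_real]
    by (simp only: of_real_add of_real_diff of_real_mult of_real_divide of_real_power of_real_minus)
qed

end
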